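(* Let $N\ge 1$ and $m\ge 1$ be integers, let $1<p<\infty$, and let $K\subset\mathbb{R}^N$ be a bounded, convex, symmetric set containing the origin and with nonempty interior. Let $f\in W^{m,p}(\mathbb{R}^N)$. Then $$\lim_{\delta\to 0^+}\ \iint_{\{(x,y)\in\mathbb{R}^N\times\mathbb{R}^N:\ |R_{m-1} f(x,y)|>\delta\}}\frac{\delta^p}{\|x-y\|_K^{N+mp}}\,dx\,dy=\frac{N+mp}{(m!)^p\,mp}\int_{\mathbb{R}^N}\int_K |D^m f(x)(y,\dots,y)|^p\,dy\,dx.$$
   Context: Symmetric means $K=-K$. $\|\cdot\|_K$ is the norm on $\mathbb{R}^N$ with unit ball $K$: $\|x\|_K=\inf\{\lambda>0: x/\lambda\in K\}$. $W^{m,p}(\mathbb{R}^N)$ is the usual Sobolev space. For $\sigma=(\sigma_1,\dots,\sigma_N)\in\mathbb{R}^N$ and a.e. $x$, $$D^m f(x)(\sigma,\dots,\sigma)=\sum_{1\le i_1,\dots,i_m\le N}\sigma_{i_1}\cdots\sigma_{i_m}\frac{\partial^m f}{\partial x_{i_1}\cdots\partial x_{i_m}}(x)$$ (weak derivatives). The Taylor remainder is $$R_{m-1}f(x,y)=f(x)-T_y^{m-1}f(x),\qquad T_y^{m-1}f(x)=\sum_{|\alpha|\le m-1}D^\alpha f(y)\frac{(x-y)^\alpha}{\alpha!},$$ with multi-indices $\alpha$ and weak derivatives $D^\alpha f$ (so it is defined for a.e. $(x,y)$). *)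

theory Defs
  imports "HOL-Analysis.Analysis"
begin

section \<open>Multi-indices\<close>

type_synonym 'n multi_index = "'n \<Rightarrow> nat"

definition mi_order :: "('n::finite) multi_index \<Rightarrow> nat" where
  "mi_order \<alpha> = (\<Sum>i\<in>UNIV. \<alpha> i)"

definition mi_fact :: "('n::finite) multi_index \<Rightarrow> real" where
  "mi_fact \<alpha> = (\<Prod>i\<in>UNIV. fact (\<alpha> i))"

definition mi_power :: "real ^ ('n::finite) \<Rightarrow> 'n multi_index \<Rightarrow> real" where
  "mi_power v \<alpha> = (\<Prod>i\<in>UNIV. (v $ i) ^ \<alpha> i)"

lemma finite_mi_order_le: "finite {\<alpha> :: ('n::finite) multi_index. mi_order \<alpha> \<le> k}"
proof (rule finite_subset)
  show "{\<alpha> :: 'n multi_index. mi_order \<alpha> \<le> k} \<subseteq> PiE UNIV (\<lambda>_. {..k})"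
  proof
    fix \<alpha> :: "'n multi_index" assume a: "\<alpha> \<in> {\<alpha>. mi_order \<alpha> \<le> k}"
    have "\<alpha> i \<le> mi_order \<alpha>" for i
      unfolding mi_order_def by (rule member_le_sum) auto
    with a show "\<alpha> \<in> PiE UNIV (\<lambda>_. {..k})"
      by (auto intro: le_trans)
  qed
  show "finite (PiE (UNIV :: 'n set) (\<lambda>_. {..k}))"
    by (intro finite_PiE) auto
qed

lemma ex_list_of_multi_index:
  fixes \<alpha> :: "('n::finite) multi_index"
  shows "\<exists>is. count_list is = \<alpha>"
proof -
  define M where "M = (\<Sum>i\<in>(UNIV :: 'n set). replicate_mset (\<alpha> i) i)"
  obtain "is" where "mset is = M" using ex_mset by blast
  hence "count_list is i = \<alpha> i" for i
    by (simp add: M_def count_sum flip: count_mset)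
  thus ?thesis by blast
qed


section \<open>Classical partial derivatives and test functions\<close>

definition partial_deriv :: "'n \<Rightarrow> (real ^ ('n::finite) \<Rightarrow> real) \<Rightarrow> real ^ 'n \<Rightarrow> real" where
  "partial_deriv i f x = deriv (\<lambda>t. f (x + t *\<^sub>R axis i 1)) 0"

primrec iter_partial_deriv ::
    "'n list \<Rightarrow> (real ^ ('n::finite) \<Rightarrow> real) \<Rightarrow> real ^ 'n \<Rightarrow> real" where
  "iter_partial_deriv [] f = f"
| "iter_partial_deriv (i # is) f = partial_deriv i (iter_partial_deriv is f)"

text \<open>
  A function is \<open>C\<^sup>\<infinity>\<close> iff each of its iterated partial derivatives is (Frechet) differentiable
  everywhere: this makes all partial derivatives of all orders exist and be continuous.
\<close>

definition smooth :: "(real ^ ('n::finite) \<Rightarrow> real) \<Rightarrow> bool" where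
  "smooth f \<longleftrightarrow> (\<forall>is. iter_partial_deriv is f differentiable_on UNIV)"

definition test_function :: "(real ^ ('n::finite) \<Rightarrow> real) \<Rightarrow> bool" where
  "test_function \<phi> \<longleftrightarrow> smooth \<phi> \<and> compact (closure {x. \<phi> x \<noteq> 0})"

text \<open>
  The partial derivative of a smooth function belonging to a multi-index \<open>\<alpha>\<close>. The index type is not
  ordered, so an arbitrary order of differentiation is chosen, in which each coordinate \<open>i\<close> occurs
  \<open>\<alpha> i\<close> times; for smooth functions the order is irrelevant.
\<close>

definition mi_deriv ::
    "('n::finite) multi_index \<Rightarrow> (real ^ 'n \<Rightarrow> real) \<Rightarrow> real ^ 'n \<Rightarrow> real" where
  "mi_deriv \<alpha> \<phi> = iter_partial_deriv (SOME is. count_list is = \<alpha>) \<phi>"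


section \<open>Weak derivatives and Sobolev spaces\<close>

definition locally_integrable :: "(real ^ ('n::finite) \<Rightarrow> real) \<Rightarrow> bool" where
  "locally_integrable f \<longleftrightarrow> (\<forall>C. compact C \<longrightarrow> f absolutely_integrable_on C)"

definition has_weak_deriv ::
    "(real ^ ('n::finite) \<Rightarrow> real) \<Rightarrow> 'n multi_index \<Rightarrow> (real ^ 'n \<Rightarrow> real) \<Rightarrow> bool" where
  "has_weak_deriv f \<alpha> g \<longleftrightarrow>
     locally_integrable f \<and> locally_integrable g \<and>
     (\<forall>\<phi>. test_function \<phi> \<longrightarrow>
        (LINT x|lebesgue. f x * mi_deriv \<alpha> \<phi> x) =
        (-1) ^ mi_order \<alpha> * (LINT x|lebesgue. g x * \<phi> x))"

text \<open>
  Weak derivatives are only determined up to null sets; \<open>weak_deriv\<close> picks a representative.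
  In particular \<open>weak_deriv (\<lambda>_. 0) f\<close> agrees with \<open>f\<close> almost everywhere, but possibly not everywhere.
\<close>

definition weak_deriv ::
    "('n::finite) multi_index \<Rightarrow> (real ^ 'n \<Rightarrow> real) \<Rightarrow> real ^ 'n \<Rightarrow> real" where
  "weak_deriv \<alpha> f = (SOME g. has_weak_deriv f \<alpha> g)"

definition Lp_space :: "real \<Rightarrow> (real ^ ('n::finite) \<Rightarrow> real) set" where
  "Lp_space p = {f \<in> borel_measurable lebesgue. integrable lebesgue (\<lambda>x. \<bar>f x\<bar> powr p)}"

definition sobolev_space :: "nat \<Rightarrow> real \<Rightarrow> (real ^ ('n::finite) \<Rightarrow> real) set" where
  "sobolev_space m p =
     {f \<in> Lp_space p. \<forall>\<alpha>. mi_order \<alpha> \<le> m \<longrightarrow> (\<exists>g \<in> Lp_space p. has_weak_deriv f \<alpha> g)}"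


section \<open>Taylor remainders and the form of top order derivatives\<close>

definition taylor_poly ::
    "nat \<Rightarrow> (real ^ ('n::finite) \<Rightarrow> real) \<Rightarrow> real ^ 'n \<Rightarrow> real ^ 'n \<Rightarrow> real" where
  "taylor_poly k f y x =
     (\<Sum>\<alpha> | mi_order \<alpha> \<le> k. weak_deriv \<alpha> f y * (mi_power (x - y) \<alpha> / mi_fact \<alpha>))"

definition taylor_remainder ::
    "nat \<Rightarrow> (real ^ ('n::finite) \<Rightarrow> real) \<Rightarrow> real ^ 'n \<Rightarrow> real ^ 'n \<Rightarrow> real" where
  "taylor_remainder k f x y = f x - taylor_poly k f y x"

text \<open>
  Lists of length \<open>m\<close> are the index tuples \<open>(i\<^sub>1, \<dots>, i\<^sub>m)\<close>; the weak derivative with respect to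
  \<open>x\<^bsub>i1\<^esub>, \<dots>, x\<^bsub>im\<^esub>\<close> is the one whose multi-index counts the occurrences of each coordinate.
\<close>

definition deriv_form ::
    "nat \<Rightarrow> (real ^ ('n::finite) \<Rightarrow> real) \<Rightarrow> real ^ 'n \<Rightarrow> real ^ 'n \<Rightarrow> real" where
  "deriv_form m f x \<sigma> =
     (\<Sum>is | length is = m. (\<Prod>i\<leftarrow>is. \<sigma> $ i) * weak_deriv (count_list is) f x)"


section \<open>The norm with unit ball \<open>K\<close>\<close>

text \<open>
  As \<open>norm_of_ball K 0 = 0\<close>, a kernel with a negative power of \<open>norm_of_ball K (x - y)\<close> is, in HOL,
  zero rather than infinite on the diagonal; the diagonal is a null set.
\<close>

definition norm_of_ball :: "(real ^ ('n::finite)) set \<Rightarrow> real ^ 'n \<Rightarrow> real" where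
  "norm_of_ball K x = Inf {r. r > 0 \<and> x /\<^sub>R r \<in> K}"

end

theory Submission
  imports Defs "HOL-Combinatorics.Multiset_Permutations"
begin

text \<open>
  Write \<open>G\<^sub>h(y) = D\<^sup>m f(y)(h,\<dots>,h)\<close>, let \<open>\<Phi>(h)\<close> be \<open>\<parallel>h\<parallel>\<^sub>K\<close> to the power \<open>-(N + mp)\<close>, and put \<open>\<epsilon>\<^sup>m = \<delta>\<close>.
  The kernel is homogeneous, so the substitution \<open>x = y + \<epsilon> h\<close> absorbs every power of \<open>\<delta>\<close>: the
  double integral is \<open>\<integral> \<Phi>(h) |{y. |R(y + \<epsilon> h, y)| > \<delta>}| dh\<close> (\<open>nn_integral_ball_kernel_rescale\<close>). Taylor's
  formula with integral remainder holds for Sobolev functions in the following form: for every \<open>h\<close>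
  and almost every \<open>y\<close>, \<open>R(y + \<epsilon> h, y)\<close> is \<open>\<epsilon>\<^sup>m\<close> times the weighted mean
  \<open>M\<^sub>\<epsilon> G\<^sub>h(y) = \<integral>\<^sub>0\<^sup>1 w(t) G\<^sub>h(y + t \<epsilon> h) dt\<close> with \<open>w(t) = (1 - t)\<^sup>m\<^sup>-\<^sup>1 / (m - 1)!\<close>
  (\<open>weak_taylor_formula\<close>, proved by moving all derivatives onto test functions). The double integral
  therefore equals \<open>\<integral> \<Phi>(h) |{y. |M\<^sub>\<epsilon> G\<^sub>h(y)| > 1}| dh\<close>, and \<open>M\<^sub>\<epsilon> G\<^sub>h\<close> tends to \<open>G\<^sub>h / m!\<close>.

  Writing \<open>\<Phi>(h)\<close> as an integral over all dilates of \<open>K\<close> that contain \<open>h\<close> gives a substitute for polar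
  coordinates (\<open>nn_integral_norm_of_ball_kernel\<close>). As \<open>G\<^sub>h\<close> is homogeneous of degree \<open>m\<close> in \<open>h\<close>, it yields
  \<open>\<integral> \<Phi>(h) |{|G\<^sub>h| > a}| dh = (N + mp) / (mp) a\<^sup>-\<^sup>p \<integral> \<integral>\<^sub>K |G\<^sub>k(y)|\<^sup>p dk dy\<close> (\<open>kernel_level_integral\<close>), and \<open>a = m!\<close>
  is the value claimed for the limit.

  The passage to the limit is a sandwich: up to the set where \<open>|M\<^sub>\<epsilon> G\<^sub>h - G\<^sub>h / m!| \<ge> \<theta>\<close>, the set
  \<open>{|M\<^sub>\<epsilon> G\<^sub>h| > 1}\<close> lies between \<open>{|G\<^sub>h| / m! > 1 + \<theta>}\<close> and \<open>{|G\<^sub>h| / m! > 1 - \<theta>}\<close>, whose \<open>\<Phi>\<close>-integrals are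
  \<open>(1 \<plusminus> \<theta>)\<^sup>-\<^sup>p\<close> times the limit. To bound the exceptional set, drop the part of \<open>G\<^sub>h\<close> of size at most
  \<open>\<theta>/4\<close>, which changes the deviation by at most \<open>\<theta>/2\<close>, and apply Chebyshev's inequality in \<open>L\<^sup>1\<close> to the
  rest. For each \<open>h\<close> the resulting bound tends to \<open>0\<close> because translations are continuous in \<open>L\<^sup>1\<close>,
  and it is dominated by a multiple of \<open>\<integral>\<^sub>{|G\<^sub>h| > \<theta>/4} |G\<^sub>h|\<close>, uniformly in \<open>\<epsilon>\<close>. The \<open>\<Phi>\<close>-integral of the
  latter is again a multiple of \<open>\<integral> \<integral>\<^sub>K |G\<^sub>k|\<^sup>p\<close>: along each ray it is \<open>\<integral> s\<^sup>m s\<^sup>-\<^sup>m\<^sup>p\<^sup>-\<^sup>1 ds\<close> over a half-line that stays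
  away from \<open>0\<close>, which converges exactly because \<open>p > 1\<close> (\<open>kernel_truncated_integral\<close>).
\<close>

section \<open>Smooth functions and test functions\<close>

lemma iter_partial_deriv_append:
  "iter_partial_deriv (is @ js) f = iter_partial_deriv is (iter_partial_deriv js f)"
  by (induction "is") auto

lemma smooth_partial_deriv: "smooth f \<Longrightarrow> smooth (partial_deriv i f)"
  unfolding smooth_def
  using iter_partial_deriv_append[of _ "[i]" f] by (metis iter_partial_deriv.simps)

lemma smooth_iter: "smooth f \<Longrightarrow> smooth (iter_partial_deriv is f)"
  by (induction "is") (auto intro: smooth_partial_deriv)

lemma smooth_differentiable: "smooth f \<Longrightarrow> f differentiable at x"
  unfolding smooth_def differentiable_on_def by (drule spec[of _ "[]"]) simp

lemma smooth_continuous_on: "smooth f \<Longrightarrow> continuous_on S f"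
  by (intro continuous_at_imp_continuous_on ballI differentiable_imp_continuous_within smooth_differentiable)

text \<open>
  Smoothness is a coinductive property: it suffices to exhibit a set of differentiable functions
  that is closed under partial derivatives. For a product such a set consists of the finite sums of
  products of smooth functions, for a function of one coordinate of the multiples of its derivatives.
\<close>
lemma smooth_coinduct:
  assumes "f \<in> X"
    and "\<And>g x. g \<in> X \<Longrightarrow> g differentiable at x"
    and "\<And>g i. g \<in> X \<Longrightarrow> partial_deriv i g \<in> X"
  shows "smooth f"
proof -
  have "iter_partial_deriv is f \<in> X" for "is"
    by (induction "is") (use assms in auto)
  thus ?thesis unfolding smooth_def differentiable_on_def using assms(2) by auto
qed

lemma has_derivative_line:
  fixes f :: "real ^ ('n::finite) \<Rightarrow> real"
  assumes "(f has_derivative D) (at (x + t *\<^sub>R h))"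
  shows "((\<lambda>s. f (x + s *\<^sub>R h)) has_real_derivative D h) (at t)"
proof -
  have "((\<lambda>s. x + s *\<^sub>R h) has_derivative (\<lambda>s. s *\<^sub>R h)) (at t)"
    by (auto intro!: derivative_eq_intros)
  from diff_chain_at[OF this assms] have "((\<lambda>s. f (x + s *\<^sub>R h)) has_derivative (\<lambda>s. D (s *\<^sub>R h))) (at t)"
    by (simp add: o_def)
  moreover have "D (s *\<^sub>R h) = D h * s" for s
    using has_derivative_linear[OF assms] by (simp add: linear_cmul)
  ultimately show ?thesis by (simp add: has_field_derivative_def)
qed

lemma partial_deriv_eq:
  assumes "((\<lambda>t. f (x + t *\<^sub>R axis i 1)) has_real_derivative d) (at 0)"
  shows "partial_deriv i f x = d"
  using assms DERIV_imp_deriv unfolding partial_deriv_def by blast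

lemma partial_deriv_at:
  assumes "f differentiable at (x :: real ^ ('n::finite))"
  shows "((\<lambda>t. f (x + t *\<^sub>R axis i 1)) has_real_derivative partial_deriv i f x) (at 0)"
proof -
  obtain D where "(f has_derivative D) (at (x + 0 *\<^sub>R axis i 1))"
    using assms by (auto simp: differentiable_def)
  from has_derivative_line[OF this] show ?thesis using partial_deriv_eq by metis
qed

lemma smooth_mult:
  fixes f g :: "real ^ ('n::finite) \<Rightarrow> real"
  assumes "smooth f" "smooth g"
  shows "smooth (\<lambda>x. f x * g x)"
proof -
  define X where "X = {u :: real ^ 'n \<Rightarrow> real. \<exists>n F G. (\<forall>k<n::nat. smooth (F k) \<and> smooth (G k)) \<and> u = (\<lambda>x. \<Sum>k<n. F k x * G k x)}"
  show ?thesis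
  proof (rule smooth_coinduct[of _ X])
    show "(\<lambda>x. f x * g x) \<in> X" unfolding X_def
      apply (rule CollectI, rule exI[of _ "1::nat"], rule exI[of _ "\<lambda>_. f"], rule exI[of _ "\<lambda>_. g"])
      using assms by auto
  next
    fix u x assume "u \<in> X"
    then obtain n F G where s: "\<forall>k<n::nat. smooth (F k) \<and> smooth (G k)" and u: "u = (\<lambda>x. \<Sum>k<n. F k x * G k x)"
      unfolding X_def by auto
    show "u differentiable at x" unfolding u
      by (rule differentiable_sum) (use s in \<open>auto intro!: differentiable_mult intro: smooth_differentiable\<close>)
  next
    fix u i assume "u \<in> X"
    then obtain n F G where s: "\<forall>k<n::nat. smooth (F k) \<and> smooth (G k)" and u: "u = (\<lambda>x. \<Sum>k<n. F k x * G k x)"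
      unfolding X_def by auto
    \<comment> \<open>The product rule turns each summand into two; they are listed as two blocks of length \<open>n\<close>.\<close>
    define F' where "F' k = (if k < n then partial_deriv i (F k) else F (k - n))" for k
    define G' where "G' k = (if k < n then G k else partial_deriv i (G (k - n)))" for k
    have "partial_deriv i u x = (\<Sum>k<n+n. F' k x * G' k x)" for x
    proof (rule partial_deriv_eq)
      have "((\<lambda>t. \<Sum>k<n. F k (x + t *\<^sub>R axis i 1) * G k (x + t *\<^sub>R axis i 1)) has_real_derivative
          (\<Sum>k<n. partial_deriv i (F k) x * G k (x + 0 *\<^sub>R axis i 1) + partial_deriv i (G k) x * F k (x + 0 *\<^sub>R axis i 1))) (at 0)"
        using s by (intro DERIV_sum DERIV_mult partial_deriv_at smooth_differentiable) auto
      also have "(\<Sum>k<n. partial_deriv i (F k) x * G k (x + 0 *\<^sub>R axis i 1) + partial_deriv i (G k) x * F k (x + 0 *\<^sub>R axis i 1))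
          = (\<Sum>k<n+n. F' k x * G' k x)"
      proof -
        have "(\<Sum>k<n+n. F' k x * G' k x) = (\<Sum>k<n. F' k x * G' k x) + (\<Sum>k=n..<n+n. F' k x * G' k x)"
          by (simp add: lessThan_atLeast0 sum.atLeastLessThan_concat)
        also have "(\<Sum>k=n..<n+n. F' k x * G' k x) = (\<Sum>k<n. F' (k+n) x * G' (k+n) x)"
          using sum.shift_bounds_nat_ivl[of "\<lambda>k. F' k x * G' k x" 0 n n] by (simp add: lessThan_atLeast0)
        finally show ?thesis by (simp add: F'_def G'_def sum.distrib mult.commute)
      qed
      finally show "((\<lambda>t. u (x + t *\<^sub>R axis i 1)) has_real_derivative (\<Sum>k<n+n. F' k x * G' k x)) (at 0)"
        unfolding u .
    qed
    moreover have "\<forall>k<n+n. smooth (F' k) \<and> smooth (G' k)"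
      using s by (auto simp: F'_def G'_def intro: smooth_partial_deriv)
    ultimately show "partial_deriv i u \<in> X" unfolding X_def by blast
  qed
qed

lemma smooth_const: "smooth (\<lambda>x :: real ^ ('n::finite). c)"
  by (rule smooth_coinduct[of _ "range (\<lambda>c x. c)"]) (auto simp: partial_deriv_def[abs_def])

lemma smooth_prod:
  fixes F :: "'a \<Rightarrow> real ^ ('n::finite) \<Rightarrow> real"
  assumes "finite A" "\<And>j. j \<in> A \<Longrightarrow> smooth (F j)"
  shows "smooth (\<lambda>x. \<Prod>j\<in>A. F j x)"
  using assms by (induction A rule: finite_induct) (auto intro: smooth_const smooth_mult)

lemma smooth_of_coordinate:
  fixes d :: "nat \<Rightarrow> real \<Rightarrow> real"
  assumes d: "\<And>k x. (d k has_real_derivative d (Suc k) x) (at x)"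
  shows "smooth (\<lambda>x :: real ^ ('n::finite). d 0 (c * x $ j + e))"
proof (rule smooth_coinduct[of _ "range (\<lambda>(a, k) x. a * d k (c * x $ j + e))"])
  show "(\<lambda>x :: real ^ 'n. d 0 (c * x $ j + e)) \<in> range (\<lambda>(a, k) x. a * d k (c * x $ j + e))"
    by (auto intro!: image_eqI[of _ _ "(1, 0)"])
next
  fix g :: "real ^ 'n \<Rightarrow> real" and x
  assume "g \<in> range (\<lambda>(a, k) x. a * d k (c * x $ j + e))"
  then obtain a k where g: "g = (\<lambda>x. a * d k (c * x $ j + e))" by auto
  have "((\<lambda>x :: real ^ 'n. c * x $ j + e) has_derivative (\<lambda>x. c * x $ j)) (at x)"
    by (auto intro!: derivative_eq_intros bounded_linear.has_derivative[OF bounded_linear_vec_nth])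
  moreover have "d k differentiable at (c * x $ j + e)"
    using d real_differentiable_def by blast
  ultimately show "g differentiable at x" unfolding g
    using differentiable_chain_at[of "\<lambda>x. c * x $ j + e" x "d k"]
    by (intro differentiable_mult differentiable_const) (auto simp: o_def differentiable_def)
next
  fix g :: "real ^ 'n \<Rightarrow> real" and i
  assume "g \<in> range (\<lambda>(a, k) x. a * d k (c * x $ j + e))"
  then obtain a k where g: "g = (\<lambda>x. a * d k (c * x $ j + e))" by auto
  have "partial_deriv i g x = (a * (if i = j then c else 0)) * d (Suc k) (c * x $ j + e)" for x
  proof (rule partial_deriv_eq)
    show "((\<lambda>t. g (x + t *\<^sub>R axis i 1)) has_real_derivative a * (if i = j then c else 0) * d (Suc k) (c * x $ j + e)) (at 0)"
      unfolding g by (auto intro!: derivative_eq_intros DERIV_chain2[OF d] simp: axis_def)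
  qed
  thus "partial_deriv i g \<in> range (\<lambda>(a, k) x. a * d k (c * x $ j + e))"
    by (auto intro!: image_eqI[of _ _ "(a * (if i = j then c else 0), Suc k)"])
qed

text \<open>
  The flat function \<open>exp (- 1 / x)\<close>, extended by \<open>0\<close> to \<open>x \<le> 0\<close>: its \<open>k\<close>-th derivative is
  \<open>P\<^sub>k (1 / x) exp (- 1 / x)\<close>, and differentiating this expression replaces \<open>P\<close> by \<open>X\<^sup>2 (P - P')\<close>.
\<close>
definition flat_poly :: "nat \<Rightarrow> real poly" where
  "flat_poly k = ((\<lambda>P. [:0, 0, 1:] * (P - pderiv P)) ^^ k) 1"

definition flat_deriv :: "nat \<Rightarrow> real \<Rightarrow> real" where
  "flat_deriv k x = (if x > 0 then poly (flat_poly k) (1 / x) * exp (- 1 / x) else 0)"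

lemma poly_times_exp_minus_tendsto_0:
  fixes P :: "real poly"
  shows "((\<lambda>z. poly P z * exp (- z)) \<longlongrightarrow> 0) at_top"
proof -
  have "((\<lambda>z. \<Sum>i\<le>degree P. coeff P i * (z ^ i / exp z)) \<longlongrightarrow> (\<Sum>i\<le>degree P. coeff P i * 0)) at_top"
    by (intro tendsto_intros tendsto_power_div_exp_0)
  thus ?thesis
    by (simp add: poly_altdef exp_minus sum_distrib_right divide_inverse mult.assoc)
qed

text \<open>
  Only the point \<open>0\<close> needs an argument: there the difference quotient from the right is a polynomial
  in \<open>1 / y\<close> times \<open>exp (- 1 / y)\<close>, hence tends to \<open>0\<close>.
\<close>
lemma flat_deriv_has_derivative: "(flat_deriv k has_real_derivative flat_deriv (Suc k) x) (at x)"
proof -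
  consider "x > 0" | "x < 0" | "x = 0" by linarith
  thus ?thesis
  proof cases
    case 1
    have "((\<lambda>x. poly (flat_poly k) (1 / x) * exp (- 1 / x)) has_real_derivative flat_deriv (Suc k) x) (at x)"
      using 1 by (auto intro!: derivative_eq_intros DERIV_chain2[OF poly_DERIV] simp: flat_deriv_def flat_poly_def field_simps power2_eq_square)
    thus ?thesis
      by (rule has_field_derivative_transform_within_open[of _ _ _ "{0<..}"]) (use 1 in \<open>auto simp: flat_deriv_def\<close>)
  next
    case 2
    have "((\<lambda>_. 0) has_real_derivative flat_deriv (Suc k) x) (at x)"
      using 2 by (auto simp: flat_deriv_def)
    thus ?thesis
      by (rule has_field_derivative_transform_within_open[of _ _ _ "{..<0}"]) (use 2 in \<open>auto simp: flat_deriv_def\<close>)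
  next
    case 3
    have "((\<lambda>y. flat_deriv k y / y) \<longlongrightarrow> 0) (at_right 0)"
    proof -
      have "((\<lambda>y. poly (pCons 0 (flat_poly k)) (inverse y) * exp (- inverse y)) \<longlongrightarrow> 0) (at_right 0)"
        by (rule filterlim_compose[OF poly_times_exp_minus_tendsto_0 filterlim_inverse_at_top_right])
      thus ?thesis
        by (rule Lim_transform_eventually)
           (auto intro!: eventually_at_rightI[of 0 1] simp: flat_deriv_def field_simps)
    qed
    moreover have "((\<lambda>y. flat_deriv k y / y) \<longlongrightarrow> 0) (at_left 0)"
      by (rule Lim_transform_eventually[OF tendsto_const])
         (auto intro!: eventually_at_leftI[of "-1" 0] simp: flat_deriv_def)
    ultimately have "((\<lambda>y. flat_deriv k y / y) \<longlongrightarrow> 0) (at 0)"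
      by (simp add: filterlim_split_at)
    thus ?thesis using 3 by (simp add: has_field_derivative_iff flat_deriv_def)
  qed
qed

lemma flat_deriv_0: "flat_deriv 0 x = (if x > 0 then exp (- 1 / x) else 0)"
  by (simp add: flat_deriv_def flat_poly_def)

text \<open>
  The flat function is positive exactly on the positive half-line and tends to \<open>1\<close> at infinity.
  Speeding up its argument by the factor \<open>n + 1\<close> therefore makes these products increase to the
  indicator function of the open box.
\<close>
definition box_bump :: "real ^ 'n \<Rightarrow> real ^ 'n \<Rightarrow> nat \<Rightarrow> real ^ ('n::finite) \<Rightarrow> real" where
  "box_bump a b n x = (\<Prod>j\<in>UNIV. flat_deriv 0 (real (Suc n) * (x $ j - a $ j)) * flat_deriv 0 (real (Suc n) * (b $ j - x $ j)))"

lemma box_bump_bounds: "0 \<le> box_bump a b n x" "box_bump a b n x \<le> 1"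
  unfolding box_bump_def by (auto intro!: prod_nonneg prod_le_1 mult_le_one simp: flat_deriv_0)

lemma box_bump_outside: "x \<notin> box a b \<Longrightarrow> box_bump a b n x = 0"
proof -
  assume "x \<notin> box a b"
  then obtain j where "x $ j \<le> a $ j \<or> b $ j \<le> x $ j" by (auto simp: mem_box_cart not_less)
  hence "\<not> real (Suc n) * (x $ j - a $ j) > 0 \<or> \<not> real (Suc n) * (b $ j - x $ j) > 0"
    by (auto simp: not_less mult_le_0_iff zero_less_mult_iff)
  thus ?thesis unfolding box_bump_def
    by (intro prod_zero bexI[of _ j]) (auto simp: flat_deriv_0)
qed

lemma box_bump_tendsto:
  fixes x :: "real ^ ('a::finite)"
  shows "(\<lambda>n. box_bump a b n x) \<longlonglongrightarrow> indicator (box a b) x"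
proof (cases "x \<in> box a b")
  case True
  have *: "(\<lambda>n. flat_deriv 0 (real (Suc n) * c)) \<longlonglongrightarrow> 1" if "c > 0" for c
  proof -
    have "(\<lambda>n. exp (- (inverse (real (Suc n)) / c))) \<longlonglongrightarrow> exp (- (0 / c))"
      by (intro tendsto_intros LIMSEQ_inverse_real_of_nat) (use that in auto)
    moreover have "flat_deriv 0 (real (Suc n) * c) = exp (- (inverse (real (Suc n)) / c))" for n
    proof -
      have "real (Suc n) * c > 0" using that by simp
      thus ?thesis unfolding flat_deriv_0 by (simp add: divide_simps)
    qed
    ultimately show ?thesis by simp
  qed
  have "(\<lambda>n. flat_deriv 0 (real (Suc n) * (x $ j - a $ j)) * flat_deriv 0 (real (Suc n) * (b $ j - x $ j)))
      \<longlonglongrightarrow> 1 * 1" for j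
    by (intro tendsto_mult *) (use True in \<open>auto simp: mem_box_cart\<close>)
  hence "(\<lambda>n. box_bump a b n x) \<longlonglongrightarrow> (\<Prod>j\<in>(UNIV :: 'a set). 1 * 1)"
    unfolding box_bump_def by (rule tendsto_prod)
  thus ?thesis using True by simp
qed (simp add: box_bump_outside)

lemma test_function_box_bump: "test_function (box_bump a b n)"
proof -
  have "smooth (\<lambda>x. flat_deriv 0 (real (Suc n) * (x $ j - a $ j)))" for j
    using smooth_of_coordinate[of flat_deriv, OF flat_deriv_has_derivative, of "real (Suc n)" j "- real (Suc n) * a $ j"] by (simp add: algebra_simps)
  moreover have "smooth (\<lambda>x. flat_deriv 0 (real (Suc n) * (b $ j - x $ j)))" for j
    using smooth_of_coordinate[of flat_deriv, OF flat_deriv_has_derivative, of "- real (Suc n)" j "real (Suc n) * b $ j"] by (simp add: algebra_simps)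
  ultimately have "smooth (box_bump a b n)"
    unfolding box_bump_def[abs_def] by (intro smooth_prod smooth_mult) auto
  moreover have "{x. box_bump a b n x \<noteq> 0} \<subseteq> cbox a b"
    using box_bump_outside box_subset_cbox by blast
  hence "compact (closure {x. box_bump a b n x \<noteq> 0})"
    by (meson bounded_cbox bounded_subset compact_closure)
  ultimately show ?thesis by (simp add: test_function_def)
qed

section \<open>The fundamental lemma of the calculus of variations\<close>

lemma locally_integrable_lborel_iff:
  assumes [measurable]: "f \<in> borel_measurable borel"
  shows "locally_integrable f \<longleftrightarrow> (\<forall>C. compact C \<longrightarrow> integrable lborel (\<lambda>x. indicator C x * f x))"
proof -
  have "integrable lebesgue (\<lambda>x. indicator C x *\<^sub>R f x) \<longleftrightarrow> integrable lborel (\<lambda>x. indicator C x * f x)"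
    if "compact C" for C
  proof -
    have [measurable]: "C \<in> sets borel" using that by (rule borel_compact)
    have "integrable lebesgue (\<lambda>x. indicator C x *\<^sub>R f x) \<longleftrightarrow> integrable lborel (\<lambda>x. indicator C x *\<^sub>R f x)"
      by (rule integrable_completion) measurable
    thus ?thesis by (simp only: real_scaleR_def)
  qed
  thus ?thesis unfolding locally_integrable_def set_integrable_def by blast
qed

text \<open>
  The positive and the negative part of \<open>u\<close> are densities of two measures that agree, and are finite,
  on the intersection-stable generator of all boxes; so the measures and then the densities agree.
\<close>
lemma AE_eq_0_if_box_integrals_0:
  fixes u :: "real ^ ('n::finite) \<Rightarrow> real"
  assumes [measurable]: "u \<in> borel_measurable borel"
    and int: "\<And>a b. integrable lborel (\<lambda>x. indicator (box a b) x * u x)"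
    and z: "\<And>a b. (\<integral>x. indicator (box a b) x * u x \<partial>lborel) = 0"
  shows "AE x in lborel. u x = 0"
proof -
  let ?M = "density lborel (\<lambda>x. ennreal (u x))"
  let ?N = "density lborel (\<lambda>x. ennreal (- u x))"
  have em: "emeasure ?M (box a b) = emeasure ?N (box a b) \<and> emeasure ?M (box a b) \<noteq> \<infinity>" for a b
  proof -
    let ?v = "\<lambda>x. indicator (box a b) x * u x"
    have 1: "emeasure ?M (box a b) = (\<integral>\<^sup>+x. ennreal (?v x) \<partial>lborel)"
      by (subst emeasure_density) (auto intro!: nn_integral_cong simp: indicator_def)
    have 2: "emeasure ?N (box a b) = (\<integral>\<^sup>+x. ennreal (- ?v x) \<partial>lborel)"
      by (subst emeasure_density) (auto intro!: nn_integral_cong simp: indicator_def)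
    have f: "(\<integral>\<^sup>+x. ennreal (?v x) \<partial>lborel) \<noteq> \<infinity>" "(\<integral>\<^sup>+x. ennreal (- ?v x) \<partial>lborel) \<noteq> \<infinity>"
      using real_integrable_def[THEN iffD1, OF int[of a b]] by auto
    define P N where PN: "P = (\<integral>\<^sup>+x. ennreal (?v x) \<partial>lborel)" "N = (\<integral>\<^sup>+x. ennreal (- ?v x) \<partial>lborel)"
    have "enn2real P = enn2real N"
      using real_lebesgue_integral_def[OF int[of a b]] z[of a b] by (simp add: PN)
    moreover have "P = ennreal (enn2real P)" "N = ennreal (enn2real N)"
      using f by (auto simp: PN top.not_eq_extremum)
    ultimately have "P = N" by metis
    thus ?thesis using 1 2 f PN by metis
  qed
  have "?M = ?N"
  proof (rule measure_eqI_generator_eq)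
    let ?E = "range (\<lambda>(a, b). box a b :: (real ^ 'n) set)"
    show "Int_stable ?E" by (auto simp: Int_stable_def box_Int_box)
    show "?E \<subseteq> Pow UNIV" "sets ?M = sigma_sets UNIV ?E" "sets ?N = sigma_sets UNIV ?E"
      by (simp_all add: borel_eq_box)
    let ?A = "\<lambda>n::nat. box (- (real n *\<^sub>R One)) (real n *\<^sub>R One) :: (real ^ 'n) set"
    show "range ?A \<subseteq> ?E" "(\<Union>i. ?A i) = UNIV" unfolding UN_box_eq_UNIV by auto
    show "emeasure ?M (?A i) \<noteq> \<infinity>" for i using em by blast
    show "emeasure ?M X = emeasure ?N X" if "X \<in> ?E" for X using that em by auto
  qed
  hence "AE x in lborel. ennreal (u x) = ennreal (- u x)"
    by (intro sigma_finite_measure.density_unique[OF sigma_finite_lborel]) auto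
  thus ?thesis
  proof eventually_elim
    case (elim x)
    show "u x = 0"
    proof (cases "u x \<ge> 0")
      case True thus ?thesis using elim ennreal_neg[of "- u x"] by simp
    next
      case False thus ?thesis using elim ennreal_neg[of "u x"] by simp
    qed
  qed
qed

text \<open>
  Testing against \<open>box_bump a b n\<close> and letting \<open>n\<close> tend to infinity shows that all box integrals vanish.
\<close>
lemma AE_eq_0_if_orthogonal_to_test_functions:
  fixes u :: "real ^ ('n::finite) \<Rightarrow> real"
  assumes [measurable]: "u \<in> borel_measurable borel"
    and loc: "locally_integrable u"
    and z: "\<And>\<phi>. test_function \<phi> \<Longrightarrow> (\<integral>x. u x * \<phi> x \<partial>lborel) = 0"
  shows "AE x in lborel. u x = 0"
proof (rule AE_eq_0_if_box_integrals_0)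
  fix a b :: "real ^ 'n"
  have ic: "integrable lborel (\<lambda>x. indicator (cbox a b) x * u x)"
    using loc by (simp add: locally_integrable_lborel_iff)
  have [measurable]: "box_bump a b n \<in> borel_measurable borel" for n
    using test_function_box_bump[of a b n]
    by (intro borel_measurable_continuous_onI smooth_continuous_on) (simp add: test_function_def)
  note dom = integrable_abs[OF ic]
  have lim: "AE x in lborel. (\<lambda>n. u x * box_bump a b n x) \<longlonglongrightarrow> indicator (box a b) x * u x"
    by (intro AE_I2) (subst mult.commute, intro tendsto_mult tendsto_const box_bump_tendsto)
  have bd: "AE x in lborel. norm (u x * box_bump a b n x) \<le> \<bar>indicator (cbox a b) x * u x\<bar>" for n
  proof (rule AE_I2)
    fix x show "norm (u x * box_bump a b n x) \<le> \<bar>indicator (cbox a b) x * u x\<bar>"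
    proof (cases "x \<in> box a b")
      case True
      hence "x \<in> cbox a b" using box_subset_cbox by blast
      thus ?thesis using box_bump_bounds[of a b n x]
        by (simp add: abs_mult mult_left_le)
    qed (simp add: box_bump_outside)
  qed
  show "integrable lborel (\<lambda>x. indicator (box a b) x * u x)"
    by (rule integrable_dominated_convergence[OF _ _ dom lim bd]) measurable
  have "(\<lambda>n. \<integral>x. u x * box_bump a b n x \<partial>lborel) \<longlonglongrightarrow> (\<integral>x. indicator (box a b) x * u x \<partial>lborel)"
    by (rule integral_dominated_convergence[OF _ _ dom lim bd]) measurable
  thus "(\<integral>x. indicator (box a b) x * u x \<partial>lborel) = 0"
    using z[OF test_function_box_bump] by (simp add: LIMSEQ_const_iff)
qed measurable

section \<open>Directional derivatives of smooth functions\<close>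

text \<open>
  For \<open>c \<alpha> = D\<^sup>\<alpha> f (x)\<close> this is \<open>D\<^sup>j f (x) (h, \<dots>, h)\<close>. The coefficients are kept as an arbitrary family,
  so that the same form serves for weak derivatives, for their Borel versions, and for the
  derivatives of test functions.
\<close>
definition directional_form ::
    "nat \<Rightarrow> (('n::finite) multi_index \<Rightarrow> real) \<Rightarrow> real ^ 'n \<Rightarrow> real" where
  "directional_form j c h = (\<Sum>is | length is = j. (\<Prod>i\<leftarrow>is. h $ i) * c (count_list is))"

lemma finite_lists_length: "finite {is :: ('n::finite) list. length is = j}"
  using finite_lists_length_eq[of "UNIV :: 'n set" j] by simp

lemma sum_lists_length_Suc:
  "(\<Sum>is | length is = Suc j. F is) = (\<Sum>i\<in>(UNIV :: ('n::finite) set). \<Sum>is | length is = j. F (i # is))"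
proof -
  have "(\<Sum>is | length is = Suc j. F is) = (\<Sum>is\<in>(\<lambda>(i, is). i # is) ` (UNIV \<times> {is. length is = j}). F is)"
    by (intro sum.cong) (auto simp: length_Suc_conv image_iff)
  also have "\<dots> = (\<Sum>(i, is)\<in>UNIV \<times> {is. length is = j}. F (i # is))"
    by (subst sum.reindex) (auto simp: inj_on_def case_prod_beta)
  also have "\<dots> = (\<Sum>i\<in>UNIV. \<Sum>is | length is = j. F (i # is))"
    by (rule sum.cartesian_product[symmetric])
  finally show ?thesis .
qed

lemma directional_form_scale:
  "directional_form j c (r *\<^sub>R h) = r ^ j * directional_form j c h"
proof -
  have "(\<Prod>i\<leftarrow>is. (r *\<^sub>R h) $ i) = r ^ length is * (\<Prod>i\<leftarrow>is. h $ i)" for "is"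
    by (induction "is") auto
  thus ?thesis unfolding directional_form_def sum_distrib_left
    by (intro sum.cong refl) (simp only: mem_Collect_eq mult.assoc)
qed

lemma count_list_eq_mset: "count_list is = count (mset is)"
  by (auto simp: count_mset)

text \<open>
  The symmetric second difference in the directions \<open>i\<close> and \<open>j\<close> equals, by two applications of the mean
  value theorem, \<open>r\<^sup>2\<close> times the mixed derivative at a nearby point. As it does not see the order of \<open>i\<close>
  and \<open>j\<close>, the mixed derivatives commute.
\<close>
lemma mixed_difference_quotient:
  fixes f :: "real ^ ('n::finite) \<Rightarrow> real"
  assumes f: "smooth f"
  shows "((\<lambda>r. (f (x + r *\<^sub>R axis i 1 + r *\<^sub>R axis j 1) - f (x + r *\<^sub>R axis i 1) - f (x + r *\<^sub>R axis j 1) + f x) / r\<^sup>2)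
     \<longlongrightarrow> partial_deriv j (partial_deriv i f) x) (at_right 0)"
proof -
  let ?a = "axis i 1 :: real ^ 'n" and ?b = "axis j 1 :: real ^ 'n"
  let ?u = "partial_deriv j (partial_deriv i f)"
  define Q where "Q r = (f (x + r *\<^sub>R ?a + r *\<^sub>R ?b) - f (x + r *\<^sub>R ?a) - f (x + r *\<^sub>R ?b) + f x) / r\<^sup>2" for r :: real
  have line: "((\<lambda>t. g (y + t *\<^sub>R axis k 1)) has_real_derivative partial_deriv k g (y + t *\<^sub>R axis k 1)) (at t)"
    if "smooth g" for g :: "real ^ 'n \<Rightarrow> real" and y t k
  proof -
    let ?y = "y + t *\<^sub>R axis k 1"
    obtain D where D: "(g has_derivative D) (at ?y)"
      using smooth_differentiable[OF \<open>smooth g\<close>] unfolding differentiable_def by blast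
    hence "(g has_derivative D) (at (?y + 0 *\<^sub>R axis k 1))" by simp
    hence "partial_deriv k g ?y = D (axis k 1)"
      by (intro partial_deriv_eq has_derivative_line)
    thus ?thesis using has_derivative_line[OF D] by simp
  qed
  have Q: "\<exists>y. dist y x \<le> 2 * r \<and> Q r = ?u y" if "r > 0" for r
  proof -
    have "\<exists>s>0. s < r \<and> (f (x + r *\<^sub>R ?b + r *\<^sub>R ?a) - f (x + r *\<^sub>R ?a)) - (f (x + r *\<^sub>R ?b + 0 *\<^sub>R ?a) - f (x + 0 *\<^sub>R ?a))
        = (r - 0) * (partial_deriv i f (x + r *\<^sub>R ?b + s *\<^sub>R ?a) - partial_deriv i f (x + s *\<^sub>R ?a))"
      using that by (intro MVT2) (auto intro!: DERIV_diff line f)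
    then obtain s where s: "s > 0" "s < r" and
      1: "f (x + r *\<^sub>R ?b + r *\<^sub>R ?a) - f (x + r *\<^sub>R ?a) - f (x + r *\<^sub>R ?b) + f x
        = r * (partial_deriv i f (x + r *\<^sub>R ?b + s *\<^sub>R ?a) - partial_deriv i f (x + s *\<^sub>R ?a))" by (auto simp: algebra_simps)
    have "\<exists>t>0. t < r \<and> partial_deriv i f (x + s *\<^sub>R ?a + r *\<^sub>R ?b) - partial_deriv i f (x + s *\<^sub>R ?a + 0 *\<^sub>R ?b)
        = (r - 0) * ?u (x + s *\<^sub>R ?a + t *\<^sub>R ?b)"
      using that by (intro MVT2) (auto intro!: line smooth_partial_deriv f)
    then obtain t where t: "t > 0" "t < r" and
      2: "partial_deriv i f (x + s *\<^sub>R ?a + r *\<^sub>R ?b) - partial_deriv i f (x + s *\<^sub>R ?a) = r * ?u (x + s *\<^sub>R ?a + t *\<^sub>R ?b)" by auto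
    have "Q r = ?u (x + s *\<^sub>R ?a + t *\<^sub>R ?b)"
    proof -
      have "f (x + r *\<^sub>R ?a + r *\<^sub>R ?b) - f (x + r *\<^sub>R ?a) - f (x + r *\<^sub>R ?b) + f x = r * (r * ?u (x + s *\<^sub>R ?a + t *\<^sub>R ?b))"
        using 1 2 by (simp add: add.assoc add.commute add.left_commute)
      thus ?thesis using that by (simp add: Q_def power2_eq_square)
    qed
    moreover have "norm (s *\<^sub>R ?a + t *\<^sub>R ?b) \<le> s + t"
      using norm_triangle_ineq[of "s *\<^sub>R ?a" "t *\<^sub>R ?b"] s t by simp
    hence "dist (x + s *\<^sub>R ?a + t *\<^sub>R ?b) x \<le> 2 * r" using s t by (simp add: dist_norm add.assoc)
    ultimately show ?thesis by blast
  qed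
  have "(Q \<longlongrightarrow> ?u x) (at_right 0)"
  proof (rule tendstoI)
    fix e :: real assume "e > 0"
    have "continuous_on UNIV ?u" using f by (intro smooth_continuous_on smooth_partial_deriv)
    hence "isCont ?u x" by (simp add: continuous_on_eq_continuous_at)
    then obtain d where d: "d > 0" "\<And>y. dist y x < d \<Longrightarrow> dist (?u y) (?u x) < e"
      using \<open>e > 0\<close> by (metis continuous_at_eps_delta)
    have "dist (Q r) (?u x) < e" if r: "0 < r" "r < d / 2" for r
      using Q[OF r(1)] d(2) r(2) by force
    thus "\<forall>\<^sub>F r in at_right 0. dist (Q r) (?u x) < e"
      using d(1) by (intro eventually_at_rightI[of 0 "d / 2"]) auto
  qed
  thus ?thesis by (simp add: Q_def[abs_def])
qed

lemma partial_deriv_commute: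
  fixes f :: "real ^ ('n::finite) \<Rightarrow> real"
  assumes f: "smooth f"
  shows "partial_deriv i (partial_deriv j f) = partial_deriv j (partial_deriv i f)"
proof
  fix x
  show "partial_deriv i (partial_deriv j f) x = partial_deriv j (partial_deriv i f) x"
  proof (rule tendsto_unique[OF trivial_limit_at_right_real])
    show "((\<lambda>r. (f (x + r *\<^sub>R axis i 1 + r *\<^sub>R axis j 1) - f (x + r *\<^sub>R axis i 1) - f (x + r *\<^sub>R axis j 1) + f x) / r\<^sup>2)
      \<longlongrightarrow> partial_deriv i (partial_deriv j f) x) (at_right 0)"
      using mixed_difference_quotient[OF f, of x j i] by (simp add: algebra_simps)
  qed (rule mixed_difference_quotient[OF f])
qed

lemma iter_partial_deriv_remove1:
  assumes "smooth f" "i \<in> set js"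
  shows "iter_partial_deriv js f = partial_deriv i (iter_partial_deriv (remove1 i js) f)"
  using assms(2)
proof (induction js)
  case (Cons j js)
  show ?case
  proof (cases "i = j")
    case False
    hence "iter_partial_deriv js f = partial_deriv i (iter_partial_deriv (remove1 i js) f)" using Cons by auto
    hence "iter_partial_deriv (j # js) f = partial_deriv j (partial_deriv i (iter_partial_deriv (remove1 i js) f))"
      by simp
    also have "\<dots> = partial_deriv i (partial_deriv j (iter_partial_deriv (remove1 i js) f))"
      by (rule partial_deriv_commute[OF smooth_iter[OF assms(1)]])
    finally show ?thesis using False by simp
  qed simp
qed simp

lemma iter_partial_deriv_mset_cong:
  assumes "smooth f" "mset is = mset js"
  shows "iter_partial_deriv is f = iter_partial_deriv js f"
  using assms(2)
proof (induction "is" arbitrary: js)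
  case (Cons i "is")
  have "i \<in># mset js" unfolding Cons(2)[symmetric] by simp
  hence i: "i \<in> set js" by simp
  have "mset (remove1 i js) = mset (i # is) - {#i#}" unfolding Cons(2) by (rule mset_remove1)
  hence "iter_partial_deriv is f = iter_partial_deriv (remove1 i js) f" by (intro Cons(1)) simp
  thus ?case using iter_partial_deriv_remove1[OF assms(1) i] by simp
qed auto

text \<open>
  This makes the arbitrary order of differentiation that is chosen in \<^const>\<open>mi_deriv\<close> harmless.
\<close>
lemma mi_deriv_count_list:
  assumes "smooth f"
  shows "mi_deriv (count_list is) f = iter_partial_deriv is f"
proof -
  have "count_list (SOME js. count_list js = count_list is) = count_list is"
    by (rule someI) (rule refl)
  hence "mset (SOME js. count_list js = count_list is) = mset is"
    unfolding count_list_eq_mset by (intro multiset_eqI) (metis fun_cong)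
  thus ?thesis unfolding mi_deriv_def using iter_partial_deriv_mset_cong[OF assms] by blast
qed

lemma iter_partial_deriv_translate:
  "iter_partial_deriv is (\<lambda>x. f (x + a)) = (\<lambda>x. iter_partial_deriv is f (x + a))"
  by (induction "is") (auto simp: partial_deriv_def[abs_def] add_ac)

lemma mi_deriv_translate: "mi_deriv \<alpha> (\<lambda>x. f (x + a)) = (\<lambda>x. mi_deriv \<alpha> f (x + a))"
  by (simp add: mi_deriv_def iter_partial_deriv_translate)

lemma test_function_bounded_support:
  "test_function \<phi> \<longleftrightarrow> smooth \<phi> \<and> (\<exists>C. compact C \<and> (\<forall>x. x \<notin> C \<longrightarrow> \<phi> x = 0))"
proof -
  have "compact (closure {x. \<phi> x \<noteq> 0})" if "compact C" "\<forall>x. x \<notin> C \<longrightarrow> \<phi> x = 0" for C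
  proof -
    have "{x. \<phi> x \<noteq> 0} \<subseteq> C" using that by auto
    thus ?thesis using that(1) by (meson bounded_subset compact_closure compact_imp_bounded)
  qed
  moreover have "\<forall>x. x \<notin> closure {x. \<phi> x \<noteq> 0} \<longrightarrow> \<phi> x = 0"
    using closure_subset[of "{x. \<phi> x \<noteq> 0}"] by auto
  ultimately show ?thesis unfolding test_function_def by blast
qed

lemma smooth_translate: "smooth f \<Longrightarrow> smooth (\<lambda>x. f (x + a))"
  unfolding smooth_def iter_partial_deriv_translate differentiable_on_def
proof (intro allI ballI)
  fix "is" x assume *: "\<forall>is. \<forall>x\<in>UNIV. iter_partial_deriv is f differentiable at x within UNIV"
  show "(\<lambda>x. iter_partial_deriv is f (x + a)) differentiable at x within UNIV"
    using differentiable_chain_at[of "\<lambda>x. x + a" x "iter_partial_deriv is f"] * by (simp add: o_def)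
qed

lemma test_function_translate:
  assumes "test_function \<phi>"
  shows "test_function (\<lambda>x. \<phi> (x + a))"
proof -
  from assms obtain C where C: "smooth \<phi>" "compact C" "\<And>x. x \<notin> C \<Longrightarrow> \<phi> x = 0"
    by (auto simp: test_function_bounded_support)
  have "compact ((\<lambda>x. - a + x) ` C)" using C(2) by (rule compact_translation)
  moreover have "\<phi> (x + a) = 0" if "x \<notin> (\<lambda>x. - a + x) ` C" for x
    by (rule C(3)) (use that in \<open>auto intro!: image_eqI[of _ _ "x + a"]\<close>)
  ultimately show ?thesis using smooth_translate[OF C(1)] by (auto simp: test_function_bounded_support)
qed

lemma partial_deriv_eq_0_outside:
  assumes "closed C" "\<And>x. x \<notin> C \<Longrightarrow> f x = 0" "x \<notin> C"
  shows "partial_deriv i f x = 0"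
proof (rule partial_deriv_eq)
  have "open ((\<lambda>t. x + t *\<^sub>R axis i 1) -` (- C))"
    using assms(1) by (intro open_vimage continuous_intros) simp
  thus "((\<lambda>t. f (x + t *\<^sub>R axis i 1)) has_real_derivative 0) (at 0)"
    by (rule has_field_derivative_transform_within_open[OF DERIV_const[of 0]]) (use assms in auto)
qed

lemma mi_deriv_support:
  assumes "test_function \<phi>"
  obtains C where "compact C" "\<And>\<alpha> x. x \<notin> C \<Longrightarrow> mi_deriv \<alpha> \<phi> x = 0"
proof -
  from assms obtain C where C: "smooth \<phi>" "compact C" "\<And>x. x \<notin> C \<Longrightarrow> \<phi> x = 0"
    by (auto simp: test_function_bounded_support)
  have "iter_partial_deriv is \<phi> x = 0" if "x \<notin> C" for x "is"
    using that
  proof (induction "is" arbitrary: x)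
    case (Cons i "is")
    thus ?case using partial_deriv_eq_0_outside[OF compact_imp_closed[OF C(2)]] by simp
  qed (simp add: C(3))
  thus ?thesis using that[OF C(2)] by (simp add: mi_deriv_def)
qed

lemma test_function_mi_deriv:
  assumes "test_function \<phi>"
  shows "test_function (mi_deriv \<alpha> \<phi>)"
proof -
  have "smooth (mi_deriv \<alpha> \<phi>)"
    using assms by (simp add: mi_deriv_def test_function_def smooth_iter)
  thus ?thesis using mi_deriv_support[OF assms] by (metis test_function_bounded_support)
qed

lemma test_function_continuous: "test_function \<phi> \<Longrightarrow> continuous_on S \<phi>"
  by (simp add: test_function_def smooth_continuous_on)

lemma has_derivative_along_line:
  fixes f :: "real ^ ('n::finite) \<Rightarrow> real"
  assumes "f differentiable at (x + t *\<^sub>R h)"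
  shows "((\<lambda>s. f (x + s *\<^sub>R h)) has_real_derivative (\<Sum>i\<in>UNIV. h $ i * partial_deriv i f (x + t *\<^sub>R h))) (at t)"
proof -
  let ?y = "x + t *\<^sub>R h"
  obtain D where D: "(f has_derivative D) (at ?y)" using assms by (auto simp: differentiable_def)
  hence D0: "(f has_derivative D) (at (?y + 0 *\<^sub>R axis i 1))" for i by simp
  have lin: "linear D" using D has_derivative_linear by blast
  have "D (\<Sum>i\<in>UNIV. h $ i *\<^sub>R axis i 1) = (\<Sum>i\<in>UNIV. h $ i * D (axis i 1))"
    by (simp add: linear_sum[OF lin] linear_cmul[OF lin])
  moreover have "(\<Sum>i\<in>UNIV. h $ i *\<^sub>R axis i 1) = h"
    using basis_expansion[of h] by (simp add: scalar_mult_eq_scaleR)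
  moreover have "D (axis i 1) = partial_deriv i f ?y" for i
    using partial_deriv_eq[OF has_derivative_line[OF D0]] by simp
  ultimately have "D h = (\<Sum>i\<in>UNIV. h $ i * partial_deriv i f ?y)" by simp
  thus ?thesis using has_derivative_line[OF D] by simp
qed

text \<open>
  Prepending an index to a list corresponds to one more differentiation along the line, so the
  forms of consecutive orders are derivatives of each other and the one-dimensional Taylor formula
  applies.
\<close>
lemma directional_form_has_derivative:
  fixes \<phi> :: "real ^ ('n::finite) \<Rightarrow> real"
  assumes "smooth \<phi>"
  shows "((\<lambda>s. directional_form j (\<lambda>\<alpha>. mi_deriv \<alpha> \<phi> (x + s *\<^sub>R h)) h) has_real_derivative
     directional_form (Suc j) (\<lambda>\<alpha>. mi_deriv \<alpha> \<phi> (x + t *\<^sub>R h)) h) (at t)"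
proof -
  have "((\<lambda>s. \<Sum>is | length is = j. (\<Prod>i\<leftarrow>is. h $ i) * iter_partial_deriv is \<phi> (x + s *\<^sub>R h)) has_real_derivative
     (\<Sum>is | length is = j. (\<Prod>i\<leftarrow>is. h $ i) * (\<Sum>k\<in>UNIV. h $ k * partial_deriv k (iter_partial_deriv is \<phi>) (x + t *\<^sub>R h)))) (at t)"
    using assms by (intro DERIV_sum DERIV_cmult has_derivative_along_line smooth_differentiable smooth_iter)
  also have "(\<Sum>is | length is = j. (\<Prod>i\<leftarrow>is. h $ i) * (\<Sum>k\<in>UNIV. h $ k * partial_deriv k (iter_partial_deriv is \<phi>) (x + t *\<^sub>R h)))
    = (\<Sum>is | length is = Suc j. (\<Prod>i\<leftarrow>is. h $ i) * iter_partial_deriv is \<phi> (x + t *\<^sub>R h))"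
    unfolding sum_lists_length_Suc by (subst sum.swap) (auto simp: sum_distrib_left mult_ac)
  finally show ?thesis unfolding directional_form_def mi_deriv_count_list[OF assms] .
qed

lemma taylor_formula_along_line:
  fixes \<phi> :: "real ^ ('n::finite) \<Rightarrow> real"
  assumes "smooth \<phi>" "m \<ge> 1"
  shows "((\<lambda>t. ((1 - t) ^ (m - 1) / fact (m - 1)) * directional_form m (\<lambda>\<alpha>. mi_deriv \<alpha> \<phi> (x + t *\<^sub>R h)) h) has_integral
     \<phi> (x + h) - (\<Sum>j<m. directional_form j (\<lambda>\<alpha>. mi_deriv \<alpha> \<phi> x) h / fact j)) {0..1}"
proof -
  define D where "D j s = directional_form j (\<lambda>\<alpha>. mi_deriv \<alpha> \<phi> (x + s *\<^sub>R h)) h" for j and s :: real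
  have D0: "D 0 s = \<phi> (x + s *\<^sub>R h)" for s
    using mi_deriv_count_list[OF assms(1), of "[]"] by (simp add: D_def directional_form_def)
  have der: "(D j has_vector_derivative D (Suc j) t) (at t within {0..1})" for j t
    unfolding D_def has_real_derivative_iff_has_vector_derivative[symmetric]
    by (rule has_field_derivative_at_within, rule directional_form_has_derivative[OF assms(1)])
  have "m > 0" using assms(2) by simp
  from Taylor_has_integral[of m D "D 0" 0 1, OF this refl der]
  have "((\<lambda>t. ((1 - t) ^ (m - 1) / fact (m - 1)) *\<^sub>R D m t) has_integral
     D 0 1 - (\<Sum>j<m. ((1 - 0) ^ j / fact j) *\<^sub>R D j 0)) {0..1}" by simp
  moreover have "D 0 1 - (\<Sum>j<m. ((1 - 0) ^ j / fact j) *\<^sub>R D j 0)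
      = \<phi> (x + h) - (\<Sum>j<m. directional_form j (\<lambda>\<alpha>. mi_deriv \<alpha> \<phi> x) h / fact j)"
    unfolding D0 by (simp add: D_def)
  ultimately show ?thesis by (simp add: D_def)
qed

section \<open>Linearity of directional forms and translation of integrals\<close>

lemma mi_order_count_list: "mi_order (count_list is) = length is"
proof -
  have "mi_order (count_list is) = (\<Sum>i\<in>set is. count_list is i)"
    unfolding mi_order_def by (rule sum.mono_neutral_right) (auto simp: count_list_0_iff)
  also have "\<dots> = length is" by (rule sum_count_set) auto
  finally show ?thesis .
qed

lemma directional_form_cong:
  "(\<And>\<alpha>. mi_order \<alpha> = j \<Longrightarrow> c \<alpha> = d \<alpha>) \<Longrightarrow> directional_form j c h = directional_form j d h"
  unfolding directional_form_def by (intro sum.cong refl) (simp add: mi_order_count_list)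

lemma directional_form_cmult: "directional_form j (\<lambda>\<alpha>. a * c \<alpha>) h = a * directional_form j c h"
  by (simp add: directional_form_def sum_distrib_left mult_ac)

lemma directional_form_uminus: "directional_form j c (- h) = (- 1) ^ j * directional_form j c h"
  using directional_form_scale[of j c "-1" h] by simp

lemma
  assumes "\<And>\<alpha>. mi_order \<alpha> = j \<Longrightarrow> integrable M (c \<alpha>)"
  shows integrable_directional_form: "integrable M (\<lambda>y. directional_form j (\<lambda>\<alpha>. c \<alpha> y) h)" (is ?I)
    and integral_directional_form: "(\<integral>y. directional_form j (\<lambda>\<alpha>. c \<alpha> y) h \<partial>M) = directional_form j (\<lambda>\<alpha>. \<integral>y. c \<alpha> y \<partial>M) h" (is ?E)
proof -
  have *: "integrable M (\<lambda>y. (\<Prod>i\<leftarrow>is. h $ i) * c (count_list is) y)" if "is \<in> {is. length is = j}" for "is"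
    using that assms by (simp add: mi_order_count_list)
  show ?I unfolding directional_form_def by (intro Bochner_Integration.integrable_sum *)
  show ?E unfolding directional_form_def using * by (subst Bochner_Integration.integral_sum) auto
qed

lemma borel_measurable_directional_form:
  assumes "\<And>\<alpha>. mi_order \<alpha> = j \<Longrightarrow> c \<alpha> \<in> borel_measurable M" and [measurable]: "h \<in> M \<rightarrow>\<^sub>M borel"
  shows "(\<lambda>y. directional_form j (\<lambda>\<alpha>. c \<alpha> y) (h y)) \<in> borel_measurable M"
proof -
  have [measurable]: "(\<lambda>y. (\<Prod>i\<leftarrow>is. h y $ i)) \<in> borel_measurable M" for "is"
  proof (induction "is")
    case (Cons i "is")
    have "(\<lambda>y. h y $ i) \<in> borel_measurable M"
      by (rule measurable_compose[OF assms(2)]) (intro borel_measurable_continuous_onI continuous_intros)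
    with Cons show ?case by simp
  qed simp
  show ?thesis unfolding directional_form_def
    by (intro borel_measurable_sum borel_measurable_times) (auto intro!: assms(1) simp: mi_order_count_list)
qed

lemma
  fixes F :: "'a::euclidean_space \<Rightarrow> 'b::{banach, second_countable_topology}"
  assumes [measurable]: "F \<in> borel_measurable borel"
  shows integrable_lborel_translate: "integrable lborel (\<lambda>x. F (x + a)) \<longleftrightarrow> integrable lborel F" (is ?I)
    and integral_lborel_translate: "(\<integral>x. F (x + a) \<partial>lborel) = (\<integral>x. F x \<partial>lborel)" (is ?E)
proof -
  have *: "(lborel :: 'a measure) = distr lborel borel (\<lambda>x. x + a)"
    using lborel_distr_plus[of a] by (subst add.commute) simp
  show ?I by (subst (2) *, subst integrable_distr_eq) auto
  show ?E by (subst (2) *, subst integral_distr) auto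
qed

lemma nn_integral_lborel_translate:
  fixes F :: "'a::euclidean_space \<Rightarrow> ennreal"
  assumes [measurable]: "F \<in> borel_measurable borel"
  shows "(\<integral>\<^sup>+x. F (x + a) \<partial>lborel) = (\<integral>\<^sup>+x. F x \<partial>lborel)"
proof -
  have *: "(lborel :: 'a measure) = distr lborel borel (\<lambda>x. x + a)"
    using lborel_distr_plus[of a] by (subst add.commute) simp
  show ?thesis by (subst (2) *, subst nn_integral_distr) auto
qed

section \<open>Weighted means along segments\<close>

lemma continuous_compact_support_bounded:
  fixes \<psi> :: "'a::topological_space \<Rightarrow> real"
  assumes "continuous_on UNIV \<psi>" "compact C" "\<And>x. x \<notin> C \<Longrightarrow> \<psi> x = 0"
  obtains B where "B \<ge> 0" "\<And>x. \<bar>\<psi> x\<bar> \<le> B"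
proof -
  have "compact (\<psi> ` C)" using assms by (intro compact_continuous_image) (auto intro: continuous_on_subset)
  then obtain B where B: "\<forall>x\<in>\<psi> ` C. norm x \<le> B" using bounded_iff compact_imp_bounded by blast
  have "\<bar>\<psi> x\<bar> \<le> max B 0" for x using B assms(3)[of x] by (cases "x \<in> C") (auto simp: le_max_iff_disj)
  thus ?thesis using that[of "max B 0"] by auto
qed

lemma integrable_mult_continuous_compact_support:
  fixes g :: "real ^ ('n::finite) \<Rightarrow> real"
  assumes [measurable]: "g \<in> borel_measurable borel" and loc: "locally_integrable g"
    and \<psi>: "continuous_on UNIV \<psi>" "compact C" "\<And>x. x \<notin> C \<Longrightarrow> \<psi> x = 0"
  shows "integrable lborel (\<lambda>y. g y * \<psi> y)"
proof -
  obtain B where B: "B \<ge> 0" "\<And>x. \<bar>\<psi> x\<bar> \<le> B" using continuous_compact_support_bounded[OF \<psi>] by blast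
  have [measurable]: "\<psi> \<in> borel_measurable borel" using \<psi>(1) by (rule borel_measurable_continuous_onI)
  have "integrable lborel (\<lambda>x. indicator C x * g x)"
    using loc \<psi>(2) by (simp add: locally_integrable_lborel_iff)
  hence "integrable lborel (\<lambda>x. B * (indicator C x * g x))" by simp
  thus ?thesis
  proof (rule Bochner_Integration.integrable_bound)
    show "AE y in lborel. norm (g y * \<psi> y) \<le> norm (B * (indicator C y * g y))"
      using B \<psi>(3) by (intro AE_I2) (auto simp: abs_mult indicator_def mult.commute intro!: mult_right_mono)
  qed measurable
qed

lemma integrable_test_function:
  fixes g :: "real ^ ('n::finite) \<Rightarrow> real"
  assumes "g \<in> borel_measurable borel" "locally_integrable g" "test_function \<phi>"
  shows "integrable lborel (\<lambda>y. g y * \<phi> y)"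
  using assms(3) integrable_mult_continuous_compact_support[OF assms(1,2) test_function_continuous[OF assms(3)]]
  by (auto simp: test_function_bounded_support)

text \<open>
  By Tonelli's theorem and translation invariance, each \<open>t\<close> contributes at most the integral of \<open>|g|\<close>
  over a ball that contains all segments starting in \<open>C\<close>.
\<close>
lemma integrable_along_segments:
  fixes g :: "real ^ ('n::finite) \<Rightarrow> real"
  assumes [measurable]: "g \<in> borel_measurable borel" and loc: "locally_integrable g" and C: "compact C"
  shows "integrable (lborel \<Otimes>\<^sub>M lborel) (\<lambda>(y, t). indicator C y * indicator {0..1::real} t * g (y + t *\<^sub>R h))"
proof (rule integrableI_bounded)
  have [measurable]: "C \<in> sets borel" using C by (rule borel_compact)
  show "(\<lambda>(y, t). indicator C y * indicator {0..1::real} t * g (y + t *\<^sub>R h)) \<in> borel_measurable (lborel \<Otimes>\<^sub>M lborel)"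
    by measurable
  obtain R where R: "\<And>x. x \<in> C \<Longrightarrow> norm x \<le> R" using compact_imp_bounded[OF C] bounded_iff by blast
  let ?B = "cball 0 (R + norm h) :: (real ^ 'n) set"
  let ?F = "\<lambda>y. ennreal (norm (indicator ?B y * g y))"
  let ?H = "\<lambda>z. case z of (y, t) \<Rightarrow> indicator C y * indicator {0..1::real} t * g (y + t *\<^sub>R h)"
  have "(\<integral>\<^sup>+z. ennreal (norm (?H z)) \<partial>(lborel \<Otimes>\<^sub>M lborel))
    = (\<integral>\<^sup>+t. \<integral>\<^sup>+y. ennreal (norm (indicator C y * indicator {0..1::real} t * g (y + t *\<^sub>R h))) \<partial>lborel \<partial>lborel)"
    by (subst lborel_pair.nn_integral_snd[symmetric]) auto
  also have "\<dots> \<le> (\<integral>\<^sup>+t. \<integral>\<^sup>+y. indicator {0..1::real} t * ?F (y + t *\<^sub>R h) \<partial>lborel \<partial>lborel)"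
  proof (intro nn_integral_mono)
    fix t y
    have "norm (y + t *\<^sub>R h) \<le> R + norm h" if "y \<in> C" "0 \<le> t" "t \<le> 1"
      using norm_triangle_ineq[of y "t *\<^sub>R h"] R[OF that(1)] that mult_left_le_one_le[of "norm h" t] by simp
    thus "ennreal (norm (indicator C y * indicator {0..1::real} t * g (y + t *\<^sub>R h)))
      \<le> indicator {0..1::real} t * ?F (y + t *\<^sub>R h)"
      by (auto simp: indicator_def)
  qed
  also have "\<dots> = (\<integral>\<^sup>+t. indicator {0..1::real} t * (\<integral>\<^sup>+y. ?F y \<partial>lborel) \<partial>lborel)"
  proof (intro nn_integral_cong)
    fix t :: real
    have [measurable]: "?B \<in> sets borel" by simp
    have Fm: "?F \<in> borel_measurable borel" by measurable
    have "(\<lambda>y. y + t *\<^sub>R h) \<in> borel \<rightarrow>\<^sub>M borel" by (intro borel_measurable_continuous_onI continuous_intros)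
    from measurable_compose[OF this Fm]
    have "(\<integral>\<^sup>+y. indicator {0..1} t * ?F (y + t *\<^sub>R h) \<partial>lborel) = indicator {0..1} t * (\<integral>\<^sup>+y. ?F (y + t *\<^sub>R h) \<partial>lborel)"
      by (intro nn_integral_cmult) simp
    also have "(\<integral>\<^sup>+y. ?F (y + t *\<^sub>R h) \<partial>lborel) = (\<integral>\<^sup>+y. ?F y \<partial>lborel)"
      by (rule nn_integral_lborel_translate[OF Fm])
    finally show "(\<integral>\<^sup>+y. indicator {0..1} t * ?F (y + t *\<^sub>R h) \<partial>lborel) = indicator {0..1} t * (\<integral>\<^sup>+y. ?F y \<partial>lborel)" .
  qed
  also have "\<dots> = (\<integral>\<^sup>+y. ?F y \<partial>lborel)"
    by (subst nn_integral_multc) auto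
  also have "\<dots> < \<infinity>"
    using loc by (auto simp: locally_integrable_lborel_iff integrable_iff_bounded)
  finally show "(\<integral>\<^sup>+z. ennreal (norm (?H z)) \<partial>(lborel \<Otimes>\<^sub>M lborel)) < \<infinity>" .
qed

definition segment_mean ::
    "(real \<Rightarrow> real) \<Rightarrow> real ^ ('n::finite) \<Rightarrow> (real ^ 'n \<Rightarrow> real) \<Rightarrow> real ^ 'n \<Rightarrow> real" where
  "segment_mean w h g y = (\<integral>t. indicator {0..1} t * w t * g (y + t *\<^sub>R h) \<partial>lborel)"

text \<open>
  The two formulas for pairing with a continuous function of compact support below say that the adjoint of taking means in
  direction \<open>h\<close> is taking means in direction \<open>- h\<close>. They are stated with a common middle term because
  the weak derivative is moved from one factor to the other for each fixed \<open>t\<close>.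
\<close>
context
  fixes w :: "real \<Rightarrow> real"
  assumes w_meas [measurable]: "w \<in> borel_measurable borel"
    and w_bound: "\<And>t. 0 \<le> t \<Longrightarrow> t \<le> 1 \<Longrightarrow> \<bar>w t\<bar> \<le> 1"
begin

lemma borel_measurable_segment_mean [measurable]:
  fixes g :: "real ^ ('n::finite) \<Rightarrow> real"
  assumes [measurable]: "g \<in> borel_measurable borel"
  shows "segment_mean w h g \<in> borel_measurable borel"
  unfolding segment_mean_def[abs_def] by measurable

lemma integrable_weighted_along_segments:
  fixes g :: "real ^ ('n::finite) \<Rightarrow> real"
  assumes [measurable]: "g \<in> borel_measurable borel" and loc: "locally_integrable g" and C: "compact C"
    and [measurable]: "b \<in> borel_measurable (borel \<Otimes>\<^sub>M borel)"
    and b: "\<And>y t. \<bar>b (y, t)\<bar> \<le> B" "\<And>y t. y \<notin> C \<Longrightarrow> b (y, t) = 0" and "B \<ge> 0"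
  shows "integrable (lborel \<Otimes>\<^sub>M lborel) (\<lambda>(y, t). indicator {0..1} t * w t * g (y + t *\<^sub>R h) * b (y, t))"
proof -
  have "integrable (lborel \<Otimes>\<^sub>M lborel) (\<lambda>z. B * (case z of (y, t) \<Rightarrow> indicator C y * indicator {0..1::real} t * g (y + t *\<^sub>R h)))"
    using integrable_along_segments[OF assms(1-3)] by simp
  thus ?thesis
  proof (rule Bochner_Integration.integrable_bound)
    have "\<bar>indicator {0..1} t * w t * g (y + t *\<^sub>R h) * b (y, t)\<bar> \<le> \<bar>B * (indicator C y * indicator {0..1::real} t * g (y + t *\<^sub>R h))\<bar>" for y t
    proof (cases "y \<in> C \<and> t \<in> {0..1}")
      case True
      hence "\<bar>w t\<bar> * \<bar>b (y, t)\<bar> \<le> 1 * B" using w_bound b(1) by (intro mult_mono) auto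
      hence "\<bar>g (y + t *\<^sub>R h)\<bar> * (\<bar>w t\<bar> * \<bar>b (y, t)\<bar>) \<le> \<bar>g (y + t *\<^sub>R h)\<bar> * (1 * B)" by (intro mult_left_mono) auto
      thus ?thesis using True \<open>B \<ge> 0\<close> by (simp add: abs_mult mult_ac)
    qed (auto simp: b(2))
    thus "AE z in lborel \<Otimes>\<^sub>M lborel. norm (case z of (y, t) \<Rightarrow> indicator {0..1} t * w t * g (y + t *\<^sub>R h) * b (y, t))
      \<le> norm (B * (case z of (y, t) \<Rightarrow> indicator C y * indicator {0..1::real} t * g (y + t *\<^sub>R h)))"
      by (intro AE_I2) auto
  qed measurable
qed

lemma locally_integrable_segment_mean:
  fixes g :: "real ^ ('n::finite) \<Rightarrow> real"
  assumes [measurable]: "g \<in> borel_measurable borel" and loc: "locally_integrable g"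
  shows "locally_integrable (segment_mean w h g)"
  unfolding locally_integrable_lborel_iff[OF borel_measurable_segment_mean[OF assms(1)]]
proof (intro allI impI)
  fix C :: "(real ^ 'n) set" assume C: "compact C"
  hence [measurable]: "C \<in> sets borel" by (rule borel_compact)
  have "integrable (lborel \<Otimes>\<^sub>M lborel) (\<lambda>(y, t). indicator {0..1} t * w t * g (y + t *\<^sub>R h) * indicator C (fst (y, t)))"
    by (rule integrable_weighted_along_segments[OF assms C, of _ 1]) (auto simp: indicator_def)
  from lborel_pair.integrable_fst'[OF this]
  have "integrable lborel (\<lambda>y. \<integral>t. indicator {0..1} t * w t * g (y + t *\<^sub>R h) * indicator C y \<partial>lborel)" by simp
  thus "integrable lborel (\<lambda>y. indicator C y * segment_mean w h g y)"
    by (simp add: segment_mean_def mult.commute)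
qed

lemma
  fixes g :: "real ^ ('n::finite) \<Rightarrow> real"
  assumes [measurable]: "g \<in> borel_measurable borel" and loc: "locally_integrable g"
    and \<psi>: "continuous_on UNIV \<psi>" "compact C" "\<And>x. x \<notin> C \<Longrightarrow> \<psi> x = 0"
  shows integral_segment_mean_left:
      "(\<integral>y. segment_mean w h g y * \<psi> y \<partial>lborel)
        = (\<integral>t. indicator {0..1} t * w t * (\<integral>y. g y * \<psi> (y - t *\<^sub>R h) \<partial>lborel) \<partial>lborel)" (is ?A)
    and integral_segment_mean_right:
      "(\<integral>y. g y * segment_mean w (- h) \<psi> y \<partial>lborel)
        = (\<integral>t. indicator {0..1} t * w t * (\<integral>y. g y * \<psi> (y - t *\<^sub>R h) \<partial>lborel) \<partial>lborel)" (is ?B)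
proof -
  obtain B where B: "B \<ge> 0" "\<And>x. \<bar>\<psi> x\<bar> \<le> B" using continuous_compact_support_bounded[OF \<psi>] by blast
  have [measurable]: "\<psi> \<in> borel_measurable borel" using \<psi>(1) by (rule borel_measurable_continuous_onI)
  have 1: "integrable (lborel \<Otimes>\<^sub>M lborel) (\<lambda>(y, t). indicator {0..1} t * w t * g (y + t *\<^sub>R h) * \<psi> (fst (y, t)))"
    using B \<psi> by (intro integrable_weighted_along_segments[OF assms(1,2) \<psi>(2)]) auto
  have "(\<integral>y. segment_mean w h g y * \<psi> y \<partial>lborel)
      = (\<integral>y. \<integral>t. indicator {0..1} t * w t * g (y + t *\<^sub>R h) * \<psi> y \<partial>lborel \<partial>lborel)"
    by (simp add: segment_mean_def)
  also have "\<dots> = (\<integral>t. \<integral>y. indicator {0..1} t * w t * g (y + t *\<^sub>R h) * \<psi> y \<partial>lborel \<partial>lborel)"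
    using lborel_pair.Fubini_integral[of "\<lambda>y t. indicator {0..1} t * w t * g (y + t *\<^sub>R h) * \<psi> y"] 1
    by (simp add: case_prod_beta')
  also have "\<dots> = (\<integral>t. indicator {0..1} t * w t * (\<integral>y. g y * \<psi> (y - t *\<^sub>R h) \<partial>lborel) \<partial>lborel)"
  proof (intro Bochner_Integration.integral_cong refl)
    fix t
    have "(\<integral>y. g (y + t *\<^sub>R h) * \<psi> y \<partial>lborel) = (\<integral>y. g y * \<psi> (y - t *\<^sub>R h) \<partial>lborel)"
      using integral_lborel_translate[of "\<lambda>y. g y * \<psi> (y - t *\<^sub>R h)" "t *\<^sub>R h"] by simp
    thus "(\<integral>y. indicator {0..1} t * w t * g (y + t *\<^sub>R h) * \<psi> y \<partial>lborel)
      = indicator {0..1} t * w t * (\<integral>y. g y * \<psi> (y - t *\<^sub>R h) \<partial>lborel)"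
      by (simp add: mult.assoc)
  qed
  finally show ?A .
  obtain R where R: "\<And>x. x \<in> C \<Longrightarrow> norm x \<le> R" using compact_imp_bounded[OF \<psi>(2)] bounded_iff by blast
  let ?b = "\<lambda>(y, t). indicator {0..1} t * \<psi> (y - t *\<^sub>R h)"
  have b0: "?b (y, t) = 0" if "y \<notin> cball 0 (R + norm h)" for y :: "real ^ 'n" and t :: real
  proof (cases "t \<in> {0..1} \<and> y - t *\<^sub>R h \<in> C")
    case True
    have "norm y \<le> norm (y - t *\<^sub>R h) + norm (t *\<^sub>R h)" using norm_triangle_ineq[of "y - t *\<^sub>R h" "t *\<^sub>R h"] by simp
    also have "\<dots> \<le> R + norm h" using True R mult_left_le_one_le[of "norm h" t] by (intro add_mono) auto
    finally show ?thesis using that by simp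
  qed (auto simp: \<psi>(3))
  have 2: "integrable (lborel \<Otimes>\<^sub>M lborel) (\<lambda>(y, t). indicator {0..1} t * w t * g (y + t *\<^sub>R 0) * ?b (y, t))"
    using B b0 by (intro integrable_weighted_along_segments[OF assms(1,2) compact_cball[of 0 "R + norm h"]]) (auto simp: indicator_def)
  have "(\<integral>y. g y * segment_mean w (- h) \<psi> y \<partial>lborel)
      = (\<integral>y. \<integral>t. indicator {0..1} t * w t * g y * ?b (y, t) \<partial>lborel \<partial>lborel)"
    unfolding segment_mean_def integral_mult_right_zero[symmetric]
    by (intro Bochner_Integration.integral_cong refl) (auto simp: indicator_def)
  also have "\<dots> = (\<integral>t. \<integral>y. indicator {0..1} t * w t * g y * ?b (y, t) \<partial>lborel \<partial>lborel)"
    using lborel_pair.Fubini_integral[of "\<lambda>y t. indicator {0..1} t * w t * g y * ?b (y, t)"] 2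
    by (simp add: case_prod_beta')
  also have "\<dots> = (\<integral>t. indicator {0..1} t * w t * (\<integral>y. g y * \<psi> (y - t *\<^sub>R h) \<partial>lborel) \<partial>lborel)"
    unfolding integral_mult_right_zero[symmetric]
    by (intro Bochner_Integration.integral_cong refl) (auto simp: indicator_def)
  finally show ?B .
qed

end


section \<open>Taylor's formula for weak derivatives\<close>

definition taylor_weight :: "nat \<Rightarrow> real \<Rightarrow> real" where
  "taylor_weight m t = (1 - t) ^ (m - 1) / fact (m - 1)"

lemma borel_measurable_taylor_weight [measurable]: "taylor_weight m \<in> borel_measurable borel"
  unfolding taylor_weight_def[abs_def] by measurable

lemma taylor_weight_bound: "0 \<le> t \<Longrightarrow> t \<le> 1 \<Longrightarrow> \<bar>taylor_weight m t\<bar> \<le> 1"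
proof -
  assume t: "0 \<le> t" "t \<le> 1"
  have "\<bar>taylor_weight m t\<bar> = (1 - t) ^ (m - 1) / fact (m - 1)"
    using t by (simp add: taylor_weight_def abs_mult power_abs)
  also have "\<dots> \<le> 1 / 1" using t by (intro frac_le power_le_one fact_ge_1) auto
  finally show ?thesis by simp
qed

lemma locally_integrable_directional_form:
  fixes c :: "('n::finite) multi_index \<Rightarrow> real ^ 'n \<Rightarrow> real"
  assumes "\<And>\<alpha>. mi_order \<alpha> = j \<Longrightarrow> c \<alpha> \<in> borel_measurable borel" "\<And>\<alpha>. mi_order \<alpha> = j \<Longrightarrow> locally_integrable (c \<alpha>)"
  shows "locally_integrable (\<lambda>y. directional_form j (\<lambda>\<alpha>. c \<alpha> y) h)"
proof -
  have [measurable]: "(\<lambda>y. directional_form j (\<lambda>\<alpha>. c \<alpha> y) h) \<in> borel_measurable borel"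
    using assms(1) by (rule borel_measurable_directional_form) auto
  have "integrable lborel (\<lambda>y. directional_form j (\<lambda>\<alpha>. indicator C y * c \<alpha> y) h)" if "compact C" for C
    using assms that by (intro integrable_directional_form) (auto simp: locally_integrable_lborel_iff)
  thus ?thesis by (subst locally_integrable_lborel_iff) (auto simp: directional_form_cmult)
qed

lemma locally_integrable_translate:
  fixes f :: "real ^ ('n::finite) \<Rightarrow> real"
  assumes [measurable]: "f \<in> borel_measurable borel" and loc: "locally_integrable f"
  shows "locally_integrable (\<lambda>y. f (y + h))"
proof (subst locally_integrable_lborel_iff)
  show "\<forall>C. compact C \<longrightarrow> integrable lborel (\<lambda>x. indicator C x * f (x + h))"
  proof (intro allI impI)
    fix C :: "(real ^ 'n) set" assume C: "compact C"
    hence [measurable]: "C \<in> sets borel" by (rule borel_compact)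
    have C': "compact ((\<lambda>x. h + x) ` C)" using C by (rule compact_translation)
    hence [measurable]: "(\<lambda>x. h + x) ` C \<in> sets borel" by (rule borel_compact)
    have "integrable lborel (\<lambda>x. indicator ((\<lambda>x. h + x) ` C) x * f x)"
      using loc C' by (simp add: locally_integrable_lborel_iff)
    hence "integrable lborel (\<lambda>x. indicator ((\<lambda>x. h + x) ` C) (x + h) * f (x + h))"
      by (subst integrable_lborel_translate) auto
    moreover have "indicator ((\<lambda>x. h + x) ` C) (x + h) = (indicator C x :: real)" for x
      by (auto simp: indicator_def image_iff add.commute)
    ultimately show "integrable lborel (\<lambda>x. indicator C x * f (x + h))" by simp
  qed
qed measurable

text \<open>
  Partial integration for all multi-indices of order \<open>j\<close> at once: the sign \<open>(-1)\<^sup>j\<close> is absorbed by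
  reversing the direction.
\<close>
lemma weak_derivative_directional_form:
  fixes f :: "real ^ ('n::finite) \<Rightarrow> real"
  assumes f: "f \<in> borel_measurable borel" "locally_integrable f"
    and g: "\<And>\<alpha>. mi_order \<alpha> = j \<Longrightarrow> g \<alpha> \<in> borel_measurable borel" "\<And>\<alpha>. mi_order \<alpha> = j \<Longrightarrow> locally_integrable (g \<alpha>)"
    and weak: "\<And>\<alpha>. mi_order \<alpha> = j \<Longrightarrow>
      (\<integral>y. f y * mi_deriv \<alpha> \<phi> y \<partial>lborel) = (-1) ^ mi_order \<alpha> * (\<integral>y. g \<alpha> y * \<phi> y \<partial>lborel)"
    and \<phi>: "test_function \<phi>"
  shows "(\<integral>y. directional_form j (\<lambda>\<alpha>. g \<alpha> y) h * \<phi> y \<partial>lborel)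
    = (\<integral>y. f y * directional_form j (\<lambda>\<alpha>. mi_deriv \<alpha> \<phi> y) (- h) \<partial>lborel)"
proof -
  have "(\<integral>y. directional_form j (\<lambda>\<alpha>. g \<alpha> y) h * \<phi> y \<partial>lborel) = (\<integral>y. directional_form j (\<lambda>\<alpha>. \<phi> y * g \<alpha> y) h \<partial>lborel)"
    by (simp add: directional_form_cmult mult.commute)
  also have "\<dots> = directional_form j (\<lambda>\<alpha>. \<integral>y. \<phi> y * g \<alpha> y \<partial>lborel) h"
    using integrable_test_function[OF g \<phi>] by (intro integral_directional_form) (simp add: mult.commute)
  also have "\<dots> = directional_form j (\<lambda>\<alpha>. (-1) ^ j * (\<integral>y. f y * mi_deriv \<alpha> \<phi> y \<partial>lborel)) h"
    by (intro directional_form_cong) (simp add: weak mult.commute flip: power_add mult_2)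
  also have "\<dots> = directional_form j (\<lambda>\<alpha>. \<integral>y. f y * mi_deriv \<alpha> \<phi> y \<partial>lborel) (- h)"
    by (simp add: directional_form_cmult directional_form_uminus)
  also have "\<dots> = (\<integral>y. directional_form j (\<lambda>\<alpha>. f y * mi_deriv \<alpha> \<phi> y) (- h) \<partial>lborel)"
    using integrable_test_function[OF f test_function_mi_deriv[OF \<phi>]] by (intro integral_directional_form[symmetric])
  finally show ?thesis by (simp add: directional_form_cmult)
qed

lemma continuous_on_directional_form:
  assumes "\<And>\<alpha>. continuous_on S (c \<alpha>)"
  shows "continuous_on S (\<lambda>y. directional_form j (\<lambda>\<alpha>. c \<alpha> y) h)"
  unfolding directional_form_def by (intro continuous_intros assms)

lemma taylor_formula_segment_mean:
  fixes \<phi> :: "real ^ ('n::finite) \<Rightarrow> real"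
  assumes "smooth \<phi>" "m \<ge> 1"
  shows "segment_mean (taylor_weight m) h (\<lambda>y. directional_form m (\<lambda>\<alpha>. mi_deriv \<alpha> \<phi> y) h) x
    = \<phi> (x + h) - (\<Sum>j<m. directional_form j (\<lambda>\<alpha>. mi_deriv \<alpha> \<phi> x) h / fact j)"
proof -
  let ?F = "\<lambda>t. taylor_weight m t * directional_form m (\<lambda>\<alpha>. mi_deriv \<alpha> \<phi> (x + t *\<^sub>R h)) h"
  have "continuous_on UNIV (mi_deriv \<alpha> \<phi>)" for \<alpha>
    unfolding mi_deriv_def by (intro smooth_continuous_on smooth_iter assms)
  hence "continuous_on {0..1} (\<lambda>t. mi_deriv \<alpha> \<phi> (x + t *\<^sub>R h))" for \<alpha>
    by (rule continuous_on_compose2) (auto intro!: continuous_intros)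
  hence "continuous_on {0..1} ?F"
    unfolding taylor_weight_def by (intro continuous_intros continuous_on_directional_form) auto
  hence si: "set_integrable lborel {0..1} ?F" by (rule borel_integrable_atLeastAtMost')
  have "(LINT t:{0..1}|lborel. ?F t) = integral {0..1} ?F"
    using set_borel_integral_eq_integral(2)[OF si] .
  also have "\<dots> = \<phi> (x + h) - (\<Sum>j<m. directional_form j (\<lambda>\<alpha>. mi_deriv \<alpha> \<phi> x) h / fact j)"
    unfolding taylor_weight_def by (rule integral_unique[OF taylor_formula_along_line[OF assms]])
  finally show ?thesis by (simp add: segment_mean_def set_lebesgue_integral_def mult.assoc)
qed

text \<open>
  Tested against \<open>\<phi>\<close>, every term can be transferred to \<open>\<phi>\<close>: the translate by changing variables, the
  Taylor terms by partial integration, and the remainder by both, for each \<open>t\<close> separately. What remains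
  is \<open>f\<close> integrated against the defect of Taylor's formula for the smooth function \<open>\<phi>\<close> in direction
  \<open>- h\<close>, which is zero.
\<close>
lemma weak_taylor_formula:
  fixes f :: "real ^ ('n::finite) \<Rightarrow> real"
  assumes m: "m \<ge> 1"
    and f: "f \<in> borel_measurable borel" "locally_integrable f"
    and g: "\<And>\<alpha>. mi_order \<alpha> \<le> m \<Longrightarrow> g \<alpha> \<in> borel_measurable borel" "\<And>\<alpha>. mi_order \<alpha> \<le> m \<Longrightarrow> locally_integrable (g \<alpha>)"
    and weak: "\<And>\<alpha> \<phi>. mi_order \<alpha> \<le> m \<Longrightarrow> test_function \<phi> \<Longrightarrow>
      (\<integral>y. f y * mi_deriv \<alpha> \<phi> y \<partial>lborel) = (-1) ^ mi_order \<alpha> * (\<integral>y. g \<alpha> y * \<phi> y \<partial>lborel)"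
  shows "AE y in lborel. f (y + h) - (\<Sum>j<m. directional_form j (\<lambda>\<alpha>. g \<alpha> y) h / fact j)
    = segment_mean (taylor_weight m) h (\<lambda>y. directional_form m (\<lambda>\<alpha>. g \<alpha> y) h) y"
proof -
  define G where "G j y = directional_form j (\<lambda>\<alpha>. g \<alpha> y) h" for j y
  define M where "M = segment_mean (taylor_weight m) h (G m)"
  define u where "u y = f (y + h) - (\<Sum>j<m. G j y / fact j) - M y" for y
  note w = borel_measurable_taylor_weight[of m] taylor_weight_bound[of _ m]
  note [measurable] = f(1)
  have Gm [measurable]: "G j \<in> borel_measurable borel" and Gl: "locally_integrable (G j)" if "j \<le> m" for j
    unfolding G_def using that g
    by (auto intro!: borel_measurable_directional_form locally_integrable_directional_form)
  have Mm [measurable]: "M \<in> borel_measurable borel" and Ml: "locally_integrable M"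
    unfolding M_def using Gm Gl w by (auto intro!: borel_measurable_segment_mean locally_integrable_segment_mean)
  have um [measurable]: "u \<in> borel_measurable borel" unfolding u_def by measurable
  have ul: "locally_integrable u"
  proof (subst locally_integrable_lborel_iff, measurable, intro allI impI)
    fix C :: "(real ^ 'n) set" assume C: "compact C"
    have "integrable lborel (\<lambda>x. indicator C x * f (x + h) - (\<Sum>j<m. indicator C x * G j x / fact j) - indicator C x * M x)"
      using C locally_integrable_translate[OF f, of h] Ml Gl
      by (intro Bochner_Integration.integrable_diff Bochner_Integration.integrable_sum integrable_divide)
        (auto simp: locally_integrable_lborel_iff)
    thus "integrable lborel (\<lambda>x. indicator C x * u x)"
      by (simp add: u_def right_diff_distrib sum_distrib_left)
  qed
  have z: "(\<integral>x. u x * \<phi> x \<partial>lborel) = 0" if \<phi>: "test_function \<phi>" for \<phi>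
  proof -
    have sm: "smooth \<phi>" using \<phi> by (simp add: test_function_def)
    obtain C where C: "compact C" "\<And>\<alpha> x. x \<notin> C \<Longrightarrow> mi_deriv \<alpha> \<phi> x = 0" using mi_deriv_support[OF \<phi>] by blast
    define D where "D j y = directional_form j (\<lambda>\<alpha>. mi_deriv \<alpha> \<phi> y) (- h)" for j y
    have Dc: "continuous_on UNIV (D j)" for j unfolding D_def
      by (intro continuous_on_directional_form test_function_continuous test_function_mi_deriv \<phi>)
    have D0: "D j x = 0" if "x \<notin> C" for j x unfolding D_def directional_form_def by (simp add: C(2)[OF that])
    have GD: "(\<integral>y. G j y * \<phi> y \<partial>lborel) = (\<integral>y. f y * D j y \<partial>lborel)" if "j \<le> m" for j
      unfolding G_def D_def using that g weak \<phi> by (intro weak_derivative_directional_form f) auto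
    have T: "segment_mean (taylor_weight m) (- h) (D m) y = \<phi> (y - h) - (\<Sum>j<m. D j y / fact j)" for y
      unfolding D_def using taylor_formula_segment_mean[OF sm m, of "- h" y] by simp
    have "(\<integral>y. M y * \<phi> y \<partial>lborel) = (\<integral>t. indicator {0..1} t * taylor_weight m t * (\<integral>y. G m y * \<phi> (y - t *\<^sub>R h) \<partial>lborel) \<partial>lborel)"
      unfolding M_def using \<phi> Gm Gl test_function_continuous[OF \<phi>]
      by (auto simp: test_function_bounded_support intro!: integral_segment_mean_left[OF w])
    also have "\<dots> = (\<integral>t. indicator {0..1} t * taylor_weight m t * (\<integral>y. f y * D m (y - t *\<^sub>R h) \<partial>lborel) \<partial>lborel)"
    proof (rule Bochner_Integration.integral_cong[OF refl])
      fix t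
      have "test_function (\<lambda>y. \<phi> (y + - (t *\<^sub>R h)))" using \<phi> by (rule test_function_translate)
      hence "(\<integral>y. G m y * \<phi> (y + - (t *\<^sub>R h)) \<partial>lborel)
        = (\<integral>y. f y * directional_form m (\<lambda>\<alpha>. mi_deriv \<alpha> (\<lambda>y. \<phi> (y + - (t *\<^sub>R h))) y) (- h) \<partial>lborel)"
        unfolding G_def using g weak by (intro weak_derivative_directional_form f) auto
      hence "(\<integral>y. G m y * \<phi> (y - t *\<^sub>R h) \<partial>lborel) = (\<integral>y. f y * D m (y - t *\<^sub>R h) \<partial>lborel)"
        unfolding mi_deriv_translate by (simp add: D_def)
      thus "indicator {0..1} t * taylor_weight m t * (\<integral>y. G m y * \<phi> (y - t *\<^sub>R h) \<partial>lborel)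
        = indicator {0..1} t * taylor_weight m t * (\<integral>y. f y * D m (y - t *\<^sub>R h) \<partial>lborel)"
        by simp
    qed
    also have "\<dots> = (\<integral>y. f y * segment_mean (taylor_weight m) (- h) (D m) y \<partial>lborel)"
      by (rule integral_segment_mean_right[OF w f Dc C(1) D0, symmetric])
    also have "\<dots> = (\<integral>y. f y * \<phi> (y - h) - (\<Sum>j<m. f y * D j y / fact j) \<partial>lborel)"
      unfolding T by (simp add: right_diff_distrib sum_distrib_left)
    finally have M: "(\<integral>y. M y * \<phi> y \<partial>lborel) = (\<integral>y. f y * \<phi> (y - h) - (\<Sum>j<m. f y * D j y / fact j) \<partial>lborel)" .
    have i1: "integrable lborel (\<lambda>y. f y * \<phi> (y - h))"
      using integrable_test_function[OF f test_function_translate[OF \<phi>, of "- h"]] by simp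
    have i2: "integrable lborel (\<lambda>y. f y * D j y)" for j
      by (rule integrable_mult_continuous_compact_support[OF f Dc C(1) D0])
    have i3: "integrable lborel (\<lambda>y. G j y * \<phi> y)" if "j \<le> m" for j
      using that by (intro integrable_test_function Gm Gl \<phi>)
    have i4: "integrable lborel (\<lambda>y. M y * \<phi> y)" by (intro integrable_test_function Mm Ml \<phi>)
    have [measurable]: "\<phi> \<in> borel_measurable borel"
      using test_function_continuous[OF \<phi>] by (rule borel_measurable_continuous_onI)
    have i5: "integrable lborel (\<lambda>y. f (y + h) * \<phi> y)"
      using i1 integrable_lborel_translate[of "\<lambda>y. f y * \<phi> (y - h)" h] by simp
    have e5: "(\<integral>y. f (y + h) * \<phi> y \<partial>lborel) = (\<integral>y. f y * \<phi> (y - h) \<partial>lborel)"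
      using integral_lborel_translate[of "\<lambda>y. f y * \<phi> (y - h)" h] by simp
    have s2: "integrable lborel (\<lambda>y. \<Sum>j<m. f y * D j y / fact j)"
      "(\<integral>y. (\<Sum>j<m. f y * D j y / fact j) \<partial>lborel) = (\<Sum>j<m. (\<integral>y. f y * D j y \<partial>lborel) / fact j)"
      using i2 by (auto simp: Bochner_Integration.integral_sum)
    have s3: "integrable lborel (\<lambda>y. \<Sum>j<m. G j y * \<phi> y / fact j)"
      "(\<integral>y. (\<Sum>j<m. G j y * \<phi> y / fact j) \<partial>lborel) = (\<Sum>j<m. (\<integral>y. G j y * \<phi> y \<partial>lborel) / fact j)"
      using i3 by (auto simp: Bochner_Integration.integral_sum)
    have "(\<integral>x. u x * \<phi> x \<partial>lborel) = (\<integral>x. f (x + h) * \<phi> x - (\<Sum>j<m. G j x * \<phi> x / fact j) - M x * \<phi> x \<partial>lborel)"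
      by (simp add: u_def left_diff_distrib sum_distrib_right)
    also have "\<dots> = (\<integral>x. f (x + h) * \<phi> x \<partial>lborel) - (\<Sum>j<m. (\<integral>x. G j x * \<phi> x \<partial>lborel) / fact j) - (\<integral>x. M x * \<phi> x \<partial>lborel)"
      using s3 by (simp add: Bochner_Integration.integral_diff[OF Bochner_Integration.integrable_diff[OF i5 s3(1)] i4]
          Bochner_Integration.integral_diff[OF i5 s3(1)])
    also have "\<dots> = 0" unfolding M e5
      using s2 GD by (simp add: Bochner_Integration.integral_diff[OF i1 s2(1)])
    finally show ?thesis .
  qed
  have "AE y in lborel. u y = 0"
    by (rule AE_eq_0_if_orthogonal_to_test_functions[OF um ul z])
  thus ?thesis by eventually_elim (simp add: u_def M_def G_def[abs_def])
qed

section \<open>The norm with a given unit ball\<close>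

lemma zero_in_interior_symmetric_convex:
  fixes K :: "'a::euclidean_space set"
  assumes "convex K" "K = uminus ` K" "interior K \<noteq> {}"
  shows "0 \<in> interior K"
proof -
  obtain x where x: "x \<in> interior K" using assms(3) by blast
  have "interior K = uminus ` interior K"
    using interior_negations[of K] assms(2) by simp
  hence "- x \<in> interior K" using x by (metis imageI)
  with x convex_interior[OF assms(1)] have "(1/2) *\<^sub>R x + (1/2) *\<^sub>R (- x) \<in> interior K"
    by (intro convexD) auto
  thus ?thesis by simp
qed

context
  fixes K :: "(real ^ ('n::finite)) set"
  assumes K_bounded: "bounded K" and K_convex: "convex K" and K_zero: "0 \<in> interior K"
begin

lemma norm_of_ball_set_nonempty: "{r. r > 0 \<and> x /\<^sub>R r \<in> K} \<noteq> {}"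
proof -
  obtain e where e: "e > 0" "ball 0 e \<subseteq> K" using K_zero by (auto simp: mem_interior)
  have n: "norm x + 1 > 0" by (simp add: add_nonneg_pos)
  hence "x /\<^sub>R ((norm x + 1) / e) \<in> ball 0 e"
    using e by (simp add: divide_simps)
  moreover have "(norm x + 1) / e > 0" using n e by simp
  ultimately show ?thesis using e by blast
qed

lemma norm_of_ball_nonneg: "0 \<le> norm_of_ball K x"
  unfolding norm_of_ball_def using norm_of_ball_set_nonempty by (intro cInf_greatest) auto

text \<open>
  The norm forgets which boundary points belong to \<open>K\<close>: its strict sublevel sets are dilates of the
  interior. Its measurability and its homogeneity are read off from this.
\<close>
lemma norm_of_ball_less_iff:
  assumes "s > 0"
  shows "norm_of_ball K x < s \<longleftrightarrow> x /\<^sub>R s \<in> interior K"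
proof
  assume "norm_of_ball K x < s"
  then obtain r where r: "0 < r" "r < s" "x /\<^sub>R r \<in> K"
    unfolding norm_of_ball_def using cInf_lessD[OF norm_of_ball_set_nonempty] by blast
  have "x /\<^sub>R r - (1 - r / s) *\<^sub>R (x /\<^sub>R r - 0) \<in> interior K"
    using r K_zero K_convex by (intro mem_interior_convex_shrink) auto
  also have "x /\<^sub>R r - (1 - r / s) *\<^sub>R (x /\<^sub>R r - 0) = x /\<^sub>R s"
  proof -
    have "x /\<^sub>R r - (1 - r / s) *\<^sub>R (x /\<^sub>R r - 0) = (r / s) *\<^sub>R (x /\<^sub>R r)"
      by (simp add: scaleR_left_diff_distrib del: scaleR_scaleR)
    thus ?thesis using r by (simp add: divide_inverse)
  qed
  finally show "x /\<^sub>R s \<in> interior K" .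
next
  assume "x /\<^sub>R s \<in> interior K"
  then obtain e where e: "e > 0" "ball (x /\<^sub>R s) e \<subseteq> K" by (auto simp: mem_interior)
  define c where "c = norm (x /\<^sub>R s) + 1"
  define \<eta> where "\<eta> = e / (2 * c)"
  have n: "c > 0" unfolding c_def by (simp add: add_nonneg_pos)
  have \<eta>: "\<eta> > 0" unfolding \<eta>_def using e n by (intro divide_pos_pos) auto
  have "\<eta> * norm (x /\<^sub>R s) \<le> \<eta> * c" unfolding c_def using \<eta> by (intro mult_left_mono) auto
  also have "\<dots> = e / 2" unfolding \<eta>_def using n by (simp add: field_simps)
  also have "\<dots> < e" using e by simp
  finally have "dist (x /\<^sub>R s) ((1 + \<eta>) *\<^sub>R (x /\<^sub>R s)) < e"
    using \<eta> by (simp add: dist_norm scaleR_add_left del: scaleR_scaleR)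
  hence "(1 + \<eta>) *\<^sub>R (x /\<^sub>R s) \<in> K" using e(2) by auto
  hence "x /\<^sub>R (s / (1 + \<eta>)) \<in> K" by (simp add: field_simps)
  hence "norm_of_ball K x \<le> s / (1 + \<eta>)"
    unfolding norm_of_ball_def using \<eta> assms by (intro cInf_lower bdd_belowI[of _ 0]) auto
  also have "\<dots> < s" using \<eta> assms by (simp add: divide_simps)
  finally show "norm_of_ball K x < s" .
qed

lemma norm_of_ball_pos:
  assumes "x \<noteq> 0"
  shows "norm_of_ball K x > 0"
proof -
  obtain R where R: "R > 0" "\<And>x. x \<in> K \<Longrightarrow> norm x \<le> R" using K_bounded bounded_pos by blast
  have "norm x / R \<le> norm_of_ball K x"
    unfolding norm_of_ball_def
  proof (rule cInf_greatest[OF norm_of_ball_set_nonempty])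
    fix r assume "r \<in> {r. 0 < r \<and> x /\<^sub>R r \<in> K}"
    thus "norm x / R \<le> r" using R(1) R(2)[of "x /\<^sub>R r"] by (simp add: divide_simps mult.commute)
  qed
  thus ?thesis using assms R(1) by (smt (verit) divide_pos_pos zero_less_norm_iff)
qed

lemma borel_measurable_norm_of_ball [measurable]: "norm_of_ball K \<in> borel_measurable borel"
proof (rule borel_measurableI_less)
  fix s :: real
  have "open {x. norm_of_ball K x < s}"
  proof (cases "s > 0")
    case True
    have "open ((\<lambda>x. x /\<^sub>R s) -` interior K)" by (intro open_vimage continuous_intros) auto
    thus ?thesis using True by (simp add: norm_of_ball_less_iff vimage_def)
  next
    case False
    hence "{x. norm_of_ball K x < s} = {}" using norm_of_ball_nonneg by (auto simp: not_less intro: order.trans)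
    thus ?thesis by simp
  qed
  thus "{x \<in> space borel. norm_of_ball K x < s} \<in> sets borel" by simp
qed

end

section \<open>A substitute for polar coordinates\<close>

lemma nn_integral_powr_tail:
  fixes a r :: real
  assumes "a > 0" "r > 0"
  shows "(\<integral>\<^sup>+s. indicator {a<..} s * ennreal (s powr (- r - 1)) \<partial>lborel) = ennreal (a powr (- r) / r)"
proof -
  have 1: "((\<lambda>s. s powr (- r - 1)) has_integral (a powr (- r) / r)) {a..}"
    using has_integral_powr_to_inf[of "- r - 1" a] assms by simp
  have "(\<integral>\<^sup>+s. ennreal (s powr (- r - 1)) * indicator {a..} s \<partial>lborel) = ennreal (a powr (- r) / r)"
    by (rule nn_integral_has_integral_lebesgue'[OF _ 1]) auto
  moreover have "AE s in lborel. s \<noteq> a" by (rule AE_lborel_singleton)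
  hence "(\<integral>\<^sup>+s. indicator {a<..} s * ennreal (s powr (- r - 1)) \<partial>lborel) = (\<integral>\<^sup>+s. ennreal (s powr (- r - 1)) * indicator {a..} s \<partial>lborel)"
    by (intro nn_integral_cong_AE) (auto simp: indicator_def)
  ultimately show ?thesis by simp
qed

lemma nn_integral_lborel_scale:
  fixes F :: "'a::euclidean_space \<Rightarrow> ennreal"
  assumes [measurable]: "F \<in> borel_measurable borel" and c: "c > 0"
  shows "(\<integral>\<^sup>+x. F x \<partial>lborel) = ennreal (c ^ DIM('a)) * (\<integral>\<^sup>+x. F (c *\<^sub>R x) \<partial>lborel)"
proof -
  have "(\<integral>\<^sup>+x. F x \<partial>lborel) = (\<integral>\<^sup>+x. F x \<partial>density (distr lborel borel (\<lambda>x. 0 + c *\<^sub>R x)) (\<lambda>_. \<bar>c\<bar> ^ DIM('a)))"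
    using lborel_affine[of c "0 :: 'a"] c by simp
  also have "\<dots> = ennreal (c ^ DIM('a)) * (\<integral>\<^sup>+x. F (c *\<^sub>R x) \<partial>lborel)"
    using c by (subst nn_integral_density) (simp_all add: nn_integral_distr nn_integral_cmult)
  finally show ?thesis .
qed

text \<open>
  Each value of the kernel is \<open>r \<integral> s\<^sup>-\<^sup>r\<^sup>-\<^sup>1 ds\<close> over all \<open>s\<close> exceeding the norm of \<open>h\<close>, where \<open>r = N + q\<close>. After
  exchanging the integrals, \<open>h\<close> runs through the open dilate of \<open>K\<close> by \<open>s\<close>, and \<open>h = s k\<close> brings in the
  factor \<open>s\<^sup>N\<close>. The origin, where the kernel has the default value \<open>0\<close>, is a null set.
\<close>
lemma nn_integral_norm_of_ball_kernel:
  fixes K :: "(real ^ ('n::finite)) set" and \<Psi> :: "real ^ 'n \<Rightarrow> ennreal"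
  assumes K: "bounded K" "convex K" "0 \<in> interior K" and q: "q > 0"
    and \<Psi> [measurable]: "\<Psi> \<in> borel_measurable borel"
  shows "(\<integral>\<^sup>+h. ennreal (1 / norm_of_ball K h powr (real CARD('n) + q)) * \<Psi> h \<partial>lborel)
    = ennreal (real CARD('n) + q) * (\<integral>\<^sup>+k. indicator (interior K) k *
        (\<integral>\<^sup>+s. indicator {0<..} s * ennreal (s powr (- q - 1)) * \<Psi> (s *\<^sub>R k) \<partial>lborel) \<partial>lborel)"
proof -
  let ?N = "norm_of_ball K" and ?r = "real CARD('n) + q"
  note [measurable] = borel_measurable_norm_of_ball[OF K]
  have r: "?r > 0" using q by simp
  have [measurable]: "interior K \<in> sets borel" by simp
  let ?F = "\<lambda>s k. ennreal ?r * (indicator (interior K) k * (indicator {0<..} s * ennreal (s powr (- q - 1)) * \<Psi> (s *\<^sub>R k)))"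
  let ?g = "\<lambda>s h. (if ?N h < s then 1 else 0) * ennreal (s powr (- ?r - 1)) * (ennreal ?r * \<Psi> h)"
  have "(\<integral>\<^sup>+h. ennreal (1 / ?N h powr ?r) * \<Psi> h \<partial>lborel) = (\<integral>\<^sup>+h. \<integral>\<^sup>+s. ?g s h \<partial>lborel \<partial>lborel)"
  proof (rule nn_integral_cong_AE)
    have "AE h in lborel. h \<noteq> (0 :: real ^ 'n)" by (rule AE_lborel_singleton)
    thus "AE h in lborel. ennreal (1 / ?N h powr ?r) * \<Psi> h = (\<integral>\<^sup>+s. ?g s h \<partial>lborel)"
    proof eventually_elim
      case (elim h)
      have N: "?N h > 0" using norm_of_ball_pos[OF K elim] .
      have "(\<integral>\<^sup>+s. ?g s h \<partial>lborel) = (\<integral>\<^sup>+s. indicator {?N h<..} s * ennreal (s powr (- ?r - 1)) * (ennreal ?r * \<Psi> h) \<partial>lborel)"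
        by (intro nn_integral_cong) (auto simp: indicator_def)
      also have "\<dots> = (\<integral>\<^sup>+s. indicator {?N h<..} s * ennreal (s powr (- ?r - 1)) \<partial>lborel) * (ennreal ?r * \<Psi> h)"
        by (rule nn_integral_multc) measurable
      also have "\<dots> = ennreal (?N h powr (- ?r) / ?r) * ennreal ?r * \<Psi> h"
        by (subst nn_integral_powr_tail[OF N r]) (simp add: mult.assoc)
      also have "ennreal (?N h powr (- ?r) / ?r) * ennreal ?r = ennreal (1 / ?N h powr ?r)"
        using r by (subst ennreal_mult[symmetric]) (auto simp: powr_minus_divide[symmetric])
      finally show ?case by simp
    qed
  qed
  also have "\<dots> = (\<integral>\<^sup>+s. \<integral>\<^sup>+h. ?g s h \<partial>lborel \<partial>lborel)"
    by (rule lborel_pair.Fubini') measurable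
  also have "\<dots> = (\<integral>\<^sup>+s. \<integral>\<^sup>+k. ?F s k \<partial>lborel \<partial>lborel)"
  proof (rule nn_integral_cong)
    fix s :: real
    show "(\<integral>\<^sup>+h. ?g s h \<partial>lborel) = (\<integral>\<^sup>+k. ?F s k \<partial>lborel)"
    proof (cases "s > 0")
      case False
      hence "\<not> ?N h < s" for h using norm_of_ball_nonneg[OF K, of h] by simp
      thus ?thesis using False by simp
    next
      case s: True
      have p: "s ^ CARD('n) * s powr (- ?r - 1) = s powr (- q - 1)"
        using s by (simp add: powr_realpow[symmetric] powr_add[symmetric])
      have "(\<integral>\<^sup>+h. ?g s h \<partial>lborel) = ennreal (s ^ DIM(real ^ 'n)) * (\<integral>\<^sup>+k. ?g s (s *\<^sub>R k) \<partial>lborel)"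
        using s by (intro nn_integral_lborel_scale) measurable
      also have "\<dots> = (\<integral>\<^sup>+k. ennreal (s ^ DIM(real ^ 'n)) * ?g s (s *\<^sub>R k) \<partial>lborel)"
        by (rule nn_integral_cmult[symmetric]) measurable
      also have "\<dots> = (\<integral>\<^sup>+k. ?F s k \<partial>lborel)"
      proof (rule nn_integral_cong)
        fix k
        have "?N (s *\<^sub>R k) < s \<longleftrightarrow> k \<in> interior K" using norm_of_ball_less_iff[OF K s, of "s *\<^sub>R k"] s by simp
        hence i: "(if ?N (s *\<^sub>R k) < s then 1 else 0 :: ennreal) = indicator (interior K) k" by (simp add: indicator_def)
        have "ennreal (s ^ DIM(real ^ 'n)) * ?g s (s *\<^sub>R k)
          = (ennreal (s ^ CARD('n)) * ennreal (s powr (- ?r - 1))) * (ennreal ?r * (indicator (interior K) k * \<Psi> (s *\<^sub>R k)))"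
          unfolding i by (simp add: mult_ac)
        also have "ennreal (s ^ CARD('n)) * ennreal (s powr (- ?r - 1)) = ennreal (s powr (- q - 1))"
          using s p by (simp add: ennreal_mult[symmetric])
        finally show "ennreal (s ^ DIM(real ^ 'n)) * ?g s (s *\<^sub>R k)
          = ?F s k"
          using s by (simp add: mult_ac)
      qed
      finally show ?thesis .
    qed
  qed
  also have "\<dots> = (\<integral>\<^sup>+k. \<integral>\<^sup>+s. ?F s k \<partial>lborel \<partial>lborel)"
    by (rule lborel_pair.Fubini') measurable
  also have "\<dots> = (\<integral>\<^sup>+k. ennreal ?r * (indicator (interior K) k * (\<integral>\<^sup>+s. indicator {0<..} s * ennreal (s powr (- q - 1)) * \<Psi> (s *\<^sub>R k) \<partial>lborel)) \<partial>lborel)"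
    by (simp add: nn_integral_cmult)
  also have "\<dots> = ennreal ?r * (\<integral>\<^sup>+k. indicator (interior K) k * (\<integral>\<^sup>+s. indicator {0<..} s * ennreal (s powr (- q - 1)) * \<Psi> (s *\<^sub>R k) \<partial>lborel) \<partial>lborel)"
    by (rule nn_integral_cmult) measurable
  finally show ?thesis .
qed

text \<open>
  The condition \<open>s\<^sup>m a > 1\<close> means that \<open>s\<close> exceeds \<open>a\<close> to the power \<open>-1/m\<close>; for \<open>a = 0\<close> it is never satisfied,
  and both sides vanish.
\<close>
lemma nn_integral_superlevel_powr:
  fixes a q :: real
  assumes "a \<ge> 0" "q > 0" "m \<ge> 1"
  shows "(\<integral>\<^sup>+s. indicator {0<..} s * ennreal (s powr (- q - 1)) * indicator {s. s ^ m * a > 1} s \<partial>lborel)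
    = ennreal (a powr (q / m) / q)"
proof (cases "a = 0")
  case False
  hence a: "a > 0" using assms by simp
  define b where "b = a powr (- 1 / m)"
  have b1: "b > 0" using a by (simp add: b_def)
  have "b ^ m = a powr (- 1 / m * m)" unfolding b_def powr_powr[symmetric]
    using b1 by (simp add: b_def powr_realpow)
  also have "\<dots> = 1 / a" using a assms(3) by (simp add: powr_minus_divide)
  finally have b: "b > 0" "b ^ m = 1 / a" using b1 by auto
  have "1 < s ^ m * a \<longleftrightarrow> b < s" if "s > 0" for s
  proof -
    have "1 < s ^ m * a \<longleftrightarrow> b ^ m < s ^ m" unfolding b(2) using a by (simp add: divide_simps)
    also have "\<dots> \<longleftrightarrow> b < s" using b that assms(3) using power_mono_iff[of s b m] b(1) that assms(3) by linarith
    finally show ?thesis .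
  qed
  hence "(\<integral>\<^sup>+s. indicator {0<..} s * ennreal (s powr (- q - 1)) * indicator {s. s ^ m * a > 1} s \<partial>lborel)
    = (\<integral>\<^sup>+s. indicator {b<..} s * ennreal (s powr (- q - 1)) \<partial>lborel)"
    using b(1) by (intro nn_integral_cong) (auto simp: indicator_def)
  also have "\<dots> = ennreal (b powr (- q) / q)" by (rule nn_integral_powr_tail[OF b(1) assms(2)])
  also have "b powr (- q) = a powr (q / m)" unfolding b_def by (simp add: powr_powr)
  finally show ?thesis .
qed (use assms in simp)

section \<open>Continuity of translations in the mean\<close>

definition translation_gap :: "('a::euclidean_space \<Rightarrow> real) \<Rightarrow> 'a \<Rightarrow> ennreal" where
  "translation_gap u h = (\<integral>\<^sup>+x. ennreal \<bar>u (x + h) - u x\<bar> \<partial>lborel)"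

lemma translation_gap_add_le:
  assumes [measurable]: "u \<in> borel_measurable borel" "v \<in> borel_measurable borel"
  shows "translation_gap (\<lambda>x. u x + v x) h \<le> translation_gap u h + translation_gap v h"
proof -
  have "translation_gap (\<lambda>x. u x + v x) h \<le> (\<integral>\<^sup>+x. ennreal \<bar>u (x + h) - u x\<bar> + ennreal \<bar>v (x + h) - v x\<bar> \<partial>lborel)"
    unfolding translation_gap_def by (intro nn_integral_mono) (auto simp flip: ennreal_plus)
  also have "\<dots> = translation_gap u h + translation_gap v h"
    unfolding translation_gap_def by (rule nn_integral_add) auto
  finally show ?thesis .
qed

lemma translation_gap_le:
  fixes u :: "'a::euclidean_space \<Rightarrow> real"
  assumes [measurable]: "u \<in> borel_measurable borel"
  shows "translation_gap u h \<le> 2 * (\<integral>\<^sup>+x. ennreal \<bar>u x\<bar> \<partial>lborel)"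
proof -
  have "translation_gap u h \<le> (\<integral>\<^sup>+x. ennreal \<bar>u (x + h)\<bar> + ennreal \<bar>u x\<bar> \<partial>lborel)"
    unfolding translation_gap_def by (intro nn_integral_mono) (auto simp flip: ennreal_plus)
  also have "\<dots> = (\<integral>\<^sup>+x. ennreal \<bar>u (x + h)\<bar> \<partial>lborel) + (\<integral>\<^sup>+x. ennreal \<bar>u x\<bar> \<partial>lborel)"
    by (rule nn_integral_add) auto
  also have "(\<integral>\<^sup>+x. ennreal \<bar>u (x + h)\<bar> \<partial>lborel) = (\<integral>\<^sup>+x. ennreal \<bar>u x\<bar> \<partial>lborel)"
    by (rule nn_integral_lborel_translate[of "\<lambda>x. ennreal \<bar>u x\<bar>"]) measurable
  finally show ?thesis by (simp add: mult_2)
qed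

lemma translation_gap_approx:
  fixes u :: "'a::euclidean_space \<Rightarrow> real"
  assumes u [measurable]: "u \<in> borel_measurable borel"
    and approx: "\<And>e :: real. e > 0 \<Longrightarrow> \<exists>v \<in> borel_measurable borel. (translation_gap v \<longlongrightarrow> 0) (at 0) \<and>
      (\<integral>\<^sup>+x. ennreal \<bar>u x - v x\<bar> \<partial>lborel) \<le> ennreal e"
  shows "(translation_gap u \<longlongrightarrow> 0) (at 0)"
proof (rule order_tendstoI)
  fix a :: ennreal assume "0 < a"
  then obtain e where e: "e > 0" "ennreal e < a"
  proof -
    obtain z where z: "0 < z" "z < a" using dense[OF \<open>0 < a\<close>] by blast
    obtain r where "z = ennreal r" using z by (cases z) auto
    thus ?thesis using z that[of r] by simp
  qed
  obtain v where v [measurable]: "v \<in> borel_measurable borel" "(translation_gap v \<longlongrightarrow> 0) (at 0)"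
    and d: "(\<integral>\<^sup>+x. ennreal \<bar>u x - v x\<bar> \<partial>lborel) \<le> ennreal (e / 4)" using approx[of "e / 4"] e by auto
  have "\<forall>\<^sub>F h in at 0. translation_gap v h < ennreal (e / 2)"
    using e by (intro order_tendstoD(2)[OF v(2)]) auto
  thus "\<forall>\<^sub>F h in at 0. translation_gap u h < a"
  proof eventually_elim
    case (elim h)
    have "translation_gap u h = translation_gap (\<lambda>x. v x + (u x - v x)) h" by simp
    also have "\<dots> \<le> translation_gap v h + translation_gap (\<lambda>x. u x - v x) h"
      by (rule translation_gap_add_le) auto
    also have "\<dots> \<le> ennreal (e / 2) + ennreal (e / 2)"
    proof (rule add_mono)
      have "translation_gap (\<lambda>x. u x - v x) h \<le> 2 * (\<integral>\<^sup>+x. ennreal \<bar>u x - v x\<bar> \<partial>lborel)"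
        by (rule translation_gap_le) measurable
      also have "\<dots> \<le> 2 * ennreal (e / 4)" by (intro mult_left_mono d) simp
      also have "\<dots> = ennreal (e / 2)" using e ennreal_mult[of 2 "e / 4"] by simp
      finally show "translation_gap (\<lambda>x. u x - v x) h \<le> ennreal (e / 2)" .
    qed (use elim in simp)
    also have "\<dots> = ennreal e"
      using e ennreal_plus[of "e / 2" "e / 2"] by simp
    also have "\<dots> < a" by fact
    finally show ?case .
  qed
qed auto

text \<open>
  An open set contains \<open>x + h\<close> for small \<open>h\<close> whenever it contains \<open>x\<close>, so dominated convergence applies
  to the points that a translation moves out of \<open>U\<close>. The points moved into \<open>U\<close> are those moved out by
  the inverse translation.
\<close>
lemma translation_gap_open:
  fixes U :: "'a::euclidean_space set"
  assumes U: "open U" "emeasure lborel U < \<infinity>"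
  shows "(translation_gap (indicator U) \<longlongrightarrow> 0) (at 0)"
  unfolding tendsto_at_iff_sequentially
proof (intro allI impI)
  fix X :: "nat \<Rightarrow> 'a" assume X: "X \<longlonglongrightarrow> 0"
  have [measurable]: "U \<in> sets borel" using U by simp
  have *: "(\<lambda>n. \<integral>\<^sup>+x. indicator U x * indicator (- U) (x + Y n) \<partial>lborel) \<longlonglongrightarrow> (\<integral>\<^sup>+x. 0 \<partial>(lborel :: 'a measure))"
    if Y: "Y \<longlonglongrightarrow> 0" for Y
  proof (rule nn_integral_dominated_convergence[where w = "indicator U"])
    show "AE x in lborel. (\<lambda>n. indicator U x * indicator (- U) (x + Y n) :: ennreal) \<longlonglongrightarrow> 0"
    proof (rule AE_I2)
      fix x
      show "(\<lambda>n. indicator U x * indicator (- U) (x + Y n) :: ennreal) \<longlonglongrightarrow> 0"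
      proof (cases "x \<in> U")
        case True
        have "(\<lambda>n. x + Y n) \<longlonglongrightarrow> x + 0" using Y by (intro tendsto_intros)
        hence "\<forall>\<^sub>F n in sequentially. x + Y n \<in> U" using True U(1) by (simp add: topological_tendstoD)
        hence "\<forall>\<^sub>F n in sequentially. indicator U x * indicator (- U) (x + Y n) = (0 :: ennreal)"
          by eventually_elim auto
        thus ?thesis by (rule tendsto_eventually)
      qed auto
    qed
    show "(\<integral>\<^sup>+x. indicator U x \<partial>lborel) < \<infinity>" using U(2) by simp
  qed (measurable, auto simp: indicator_def)
  let ?out = "\<lambda>h. \<integral>\<^sup>+x. indicator U x * indicator (- U) (x + h) \<partial>(lborel :: 'a measure)"
  let ?in = "\<lambda>h. \<integral>\<^sup>+x. indicator U (x + h) * indicator (- U) (x + h + - h) \<partial>(lborel :: 'a measure)"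
  have "translation_gap (indicator U) h = ?out h
    + ?out (- h)" for h
  proof -
    have "translation_gap (indicator U) h = (\<integral>\<^sup>+x. indicator U x * indicator (- U) (x + h)
      + indicator U (x + h) * indicator (- U) (x + h + - h) \<partial>lborel)"
      unfolding translation_gap_def by (intro nn_integral_cong) (auto simp: indicator_def)
    also have "\<dots> = ?out h
      + ?in h"
      by (rule nn_integral_add) measurable
    also have "?in h
      = ?out (- h)"
      by (rule nn_integral_lborel_translate[of "\<lambda>x. indicator U x * indicator (- U) (x + - h)"]) measurable
    finally show ?thesis .
  qed
  moreover have "(\<lambda>n. - X n) \<longlonglongrightarrow> 0" using tendsto_minus[OF X] by simp
  ultimately show "(translation_gap (indicator U) \<circ> X) \<longlonglongrightarrow> 0"
    using tendsto_add[OF *[OF X] *[of "\<lambda>n. - X n"]] by (simp add: o_def)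
qed

lemma translation_gap_indicator:
  fixes A :: "'a::euclidean_space set"
  assumes A [measurable]: "A \<in> sets borel" and fin: "emeasure lborel A < \<infinity>"
  shows "(translation_gap (indicator A) \<longlongrightarrow> 0) (at 0)"
proof (rule translation_gap_approx)
  fix e :: real assume "e > 0"
  obtain U where U: "open U" "A \<subseteq> U" "emeasure lborel (U - A) < e"
    using outer_regular_lborel[OF A \<open>e > 0\<close>] .
  have [measurable]: "U \<in> sets borel" using U by simp
  have "emeasure lborel U = emeasure lborel A + emeasure lborel (U - A)"
    using U(2) by (subst plus_emeasure) (auto simp: Un_absorb1)
  also have "\<dots> < \<infinity>" using fin U(3) by (auto intro: order.strict_trans simp: less_top[symmetric])
  finally have "(translation_gap (indicator U) \<longlongrightarrow> 0) (at 0)" using U(1) by (rule translation_gap_open[rotated])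
  moreover have "(\<integral>\<^sup>+x. ennreal \<bar>indicator A x - indicator U x\<bar> \<partial>lborel) = (\<integral>\<^sup>+x. indicator (U - A) x \<partial>lborel)"
    using U(2) by (intro nn_integral_cong) (auto simp: indicator_def)
  hence "(\<integral>\<^sup>+x. ennreal \<bar>indicator A x - indicator U x\<bar> \<partial>lborel) \<le> ennreal e"
    using U(3) by simp
  ultimately show "\<exists>v \<in> borel_measurable borel. (translation_gap v \<longlongrightarrow> 0) (at 0) \<and>
      (\<integral>\<^sup>+x. ennreal \<bar>indicator A x - v x\<bar> \<partial>lborel) \<le> ennreal e"
    by (intro bexI[of _ "indicator U"]) auto
qed measurable

text \<open>
  Integrable functions are built from sets of finite measure, and outer regularity replaces these by
  open sets.
\<close>
lemma translation_gap_tendsto_0: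
  fixes u :: "'a::euclidean_space \<Rightarrow> real"
  assumes "integrable lborel u"
  shows "(translation_gap u \<longlongrightarrow> 0) (at 0)"
  using assms
proof (induction rule: integrable_induct)
  case (base A c)
  have [measurable]: "A \<in> sets borel" using base by simp
  have "translation_gap (\<lambda>x. indicator A x *\<^sub>R c) h = ennreal \<bar>c\<bar> * translation_gap (indicator A) h" for h
  proof -
    have "(\<integral>\<^sup>+x. ennreal \<bar>c\<bar> * ennreal \<bar>indicator A (x + h) - indicator A x\<bar> \<partial>lborel) = ennreal \<bar>c\<bar> * translation_gap (indicator A) h"
      unfolding translation_gap_def by (rule nn_integral_cmult) measurable
    thus ?thesis unfolding translation_gap_def
      by (simp add: ennreal_mult[symmetric] abs_mult[symmetric] right_diff_distrib mult.commute)
  qed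
  moreover have "((\<lambda>h. ennreal \<bar>c\<bar> * translation_gap (indicator A) h) \<longlongrightarrow> ennreal \<bar>c\<bar> * 0) (at 0)"
    using base by (intro ennreal_tendsto_cmult translation_gap_indicator) auto
  ultimately show ?case by simp
next
  case (add f g)
  have "((\<lambda>h. translation_gap f h + translation_gap g h) \<longlongrightarrow> 0 + 0) (at 0)"
    by (intro tendsto_add add)
  hence "((\<lambda>h. translation_gap f h + translation_gap g h) \<longlongrightarrow> 0) (at 0)" by simp
  moreover have "f \<in> borel_measurable borel" "g \<in> borel_measurable borel"
    using borel_measurable_integrable[OF add(1)] borel_measurable_integrable[OF add(2)] by simp_all
  hence "translation_gap (\<lambda>x. f x + g x) h \<le> translation_gap f h + translation_gap g h" for h
    by (rule translation_gap_add_le)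
  hence "\<forall>\<^sub>F h in at 0. translation_gap (\<lambda>x. f x + g x) h \<le> translation_gap f h + translation_gap g h"
    by simp
  ultimately show ?case
    using tendsto_sandwich[of "\<lambda>_. 0" "translation_gap (\<lambda>x. f x + g x)" "at 0" "\<lambda>h. translation_gap f h + translation_gap g h" 0]
    by simp
next
  case (lim f s)
  have f: "integrable lborel f" and s: "integrable lborel (s i)" for i by (rule lim)+
  have [measurable]: "f \<in> borel_measurable borel" "\<And>i. s i \<in> borel_measurable borel"
    using borel_measurable_integrable[OF f] borel_measurable_integrable[OF s] by simp_all
  have "(\<lambda>i. \<integral>\<^sup>+x. norm (f x - s i x) \<partial>lborel) \<longlonglongrightarrow> 0"
  proof (rule nn_integral_dominated_convergence_norm[where w = "\<lambda>x. 2 * norm (f x)"])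
    have "integrable lborel (\<lambda>x. 2 * norm (f x))" using f by simp
    thus "(\<integral>\<^sup>+x. ennreal (2 * norm (f x)) \<partial>lborel) < \<infinity>" unfolding integrable_iff_bounded by simp
    show "AE x in lborel. norm (s i x) \<le> 2 * norm (f x)" for i by (rule AE_I2) (rule lim)
    show "AE x in lborel. (\<lambda>i. s i x) \<longlonglongrightarrow> f x" by (rule AE_I2) (rule lim)
  qed measurable
  hence *: "(\<lambda>i. \<integral>\<^sup>+x. ennreal \<bar>f x - s i x\<bar> \<partial>lborel) \<longlonglongrightarrow> 0" by simp
  show ?case
  proof (rule translation_gap_approx)
    fix e :: real assume "e > 0"
    hence "\<forall>\<^sub>F i in sequentially. (\<integral>\<^sup>+x. ennreal \<bar>f x - s i x\<bar> \<partial>lborel) < ennreal e"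
      by (intro order_tendstoD(2)[OF *]) auto
    then obtain i where "(\<integral>\<^sup>+x. ennreal \<bar>f x - s i x\<bar> \<partial>lborel) < ennreal e"
      by (auto simp: eventually_sequentially)
    thus "\<exists>v \<in> borel_measurable borel. (translation_gap v \<longlongrightarrow> 0) (at 0) \<and>
      (\<integral>\<^sup>+x. ennreal \<bar>f x - v x\<bar> \<partial>lborel) \<le> ennreal e"
      by (intro bexI[of _ "s i"] conjI lim) auto
  qed measurable
qed


section \<open>Deviation of means from the function\<close>

definition segment_osc :: "('a::euclidean_space \<Rightarrow> real) \<Rightarrow> 'a \<Rightarrow> 'a \<Rightarrow> ennreal" where
  "segment_osc u h y = (\<integral>\<^sup>+t. indicator {0..1} t * ennreal \<bar>u (y + t *\<^sub>R h) - u y\<bar> \<partial>lborel)"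

definition truncate_below :: "real \<Rightarrow> ('a \<Rightarrow> real) \<Rightarrow> 'a \<Rightarrow> real" where
  "truncate_below c u y = (if \<bar>u y\<bar> > c then u y else 0)"

lemma borel_measurable_segment_osc [measurable]:
  fixes u :: "'a::euclidean_space \<Rightarrow> real"
  assumes [measurable]: "u \<in> borel_measurable borel"
  shows "segment_osc u h \<in> borel_measurable borel"
  unfolding segment_osc_def[abs_def] by measurable

lemma borel_measurable_truncate_below [measurable]:
  assumes [measurable]: "u \<in> borel_measurable M"
  shows "truncate_below c u \<in> borel_measurable M"
  unfolding truncate_below_def[abs_def] by measurable

lemma segment_osc_truncate_below:
  fixes u :: "'a::euclidean_space \<Rightarrow> real"
  assumes [measurable]: "u \<in> borel_measurable borel" and c: "c \<ge> 0"
  shows "segment_osc u h y \<le> segment_osc (truncate_below c u) h y + ennreal (2 * c)"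
proof -
  let ?v = "truncate_below c u"
  have "segment_osc u h y \<le> (\<integral>\<^sup>+t. indicator {0..1} t * ennreal \<bar>?v (y + t *\<^sub>R h) - ?v y\<bar>
      + indicator {0..1::real} t * ennreal (2 * c) \<partial>lborel)"
    unfolding segment_osc_def using c
    by (intro nn_integral_mono) (auto simp: indicator_def truncate_below_def simp flip: ennreal_plus)
  also have "\<dots> = segment_osc ?v h y + (\<integral>\<^sup>+t. indicator {0..1::real} t * ennreal (2 * c) \<partial>lborel)"
    unfolding segment_osc_def by (rule nn_integral_add) measurable
  also have "(\<integral>\<^sup>+t. indicator {0..1::real} t * ennreal (2 * c) \<partial>lborel) = ennreal (2 * c)"
    by (subst nn_integral_multc) auto
  finally show ?thesis .
qed

text \<open>
  If the right-hand side is finite, then \<open>u\<close> is integrable along the segment; otherwise there is nothing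
  to prove, even though the mean has a default value.
\<close>
lemma segment_mean_diff_le_segment_osc:
  fixes u :: "real ^ ('n::finite) \<Rightarrow> real"
  assumes [measurable]: "u \<in> borel_measurable borel" "w \<in> borel_measurable borel"
    and w: "\<And>t. 0 \<le> t \<Longrightarrow> t \<le> 1 \<Longrightarrow> \<bar>w t\<bar> \<le> 1"
    and W: "(\<integral>t. indicator {0..1} t * w t \<partial>lborel) = W"
  shows "ennreal \<bar>segment_mean w h u y - W * u y\<bar> \<le> segment_osc u h y"
proof (cases "segment_osc u h y = \<infinity>")
  case False
  have iw: "integrable lborel (\<lambda>t. indicator {0..1} t * w t)"
  proof (rule Bochner_Integration.integrable_bound)
    show "integrable lborel (indicator {0..1::real} :: real \<Rightarrow> real)" by simp
    show "AE t in lborel. norm (indicator {0..1} t * w t) \<le> norm (indicator {0..1} t :: real)"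
      using w by (intro AE_I2) (auto simp: indicator_def)
  qed measurable
  have nn: "(\<integral>\<^sup>+t. ennreal (norm (indicator {0..1} t * w t * (u (y + t *\<^sub>R h) - u y))) \<partial>lborel) \<le> segment_osc u h y"
    unfolding segment_osc_def
    using w by (intro nn_integral_mono) (auto simp: indicator_def abs_mult intro!: ennreal_leI mult_left_le_one_le)
  hence i: "integrable lborel (\<lambda>t. indicator {0..1} t * w t * (u (y + t *\<^sub>R h) - u y))"
    using False by (intro integrableI_bounded) (auto simp: top.not_eq_extremum intro: order.strict_trans1)
  have "segment_mean w h u y = (\<integral>t. indicator {0..1} t * w t * (u (y + t *\<^sub>R h) - u y) + indicator {0..1} t * w t * u y \<partial>lborel)"
    unfolding segment_mean_def by (intro Bochner_Integration.integral_cong) (auto simp: algebra_simps)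
  also have "\<dots> = (\<integral>t. indicator {0..1} t * w t * (u (y + t *\<^sub>R h) - u y) \<partial>lborel) + W * u y"
    using i iw W by (simp add: Bochner_Integration.integral_add)
  finally have "\<bar>segment_mean w h u y - W * u y\<bar> = norm (\<integral>t. indicator {0..1} t * w t * (u (y + t *\<^sub>R h) - u y) \<partial>lborel)"
    by simp
  also have "ennreal \<dots> \<le> (\<integral>\<^sup>+t. ennreal (norm (indicator {0..1} t * w t * (u (y + t *\<^sub>R h) - u y))) \<partial>lborel)"
    by (rule integral_norm_bound_ennreal[OF i])
  finally show ?thesis using nn by (rule order.trans)
qed simp

lemma nn_integral_segment_osc:
  fixes u :: "'a::euclidean_space \<Rightarrow> real"
  assumes [measurable]: "u \<in> borel_measurable borel"
  shows "(\<integral>\<^sup>+y. segment_osc u h y \<partial>lborel) = (\<integral>\<^sup>+t. indicator {0..1} t * translation_gap u (t *\<^sub>R h) \<partial>lborel)"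
proof -
  have "(\<integral>\<^sup>+y. segment_osc u h y \<partial>lborel)
    = (\<integral>\<^sup>+t. \<integral>\<^sup>+y. indicator {0..1} t * ennreal \<bar>u (y + t *\<^sub>R h) - u y\<bar> \<partial>lborel \<partial>lborel)"
    unfolding segment_osc_def by (rule lborel_pair.Fubini') measurable
  also have "\<dots> = (\<integral>\<^sup>+t. indicator {0..1} t * translation_gap u (t *\<^sub>R h) \<partial>lborel)"
    unfolding translation_gap_def by (intro nn_integral_cong nn_integral_cmult) measurable
  finally show ?thesis .
qed

lemma nn_integral_segment_osc_le:
  fixes u :: "'a::euclidean_space \<Rightarrow> real"
  assumes [measurable]: "u \<in> borel_measurable borel" and c: "\<And>t. 0 \<le> t \<Longrightarrow> t \<le> 1 \<Longrightarrow> translation_gap u (t *\<^sub>R h) \<le> c"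
  shows "(\<integral>\<^sup>+y. segment_osc u h y \<partial>lborel) \<le> c"
proof -
  have "(\<integral>\<^sup>+y. segment_osc u h y \<partial>lborel) \<le> (\<integral>\<^sup>+t. indicator {0..1::real} t * c \<partial>lborel)"
    unfolding nn_integral_segment_osc[OF assms(1)]
    using c by (intro nn_integral_mono) (auto simp: indicator_def)
  also have "\<dots> = c" by (subst nn_integral_multc) auto
  finally show ?thesis .
qed

lemma nn_integral_segment_osc_tendsto_0:
  fixes u :: "'a::euclidean_space \<Rightarrow> real"
  assumes u: "integrable lborel u" and X: "X \<longlonglongrightarrow> 0"
  shows "(\<lambda>n. \<integral>\<^sup>+y. segment_osc u (X n) y \<partial>lborel) \<longlonglongrightarrow> 0"
proof (rule order_tendstoI)
  fix a :: ennreal assume "0 < a"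
  then obtain b where b: "0 < b" "b < a" using dense by blast
  have um: "u \<in> borel_measurable borel" using borel_measurable_integrable[OF u] by simp
  have "\<forall>\<^sub>F h in at 0. translation_gap u h < b"
    using order_tendstoD(2)[OF translation_gap_tendsto_0[OF u] b(1)] .
  then obtain d where d: "d > 0" "\<And>h. h \<noteq> 0 \<Longrightarrow> norm h < d \<Longrightarrow> translation_gap u h < b"
    by (auto simp: eventually_at dist_norm)
  have d': "translation_gap u h \<le> b" if "norm h < d" for h
    using d(2)[of h] that by (cases "h = 0") (auto simp: translation_gap_def intro: less_imp_le)
  have "\<forall>\<^sub>F n in sequentially. norm (X n) < d"
    using tendstoD[OF X d(1)] by simp
  thus "\<forall>\<^sub>F n in sequentially. (\<integral>\<^sup>+y. segment_osc u (X n) y \<partial>lborel) < a"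
  proof eventually_elim
    case (elim n)
    have "(\<integral>\<^sup>+y. segment_osc u (X n) y \<partial>lborel) \<le> b"
    proof (rule nn_integral_segment_osc_le[OF um])
      fix t :: real assume "0 \<le> t" "t \<le> 1"
      hence "norm (t *\<^sub>R X n) \<le> norm (X n)" by (simp add: mult_left_le_one_le)
      thus "translation_gap u (t *\<^sub>R X n) \<le> b" using elim by (intro d') simp
    qed
    thus ?case using b(2) by simp
  qed
qed auto

text \<open>
  Dominated convergence in \<open>h\<close>: the inner integral tends to \<open>0\<close> wherever \<open>u h\<close> is integrable, and it never
  exceeds twice the \<open>L\<^sup>1\<close>-norm of \<open>u h\<close>.
\<close>
lemma weighted_segment_osc_tendsto_0:
  fixes u :: "'a::euclidean_space \<Rightarrow> 'a \<Rightarrow> real" and k :: "'a \<Rightarrow> ennreal"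
  assumes u: "(\<lambda>(h, y). u h y) \<in> borel_measurable (borel \<Otimes>\<^sub>M borel)"
    and k [measurable]: "k \<in> borel_measurable borel" and kfin: "\<And>h. k h < \<infinity>"
    and fin: "(\<integral>\<^sup>+h. k h * (\<integral>\<^sup>+y. ennreal \<bar>u h y\<bar> \<partial>lborel) \<partial>lborel) < \<infinity>"
    and X: "X \<longlonglongrightarrow> (0::real)"
  shows "(\<lambda>n. \<integral>\<^sup>+h. k h * (\<integral>\<^sup>+y. segment_osc (u h) (X n *\<^sub>R h) y \<partial>lborel) \<partial>lborel) \<longlonglongrightarrow> 0"
proof -
  note u' [measurable] = u[unfolded case_prod_beta']
  have u1 [measurable]: "u h \<in> borel_measurable borel" for h
    using measurable_compose[OF measurable_Pair1'[of h borel borel] u] by simp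
  have um [measurable (raw)]: "(\<lambda>x. u (f x) (g x)) \<in> borel_measurable M"
    if [measurable]: "f \<in> M \<rightarrow>\<^sub>M borel" "g \<in> M \<rightarrow>\<^sub>M borel" for f g :: "'c \<Rightarrow> 'a" and M
    using measurable_compose[OF measurable_Pair[OF that] u] by simp
  let ?I = "\<lambda>h. \<integral>\<^sup>+y. ennreal \<bar>u h y\<bar> \<partial>lborel"
  have "(\<lambda>n. \<integral>\<^sup>+h. k h * (\<integral>\<^sup>+y. segment_osc (u h) (X n *\<^sub>R h) y \<partial>lborel) \<partial>lborel) \<longlonglongrightarrow> (\<integral>\<^sup>+h. 0 \<partial>(lborel :: 'a measure))"
  proof (rule nn_integral_dominated_convergence[where w = "\<lambda>h. 2 * (k h * ?I h)"])
    show "(\<lambda>h. k h * (\<integral>\<^sup>+y. segment_osc (u h) (X n *\<^sub>R h) y \<partial>lborel)) \<in> borel_measurable lborel" for n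
      unfolding segment_osc_def by measurable
    show "(\<integral>\<^sup>+h. 2 * (k h * ?I h) \<partial>lborel) < \<infinity>"
      using fin by (subst nn_integral_cmult) (auto simp: ennreal_mult_less_top)
    show "AE h in lborel. k h * (\<integral>\<^sup>+y. segment_osc (u h) (X n *\<^sub>R h) y \<partial>lborel) \<le> 2 * (k h * ?I h)" for n
    proof (rule AE_I2)
      fix h
      have "(\<integral>\<^sup>+y. segment_osc (u h) (X n *\<^sub>R h) y \<partial>lborel) \<le> 2 * ?I h"
        by (rule nn_integral_segment_osc_le[OF u1 translation_gap_le[OF u1]])
      hence "k h * (\<integral>\<^sup>+y. segment_osc (u h) (X n *\<^sub>R h) y \<partial>lborel) \<le> k h * (2 * ?I h)"
        by (rule mult_left_mono) simp
      thus "k h * (\<integral>\<^sup>+y. segment_osc (u h) (X n *\<^sub>R h) y \<partial>lborel) \<le> 2 * (k h * ?I h)"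
        by (simp add: mult.left_commute)
    qed
    have "AE h in lborel. k h * ?I h \<noteq> \<infinity>"
      using fin by (intro nn_integral_noteq_infinite) auto
    thus "AE h in lborel. (\<lambda>n. k h * (\<integral>\<^sup>+y. segment_osc (u h) (X n *\<^sub>R h) y \<partial>lborel)) \<longlonglongrightarrow> 0"
    proof eventually_elim
      case (elim h)
      show ?case
      proof (cases "k h = 0")
        case False
        hence "?I h < \<infinity>" using elim by (auto simp: ennreal_mult_eq_top_iff top.not_eq_extremum)
        hence "integrable lborel (u h)" by (intro integrableI_bounded) auto
        moreover have "(\<lambda>n. X n *\<^sub>R h) \<longlonglongrightarrow> 0" using tendsto_scaleR[OF X tendsto_const[of h]] by simp
        ultimately have "(\<lambda>n. \<integral>\<^sup>+y. segment_osc (u h) (X n *\<^sub>R h) y \<partial>lborel) \<longlonglongrightarrow> 0"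
          by (rule nn_integral_segment_osc_tendsto_0)
        from ennreal_tendsto_cmult[OF kfin[of h, unfolded infinity_ennreal_def] this] show ?thesis by simp
      qed simp
    qed
  qed measurable
  thus ?thesis by simp
qed

section \<open>The limit for a homogeneous family\<close>

text \<open>
  Chebyshev's inequality, in the form in which it compares two level sets: outside of \<open>B\<close>, the points
  of \<open>A\<close> lie where \<open>v\<close> is large.
\<close>
lemma emeasure_le_nn_integral_bad_set:
  assumes [measurable]: "A \<in> sets M" "B \<in> sets M" "v \<in> borel_measurable M"
    and sub: "\<And>y. y \<in> A \<Longrightarrow> y \<notin> B \<Longrightarrow> ennreal \<theta> \<le> v y" and \<theta>: "\<theta> > 0"
  shows "emeasure M A \<le> emeasure M B + ennreal (1 / \<theta>) * (\<integral>\<^sup>+y. v y \<partial>M)"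
proof -
  have "emeasure M A = (\<integral>\<^sup>+y. indicator A y \<partial>M)" by simp
  also have "\<dots> \<le> (\<integral>\<^sup>+y. indicator B y + ennreal (1 / \<theta>) * v y \<partial>M)"
  proof (rule nn_integral_mono)
    fix y
    have "1 \<le> ennreal (1 / \<theta>) * v y" if "y \<in> A" "y \<notin> B"
    proof -
      have "1 = ennreal (1 / \<theta>) * ennreal \<theta>" using \<theta> by (simp flip: ennreal_mult)
      also have "\<dots> \<le> ennreal (1 / \<theta>) * v y" using sub[OF that] by (rule mult_left_mono) simp
      finally show ?thesis .
    qed
    thus "indicator A y \<le> indicator B y + ennreal (1 / \<theta>) * v y" by (auto simp: indicator_def)
  qed
  also have "\<dots> = emeasure M B + ennreal (1 / \<theta>) * (\<integral>\<^sup>+y. v y \<partial>M)"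
    by (subst nn_integral_add) (auto simp: nn_integral_cmult)
  finally show ?thesis .
qed

text \<open>
  Truncation at height \<open>\<theta> / 4\<close> changes each of the two terms of an oscillation by at most \<open>\<theta> / 4\<close>. A
  deviation of at least \<open>\<theta>\<close> therefore forces the oscillation of the truncated function to be at least
  \<open>\<theta> / 2\<close>, and the measure of that set is controlled by Chebyshev's inequality.
\<close>
lemma segment_mean_level_sandwich:
  fixes u :: "real ^ ('n::finite) \<Rightarrow> real"
  assumes [measurable]: "u \<in> borel_measurable borel" "w \<in> borel_measurable borel"
    and w: "\<And>t. 0 \<le> t \<Longrightarrow> t \<le> 1 \<Longrightarrow> \<bar>w t\<bar> \<le> 1"
    and W: "(\<integral>t. indicator {0..1} t * w t \<partial>lborel) = W" "W > 0" and \<theta>: "\<theta> > 0"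
  shows "emeasure lborel {y. \<bar>segment_mean w h u y\<bar> > 1}
      \<le> emeasure lborel {y. \<bar>u y\<bar> > (1 - \<theta>) / W}
        + ennreal (2 / \<theta>) * (\<integral>\<^sup>+y. segment_osc (truncate_below (\<theta> / 4) u) h y \<partial>lborel)" (is ?A)
    and "emeasure lborel {y. \<bar>u y\<bar> > (1 + \<theta>) / W}
      \<le> emeasure lborel {y. \<bar>segment_mean w h u y\<bar> > 1}
        + ennreal (2 / \<theta>) * (\<integral>\<^sup>+y. segment_osc (truncate_below (\<theta> / 4) u) h y \<partial>lborel)" (is ?B)
proof -
  let ?v = "segment_osc (truncate_below (\<theta> / 4) u) h"
  note [measurable] = borel_measurable_segment_mean[OF assms(2) w assms(1)]
  have "\<bar>segment_mean w h u y - W * u y\<bar> < \<theta>" if "\<not> ennreal (\<theta> / 2) \<le> ?v y" for y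
  proof -
    have "ennreal \<bar>segment_mean w h u y - W * u y\<bar> \<le> segment_osc u h y"
      by (rule segment_mean_diff_le_segment_osc[OF assms(1,2) w W(1)])
    also have "\<dots> \<le> ?v y + ennreal (2 * (\<theta> / 4))" using \<theta> by (intro segment_osc_truncate_below) auto
    also have "\<dots> < ennreal (\<theta> / 2) + ennreal (\<theta> / 2)"
    proof (cases "?v y")
      case (real r)
      thus ?thesis using that \<theta> by (simp add: not_le ennreal_less_iff flip: ennreal_plus)
    qed (use that in simp)
    also have "\<dots> = ennreal \<theta>" using \<theta> by (simp flip: ennreal_plus)
    finally show ?thesis using \<theta> by (simp add: ennreal_less_iff)
  qed note close = this
  have abs_Wu: "\<bar>W * u y\<bar> = W * \<bar>u y\<bar>" for y using W(2) by (simp add: abs_mult)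
  have eq: "1 / (\<theta> / 2) = 2 / \<theta>" by simp
  show ?A unfolding eq[symmetric]
  proof (rule emeasure_le_nn_integral_bad_set)
    fix y assume y: "y \<in> {y. \<bar>segment_mean w h u y\<bar> > 1}" "y \<notin> {y. \<bar>u y\<bar> > (1 - \<theta>) / W}"
    show "ennreal (\<theta> / 2) \<le> ?v y"
    proof (rule ccontr)
      assume "\<not> ennreal (\<theta> / 2) \<le> ?v y"
      note close[OF this]
      moreover have "\<bar>segment_mean w h u y\<bar> \<le> \<bar>segment_mean w h u y - W * u y\<bar> + \<bar>W * u y\<bar>" by linarith
      ultimately have "W * \<bar>u y\<bar> > 1 - \<theta>" using y(1) abs_Wu[of y] by simp
      thus False using y(2) W(2) by (simp add: divide_simps mult.commute)
    qed
  qed (use \<theta> in simp_all)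
  show ?B unfolding eq[symmetric]
  proof (rule emeasure_le_nn_integral_bad_set)
    fix y assume y: "y \<in> {y. \<bar>u y\<bar> > (1 + \<theta>) / W}" "y \<notin> {y. \<bar>segment_mean w h u y\<bar> > 1}"
    show "ennreal (\<theta> / 2) \<le> ?v y"
    proof (rule ccontr)
      assume "\<not> ennreal (\<theta> / 2) \<le> ?v y"
      note close[OF this]
      moreover have "\<bar>W * u y\<bar> \<le> \<bar>segment_mean w h u y - W * u y\<bar> + \<bar>segment_mean w h u y\<bar>" by linarith
      ultimately have "W * \<bar>u y\<bar> < 1 + \<theta>" using y(2) abs_Wu[of y] by simp
      thus False using y(1) W(2) by (simp add: divide_simps mult.commute)
    qed
  qed (use \<theta> in simp_all)
qed

definition ball_kernel :: "(real ^ ('n::finite)) set \<Rightarrow> nat \<Rightarrow> real \<Rightarrow> real ^ 'n \<Rightarrow> ennreal" where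
  "ball_kernel K m p h = ennreal (1 / norm_of_ball K h powr (real CARD('n) + real m * p))"

text \<open>
  For \<open>G k y = D\<^sup>m f (y) (k, \<dots>, k)\<close> this is the double integral in the limit, with the boundary of \<open>K\<close>
  removed from the inner domain.
\<close>
definition top_energy ::
    "(real ^ ('n::finite)) set \<Rightarrow> real \<Rightarrow> (real ^ 'n \<Rightarrow> real ^ 'n \<Rightarrow> real) \<Rightarrow> ennreal" where
  "top_energy K p G =
     (\<integral>\<^sup>+y. \<integral>\<^sup>+k. indicator (interior K) k * ennreal (\<bar>G k y\<bar> powr p) \<partial>lborel \<partial>lborel)"

context
  fixes K :: "(real ^ ('n::finite)) set" and m :: nat and p :: real
    and G :: "real ^ 'n \<Rightarrow> real ^ 'n \<Rightarrow> real"
  assumes K: "bounded K" "convex K" "0 \<in> interior K" and m: "m \<ge> 1" and p: "p > 1"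
    and Gm: "(\<lambda>(h, y). G h y) \<in> borel_measurable (borel \<Otimes>\<^sub>M borel)"
    and Ghom: "\<And>s h y. s > 0 \<Longrightarrow> G (s *\<^sub>R h) y = s ^ m * G h y"
begin

lemma borel_measurable_kernel [measurable]: "ball_kernel K m p \<in> borel_measurable borel"
proof -
  note [measurable] = borel_measurable_norm_of_ball[OF K]
  show ?thesis unfolding ball_kernel_def[abs_def] by measurable
qed

lemma borel_measurable_G [measurable (raw)]:
  assumes "f \<in> M \<rightarrow>\<^sub>M borel" "g \<in> M \<rightarrow>\<^sub>M borel"
  shows "(\<lambda>x. G (f x) (g x)) \<in> borel_measurable M"
  using measurable_compose[OF measurable_Pair[OF assms] Gm] by simp

text \<open>
  Common frame of the two computations that follow: only the integral of \<open>\<Psi>\<close> along rays differs.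
\<close>
lemma kernel_integral:
  assumes [measurable]: "(\<lambda>(h, y). \<Psi> h y) \<in> borel_measurable (borel \<Otimes>\<^sub>M borel)"
    and c: "\<And>y k. (\<integral>\<^sup>+s. indicator {0<..} s * ennreal (s powr (- (real m * p) - 1)) * \<Psi> (s *\<^sub>R k) y \<partial>lborel)
       = ennreal c * ennreal (\<bar>G k y\<bar> powr p)" and "c \<ge> 0"
  shows "(\<integral>\<^sup>+h. ball_kernel K m p h * (\<integral>\<^sup>+y. \<Psi> h y \<partial>lborel) \<partial>lborel) = ennreal ((real CARD('n) + real m * p) * c) * top_energy K p G"
proof -
  have [measurable (raw)]: "(\<lambda>x. \<Psi> (f x) (g x)) \<in> borel_measurable M"
    if "f \<in> M \<rightarrow>\<^sub>M borel" "g \<in> M \<rightarrow>\<^sub>M borel" for f g :: "'c \<Rightarrow> real ^ 'n" and M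
    using measurable_compose[OF measurable_Pair[OF that] assms(1)] by simp
  have [measurable]: "interior K \<in> sets borel" by simp
  have q: "real m * p > 0" using m p by simp
  have "(\<integral>\<^sup>+h. ball_kernel K m p h * (\<integral>\<^sup>+y. \<Psi> h y \<partial>lborel) \<partial>lborel) = (\<integral>\<^sup>+h. \<integral>\<^sup>+y. ball_kernel K m p h * \<Psi> h y \<partial>lborel \<partial>lborel)"
    by (intro nn_integral_cong nn_integral_cmult[symmetric]) measurable
  also have "\<dots> = (\<integral>\<^sup>+y. \<integral>\<^sup>+h. ball_kernel K m p h * \<Psi> h y \<partial>lborel \<partial>lborel)"
    by (rule lborel_pair.Fubini') measurable
  also have "\<dots> = (\<integral>\<^sup>+y. ennreal ((real CARD('n) + real m * p) * c) *
      (\<integral>\<^sup>+k. indicator (interior K) k * ennreal (\<bar>G k y\<bar> powr p) \<partial>lborel) \<partial>lborel)"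
  proof (rule nn_integral_cong)
    fix y
    have "(\<integral>\<^sup>+h. ball_kernel K m p h * \<Psi> h y \<partial>lborel) = ennreal (real CARD('n) + real m * p) *
      (\<integral>\<^sup>+k. indicator (interior K) k * (ennreal c * ennreal (\<bar>G k y\<bar> powr p)) \<partial>lborel)"
      unfolding ball_kernel_def c[symmetric] by (rule nn_integral_norm_of_ball_kernel[OF K q]) measurable
    also have "(\<integral>\<^sup>+k. indicator (interior K) k * (ennreal c * ennreal (\<bar>G k y\<bar> powr p)) \<partial>lborel)
      = ennreal c * (\<integral>\<^sup>+k. indicator (interior K) k * ennreal (\<bar>G k y\<bar> powr p) \<partial>lborel)"
      by (subst nn_integral_cmult[symmetric]) (auto simp: mult_ac)
    finally show "(\<integral>\<^sup>+h. ball_kernel K m p h * \<Psi> h y \<partial>lborel) = ennreal ((real CARD('n) + real m * p) * c) *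
      (\<integral>\<^sup>+k. indicator (interior K) k * ennreal (\<bar>G k y\<bar> powr p) \<partial>lborel)"
      using q \<open>c \<ge> 0\<close> by (simp add: ennreal_mult mult.assoc)
  qed
  also have "\<dots> = ennreal ((real CARD('n) + real m * p) * c) * top_energy K p G"
    unfolding top_energy_def by (rule nn_integral_cmult) measurable
  finally show ?thesis .
qed

lemma kernel_level_integral:
  assumes a: "a > 0"
  shows "(\<integral>\<^sup>+h. ball_kernel K m p h * emeasure lborel {y. \<bar>G h y\<bar> > a} \<partial>lborel)
    = ennreal ((real CARD('n) + real m * p) / (real m * p) * a powr (- p)) * top_energy K p G"
proof -
  have q: "real m * p > 0" using m p by simp
  let ?\<Psi> = "\<lambda>h y. if \<bar>G h y\<bar> > a then 1 else 0 :: ennreal"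
  have "emeasure lborel {y. \<bar>G h y\<bar> > a} = (\<integral>\<^sup>+y. ?\<Psi> h y \<partial>lborel)" for h
  proof -
    have "emeasure lborel {y. \<bar>G h y\<bar> > a} = (\<integral>\<^sup>+y. indicator {y. \<bar>G h y\<bar> > a} y \<partial>lborel)"
      by (rule nn_integral_indicator[symmetric]) measurable
    thus ?thesis by (simp add: indicator_def of_bool_def)
  qed
  hence "(\<integral>\<^sup>+h. ball_kernel K m p h * emeasure lborel {y. \<bar>G h y\<bar> > a} \<partial>lborel)
    = (\<integral>\<^sup>+h. ball_kernel K m p h * (\<integral>\<^sup>+y. ?\<Psi> h y \<partial>lborel) \<partial>lborel)" by simp
  also have "\<dots> = ennreal ((real CARD('n) + real m * p) * (a powr (- p) / (real m * p))) * top_energy K p G"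
  proof (rule kernel_integral)
    fix y k
    have "(\<integral>\<^sup>+s. indicator {0<..} s * ennreal (s powr (- (real m * p) - 1)) * ?\<Psi> (s *\<^sub>R k) y \<partial>lborel)
      = (\<integral>\<^sup>+s. indicator {0<..} s * ennreal (s powr (- (real m * p) - 1)) * indicator {s. s ^ m * (\<bar>G k y\<bar> / a) > 1} s \<partial>lborel)"
      using a by (intro nn_integral_cong) (auto simp: indicator_def Ghom abs_mult divide_simps)
    also have "\<dots> = ennreal ((\<bar>G k y\<bar> / a) powr (real m * p / real m) / (real m * p))"
      using a q m by (intro nn_integral_superlevel_powr) auto
    also have "(\<bar>G k y\<bar> / a) powr (real m * p / real m) / (real m * p) = a powr (- p) / (real m * p) * (\<bar>G k y\<bar> powr p)"
      using m a by (simp add: powr_divide powr_minus_divide)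
    also have "ennreal \<dots> = ennreal (a powr (- p) / (real m * p)) * ennreal (\<bar>G k y\<bar> powr p)"
      using q by (intro ennreal_mult) auto
    finally show "(\<integral>\<^sup>+s. indicator {0<..} s * ennreal (s powr (- (real m * p) - 1)) * ?\<Psi> (s *\<^sub>R k) y \<partial>lborel) = \<dots>" .
  qed (use q in auto)
  also have "(real CARD('n) + real m * p) * (a powr (- p) / (real m * p)) = (real CARD('n) + real m * p) / (real m * p) * a powr (- p)"
    by simp
  finally show ?thesis .
qed

text \<open>
  Along the ray through \<open>k\<close>, homogeneity leaves \<open>|G k y|\<close> times the integral of \<open>s\<close> to the power
  \<open>- m (p - 1) - 1\<close> over the \<open>s\<close> with \<open>s\<^sup>m |G k y| > a\<close>. The exponent is below \<open>-1\<close> since \<open>p > 1\<close>, and the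
  result is a multiple of \<open>|G k y|\<^sup>p\<close>.
\<close>
lemma kernel_truncated_integral:
  assumes a: "a > 0" and fin: "top_energy K p G < \<infinity>"
  shows "(\<integral>\<^sup>+h. ball_kernel K m p h * (\<integral>\<^sup>+y. ennreal \<bar>truncate_below a (G h) y\<bar> \<partial>lborel) \<partial>lborel) < \<infinity>"
proof -
  define c where "c = a powr (1 - p) / (real m * (p - 1))"
  have q: "real m * (p - 1) > 0" using m p by simp
  let ?\<Psi> = "\<lambda>s k y. indicator {0<..} s * ennreal (s powr (- (real m * p) - 1)) * ennreal \<bar>truncate_below a (G (s *\<^sub>R k)) y\<bar>"
  have "(\<integral>\<^sup>+h. ball_kernel K m p h * (\<integral>\<^sup>+y. ennreal \<bar>truncate_below a (G h) y\<bar> \<partial>lborel) \<partial>lborel)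
    = ennreal ((real CARD('n) + real m * p) * c) * top_energy K p G"
  proof (rule kernel_integral)
    show "(\<lambda>(h, y). ennreal \<bar>truncate_below a (G h) y\<bar>) \<in> borel_measurable (borel \<Otimes>\<^sub>M borel)"
      unfolding truncate_below_def by measurable
    fix y k
    have "(\<integral>\<^sup>+s. ?\<Psi> s k y \<partial>lborel)
      = (\<integral>\<^sup>+s. ennreal \<bar>G k y\<bar> * (indicator {0<..} s * ennreal (s powr (- (real m * (p - 1)) - 1)) * indicator {s. s ^ m * (\<bar>G k y\<bar> / a) > 1} s) \<partial>lborel)"
    proof (rule nn_integral_cong)
      fix s :: real
      show "?\<Psi> s k y
        = ennreal \<bar>G k y\<bar> * (indicator {0<..} s * ennreal (s powr (- (real m * (p - 1)) - 1)) * indicator {s. s ^ m * (\<bar>G k y\<bar> / a) > 1} s)"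
      proof (cases "s > 0 \<and> s ^ m * \<bar>G k y\<bar> > a")
        case True
        hence "s powr (- (real m * p) - 1) * (s ^ m * \<bar>G k y\<bar>) = \<bar>G k y\<bar> * s powr (- (real m * (p - 1)) - 1)"
          by (simp add: powr_realpow[symmetric] powr_add[symmetric] algebra_simps)
        thus ?thesis using True a
          by (simp add: truncate_below_def Ghom abs_mult ennreal_mult[symmetric] indicator_def divide_simps)
      next
        case False
        thus ?thesis using a by (auto simp: truncate_below_def Ghom abs_mult indicator_def divide_simps)
      qed
    qed
    also have "\<dots> = ennreal \<bar>G k y\<bar> * ennreal ((\<bar>G k y\<bar> / a) powr (real m * (p - 1) / real m) / (real m * (p - 1)))"
      using a q m by (subst nn_integral_cmult, measurable, subst nn_integral_superlevel_powr) auto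
    also have "\<dots> = ennreal (\<bar>G k y\<bar> * ((\<bar>G k y\<bar> / a) powr (real m * (p - 1) / real m) / (real m * (p - 1))))"
      using q by (intro ennreal_mult[symmetric]) auto
    also have "\<bar>G k y\<bar> * ((\<bar>G k y\<bar> / a) powr (real m * (p - 1) / real m) / (real m * (p - 1))) = c * \<bar>G k y\<bar> powr p"
    proof (cases "G k y = 0")
      case False
      have "\<bar>G k y\<bar> * \<bar>G k y\<bar> powr (p - 1) = \<bar>G k y\<bar> powr p"
        using False by (simp add: powr_mult_base)
      moreover have "a powr (1 - p) = 1 / a powr (p - 1)" using powr_minus_divide[of a "p - 1"] by simp
      ultimately show ?thesis using m a by (simp add: c_def powr_divide)
    qed simp
    also have "ennreal (c * \<bar>G k y\<bar> powr p) = ennreal c * ennreal (\<bar>G k y\<bar> powr p)"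
      unfolding c_def using q by (intro ennreal_mult) auto
    finally show "(\<integral>\<^sup>+s. ?\<Psi> s k y \<partial>lborel) = \<dots>" .
  qed (use q in \<open>auto simp: c_def\<close>)
  thus ?thesis using fin by (simp add: ennreal_mult_less_top)
qed

text \<open>
  By homogeneity the level sets at heights \<open>(1 \<plusminus> \<theta>) / W\<close> contribute \<open>(1 \<plusminus> \<theta>)\<^sup>-\<^sup>p\<close> times the limit. For fixed
  \<open>\<theta>\<close> the error term of the sandwich disappears as \<open>n\<close> tends to infinity, and then \<open>\<theta>\<close> can be sent to \<open>0\<close>.
\<close>
lemma kernel_segment_mean_level_tendsto:
  assumes wm [measurable]: "w \<in> borel_measurable borel"
    and w: "\<And>t. 0 \<le> t \<Longrightarrow> t \<le> 1 \<Longrightarrow> \<bar>w t\<bar> \<le> 1"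
    and W: "(\<integral>t. indicator {0..1} t * w t \<partial>lborel) = W" "W > 0"
    and fin: "top_energy K p G < \<infinity>" and X: "X \<longlonglongrightarrow> (0 :: real)"
  shows "(\<lambda>n. \<integral>\<^sup>+h. ball_kernel K m p h * emeasure lborel {y. \<bar>segment_mean w (X n *\<^sub>R h) (G h) y\<bar> > 1} \<partial>lborel)
    \<longlonglongrightarrow> ennreal ((real CARD('n) + real m * p) / (real m * p) * W powr p) * top_energy K p G" (is "?A \<longlonglongrightarrow> ?L")
proof -
  define C where "C = (real CARD('n) + real m * p) / (real m * p) * W powr p"
  have q: "real m * p > 0" using m p by simp
  have C: "C \<ge> 0" using q by (simp add: C_def)
  let ?osc = "\<lambda>\<theta> n h. (\<integral>\<^sup>+y. segment_osc (truncate_below (\<theta> / 4) (G h)) (X n *\<^sub>R h) y \<partial>lborel)"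
  define E where "E \<theta> n = (\<integral>\<^sup>+h. ball_kernel K m p h * ?osc \<theta> n h \<partial>lborel)" for \<theta> n
  have E0: "(\<lambda>n. ennreal (2 / \<theta>) * E \<theta> n) \<longlonglongrightarrow> 0" if "\<theta> > 0" for \<theta>
  proof -
    have "E \<theta> \<longlonglongrightarrow> 0" unfolding E_def
    proof (rule weighted_segment_osc_tendsto_0[OF _ _ _ _ X])
      show "(\<lambda>(h, y). truncate_below (\<theta> / 4) (G h) y) \<in> borel_measurable (borel \<Otimes>\<^sub>M borel)"
        unfolding truncate_below_def by measurable
      show "ball_kernel K m p h < \<infinity>" for h by (simp add: ball_kernel_def)
      show "(\<integral>\<^sup>+h. ball_kernel K m p h * (\<integral>\<^sup>+y. ennreal \<bar>truncate_below (\<theta> / 4) (G h) y\<bar> \<partial>lborel) \<partial>lborel) < \<infinity>"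
        using that by (intro kernel_truncated_integral fin) auto
    qed measurable
    from ennreal_tendsto_cmult[OF _ this, of "ennreal (2 / \<theta>)"] show ?thesis by simp
  qed
  have lev: "(\<integral>\<^sup>+h. ball_kernel K m p h * emeasure lborel {y. \<bar>G h y\<bar> > b / W} \<partial>lborel) = ennreal (b powr (- p) * C) * top_energy K p G"
    if "b > 0" for b
    using that W(2) by (subst kernel_level_integral) (auto simp: C_def powr_divide powr_minus_divide divide_simps mult_ac)
  have segm: "(\<lambda>h. ball_kernel K m p h * emeasure lborel {y. \<bar>segment_mean w (X n *\<^sub>R h) (G h) y\<bar> > 1}) \<in> borel_measurable borel" for n
  proof -
    have e: "{y. \<bar>segment_mean w (X n *\<^sub>R h) (G h) y\<bar> > 1} = Pair h -` {z \<in> space (borel \<Otimes>\<^sub>M lborel). \<bar>segment_mean w (X n *\<^sub>R fst z) (G (fst z)) (snd z)\<bar> > 1}" for h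
      by (auto simp: space_pair_measure)
    have Q: "{z \<in> space (borel \<Otimes>\<^sub>M lborel). \<bar>segment_mean w (X n *\<^sub>R fst z) (G (fst z)) (snd z)\<bar> > 1} \<in> sets (borel \<Otimes>\<^sub>M lborel)"
      unfolding segment_mean_def by measurable
    show ?thesis unfolding e
      by (rule borel_measurable_times_ennreal[OF borel_measurable_kernel lborel.measurable_emeasure_Pair[OF Q]])
  qed
  have levm: "(\<lambda>h. ball_kernel K m p h * emeasure lborel {y. \<bar>G h y\<bar> > a}) \<in> borel_measurable borel" for a
  proof -
    have e: "{y. \<bar>G h y\<bar> > a} = Pair h -` {z \<in> space (borel \<Otimes>\<^sub>M lborel). \<bar>G (fst z) (snd z)\<bar> > a}" for h
      by (auto simp: space_pair_measure)
    have Q: "{z \<in> space (borel \<Otimes>\<^sub>M lborel). \<bar>G (fst z) (snd z)\<bar> > a} \<in> sets (borel \<Otimes>\<^sub>M lborel)" by measurable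
    show ?thesis unfolding e
      by (rule borel_measurable_times_ennreal[OF borel_measurable_kernel lborel.measurable_emeasure_Pair[OF Q]])
  qed
  have oscm: "(\<lambda>h. ball_kernel K m p h * (\<integral>\<^sup>+y. segment_osc (truncate_below c (G h)) (X n *\<^sub>R h) y \<partial>lborel)) \<in> borel_measurable borel" for c n
    unfolding segment_osc_def truncate_below_def by measurable
  \<comment> \<open>Integrates either half of the sandwich against the kernel.\<close>
  have combine: "(\<integral>\<^sup>+h. ball_kernel K m p h * a h \<partial>lborel) \<le> (\<integral>\<^sup>+h. ball_kernel K m p h * b h \<partial>lborel) + ennreal (2 / \<theta>) * E \<theta> n"
    if "\<And>h. a h \<le> b h + ennreal (2 / \<theta>) * ?osc \<theta> n h"
      and [measurable]: "(\<lambda>h. ball_kernel K m p h * b h) \<in> borel_measurable borel" for a b \<theta> n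
  proof -
    let ?o = "\<lambda>h. ball_kernel K m p h * ?osc \<theta> n h"
    note oscm[measurable]
    have "(\<integral>\<^sup>+h. ball_kernel K m p h * a h \<partial>lborel) \<le> (\<integral>\<^sup>+h. ball_kernel K m p h * b h + ennreal (2 / \<theta>) * ?o h \<partial>lborel)"
    proof (rule nn_integral_mono)
      fix h
      have "ball_kernel K m p h * a h \<le> ball_kernel K m p h * (b h + ennreal (2 / \<theta>) * ?osc \<theta> n h)"
        by (rule mult_left_mono[OF that(1)]) simp
      thus "ball_kernel K m p h * a h \<le> ball_kernel K m p h * b h + ennreal (2 / \<theta>) * ?o h" by (simp add: distrib_left mult.left_commute)
    qed
    also have "\<dots> = (\<integral>\<^sup>+h. ball_kernel K m p h * b h \<partial>lborel) + ennreal (2 / \<theta>) * E \<theta> n"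
      unfolding E_def by (subst nn_integral_add) (simp_all add: nn_integral_cmult)
    finally show ?thesis .
  qed
  have Gh: "G h \<in> borel_measurable borel" for h by measurable
  have up: "?A n \<le> ennreal ((1 - \<theta>) powr (- p) * C) * top_energy K p G + ennreal (2 / \<theta>) * E \<theta> n"
    if "0 < \<theta>" "\<theta> < 1" for \<theta> n
    using combine[OF segment_mean_level_sandwich(1)[OF Gh wm w W that(1)] levm] lev[of "1 - \<theta>"] that by simp
  have low: "ennreal ((1 + \<theta>) powr (- p) * C) * top_energy K p G \<le> ?A n + ennreal (2 / \<theta>) * E \<theta> n"
    if "0 < \<theta>" for \<theta> n
    using combine[OF segment_mean_level_sandwich(2)[OF Gh wm w W that(1)] segm] lev[of "1 + \<theta>"] that by simp
  have L: "?L = ennreal C * top_energy K p G" by (simp add: C_def)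
  have cont: "((\<lambda>\<theta>. ennreal ((1 + \<sigma> * \<theta>) powr (- p) * C) * top_energy K p G) \<longlongrightarrow> ?L) (at_right 0)" for \<sigma> :: real
  proof -
    have "((\<lambda>\<theta>. (1 + \<sigma> * \<theta>) powr (- p) * C) \<longlongrightarrow> (1 + \<sigma> * 0) powr (- p) * C) (at_right 0)"
      by (intro tendsto_intros) auto
    hence "((\<lambda>\<theta>. ennreal ((1 + \<sigma> * \<theta>) powr (- p) * C)) \<longlongrightarrow> ennreal C) (at_right 0)"
      by (intro tendsto_ennrealI) simp
    from ennreal_tendsto_cmult[OF fin[unfolded infinity_ennreal_def] this] show ?thesis
      unfolding L by (simp add: mult.commute)
  qed
  show ?thesis
  proof (rule order_tendstoI)
    fix a assume a: "?L < a"
    have "\<forall>\<^sub>F \<theta> in at_right 0. ennreal ((1 + (- 1) * \<theta>) powr (- p) * C) * top_energy K p G < a \<and> \<theta> < 1 \<and> 0 < \<theta>"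
      by (intro eventually_conj order_tendstoD(2)[OF cont a] eventually_at_right_less)
        (auto intro: eventually_at_rightI[of 0 1])
    then obtain \<theta> where \<theta>: "ennreal ((1 - \<theta>) powr (- p) * C) * top_energy K p G < a" "\<theta> < 1" "0 < \<theta>"
      using eventually_happens'[OF trivial_limit_at_right_real] by fastforce
    have "(\<lambda>n. ennreal ((1 - \<theta>) powr (- p) * C) * top_energy K p G + ennreal (2 / \<theta>) * E \<theta> n)
      \<longlonglongrightarrow> ennreal ((1 - \<theta>) powr (- p) * C) * top_energy K p G + 0"
      by (intro tendsto_add tendsto_const E0 \<theta>)
    hence "\<forall>\<^sub>F n in sequentially. ennreal ((1 - \<theta>) powr (- p) * C) * top_energy K p G + ennreal (2 / \<theta>) * E \<theta> n < a"
      using \<theta>(1) by (intro order_tendstoD(2)) auto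
    thus "\<forall>\<^sub>F n in sequentially. ?A n < a"
      by eventually_elim (use up[OF \<theta>(3,2)] in \<open>auto intro: order.strict_trans1\<close>)
  next
    fix a assume a: "a < ?L"
    have "\<forall>\<^sub>F \<theta> in at_right 0. a < ennreal ((1 + 1 * \<theta>) powr (- p) * C) * top_energy K p G \<and> 0 < \<theta>"
      by (intro eventually_conj order_tendstoD(1)[OF cont a] eventually_at_right_less)
    then obtain \<theta> where \<theta>: "a < ennreal ((1 + \<theta>) powr (- p) * C) * top_energy K p G" "0 < \<theta>"
      using eventually_happens'[OF trivial_limit_at_right_real] by fastforce
    have "(\<lambda>n. a + ennreal (2 / \<theta>) * E \<theta> n) \<longlonglongrightarrow> a + 0"
      by (intro tendsto_add tendsto_const E0 \<theta>)
    hence "\<forall>\<^sub>F n in sequentially. a + ennreal (2 / \<theta>) * E \<theta> n < ennreal ((1 + \<theta>) powr (- p) * C) * top_energy K p G"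
      using \<theta>(1) by (intro order_tendstoD(2)) auto
    thus "\<forall>\<^sub>F n in sequentially. a < ?A n"
    proof eventually_elim
      case (elim n)
      show ?case
      proof (rule ccontr)
        assume "\<not> a < ?A n"
        hence "?A n + ennreal (2 / \<theta>) * E \<theta> n \<le> a + ennreal (2 / \<theta>) * E \<theta> n" by (intro add_right_mono) simp
        from order.strict_trans2[OF elim order.trans[OF low[OF \<theta>(2), of n] this]]
        show False by (rule less_irrefl[THEN notE])
      qed
    qed
  qed
qed

end

section \<open>Index tuples and multi-indices\<close>

lemma prod_list_eq_mi_power: "(\<Prod>i\<leftarrow>is. h $ i) = mi_power h (count_list is)"
proof (induction "is")
  case (Cons x "is")
  have "mi_power h (count_list (x # is)) = (\<Prod>i\<in>UNIV. (if x = i then h $ i else 1) * (h $ i) ^ count_list is i)"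
    unfolding mi_power_def by (intro prod.cong) auto
  also have "\<dots> = h $ x * mi_power h (count_list is)"
    by (simp add: prod.distrib mi_power_def)
  finally show ?case using Cons by (simp del: count_list.simps)
qed (simp add: mi_power_def)

text \<open>
  The lists with given multiplicities are the permutations of a multiset, so their number is the
  multinomial coefficient. This converts the Taylor polynomial, a sum over multi-indices, into a sum
  of directional forms, which are sums over lists.
\<close>
lemma card_lists_count_list:
  fixes \<alpha> :: "('n::finite) multi_index"
  shows "real (card {is. count_list is = \<alpha>}) = fact (mi_order \<alpha>) / mi_fact \<alpha>"
proof -
  obtain js where js: "count_list js = \<alpha>" using ex_list_of_multi_index by blast
  have eq: "{is. count_list is = \<alpha>} = permutations_of_multiset (mset js)"
    unfolding permutations_of_multiset_def js[symmetric] count_list_eq_mset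
    by (auto simp: count_inject)
  have "(\<Prod>x\<in>set_mset (mset js). fact (count (mset js) x)) = (\<Prod>x\<in>(UNIV :: 'n set). fact (\<alpha> x) :: nat)"
    unfolding js[symmetric] count_list_eq_mset
  proof (intro prod.mono_neutral_left ballI)
    fix i assume "i \<in> UNIV - set_mset (mset js)"
    hence "count (mset js) i = 0" by (simp add: count_eq_zero_iff)
    thus "fact (count (mset js) i) = (1 :: nat)" by (simp only: fact_0)
  qed auto
  hence "card {is. count_list is = \<alpha>} * (\<Prod>x\<in>(UNIV :: 'n set). fact (\<alpha> x)) = (fact (mi_order \<alpha>) :: nat)"
    using card_permutations_of_multiset_aux[of "mset js"] unfolding eq unfolding js[symmetric] mi_order_count_list by simp
  hence "real (card {is. count_list is = \<alpha>}) * mi_fact \<alpha> = fact (mi_order \<alpha>)"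
    unfolding mi_fact_def by (auto dest!: arg_cong[of _ _ real])
  moreover have "mi_fact \<alpha> > 0" unfolding mi_fact_def by (intro prod_pos) auto
  ultimately show ?thesis by (simp add: field_simps)
qed

lemma directional_form_eq_sum_multi_indices:
  fixes c :: "('n::finite) multi_index \<Rightarrow> real"
  shows "directional_form j c h / fact j = (\<Sum>\<alpha> | mi_order \<alpha> = j. c \<alpha> * (mi_power h \<alpha> / mi_fact \<alpha>))"
proof -
  have fin: "finite {\<alpha> :: 'n multi_index. mi_order \<alpha> = j}"
    by (rule finite_subset[OF _ finite_mi_order_le[of j]]) auto
  have "directional_form j c h = (\<Sum>\<alpha> | mi_order \<alpha> = j. \<Sum>is | is \<in> {is. length is = j} \<and> count_list is = \<alpha>. (\<Prod>i\<leftarrow>is. h $ i) * c (count_list is))"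
    unfolding directional_form_def
    by (rule sum.group[OF finite_lists_length fin, symmetric]) (auto simp: mi_order_count_list)
  also have "\<dots> = (\<Sum>\<alpha> | mi_order \<alpha> = j. fact j * (c \<alpha> * (mi_power h \<alpha> / mi_fact \<alpha>)))"
  proof (intro sum.cong refl)
    fix \<alpha> :: "'n multi_index" assume \<alpha>: "\<alpha> \<in> {\<alpha>. mi_order \<alpha> = j}"
    have "{is. is \<in> {is. length is = j} \<and> count_list is = \<alpha>} = {is. count_list is = \<alpha>}"
      using \<alpha> by (auto simp: mi_order_count_list)
    hence "(\<Sum>is | is \<in> {is. length is = j} \<and> count_list is = \<alpha>. (\<Prod>i\<leftarrow>is. h $ i) * c (count_list is))
      = (\<Sum>is | count_list is = \<alpha>. mi_power h \<alpha> * c \<alpha>)"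
      by (intro sum.cong) (auto simp: prod_list_eq_mi_power)
    also have "\<dots> = fact j * (c \<alpha> * (mi_power h \<alpha> / mi_fact \<alpha>))"
      using \<alpha> by (simp add: card_lists_count_list)
    finally show "(\<Sum>is | is \<in> {is. length is = j} \<and> count_list is = \<alpha>. (\<Prod>i\<leftarrow>is. h $ i) * c (count_list is))
      = fact j * (c \<alpha> * (mi_power h \<alpha> / mi_fact \<alpha>))" .
  qed
  finally have e: "directional_form j c h = \<dots>" .
  show ?thesis unfolding e sum_distrib_left[symmetric] by simp
qed

lemma taylor_remainder_eq_directional_forms:
  fixes f :: "real ^ ('n::finite) \<Rightarrow> real"
  assumes "m \<ge> 1"
  shows "taylor_remainder (m - 1) f x y = f x - (\<Sum>j<m. directional_form j (\<lambda>\<alpha>. weak_deriv \<alpha> f y) (x - y) / fact j)"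
proof -
  have "(\<Sum>j<m. \<Sum>\<alpha> | \<alpha> \<in> {\<alpha>. mi_order \<alpha> \<le> m - 1} \<and> mi_order \<alpha> = j. weak_deriv \<alpha> f y * (mi_power (x - y) \<alpha> / mi_fact \<alpha>))
    = taylor_poly (m - 1) f y x"
    unfolding taylor_poly_def using assms by (intro sum.group finite_mi_order_le) auto
  moreover have "{\<alpha>. \<alpha> \<in> {\<alpha>. mi_order \<alpha> \<le> m - 1} \<and> mi_order \<alpha> = j} = {\<alpha> :: 'n multi_index. mi_order \<alpha> = j}" if "j < m" for j
    using that by auto
  ultimately show ?thesis
    unfolding taylor_remainder_def directional_form_eq_sum_multi_indices by simp
qed

lemma deriv_form_eq_directional_form: "deriv_form m f x h = directional_form m (\<lambda>\<alpha>. weak_deriv \<alpha> f x) h"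
  by (simp add: deriv_form_def directional_form_def)

section \<open>Borel versions of weak derivatives\<close>

lemma lebesgue_borel_version:
  fixes u :: "'a::euclidean_space \<Rightarrow> real"
  assumes "u \<in> borel_measurable lebesgue"
  obtains v where "v \<in> borel_measurable borel" "AE x in lborel. u x = v x"
  using completion_ex_borel_measurable_real[OF assms] by auto

lemma locally_integrable_measurable:
  fixes f :: "real ^ ('n::finite) \<Rightarrow> real"
  assumes "locally_integrable f"
  shows "f \<in> borel_measurable lebesgue"
proof (rule borel_measurable_LIMSEQ_real)
  show "(\<lambda>x. indicator (cball 0 (real n)) x *\<^sub>R f x) \<in> borel_measurable lebesgue" for n
    using assms unfolding locally_integrable_def set_integrable_def by (intro borel_measurable_integrable) auto
  fix x :: "real ^ 'n"
  obtain n0 where n0: "norm x \<le> real n0" using real_arch_simple by blast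
  have "\<forall>\<^sub>F n in sequentially. indicator (cball 0 (real n)) x *\<^sub>R f x = f x"
    using eventually_ge_at_top[of n0] by eventually_elim (use n0 in auto)
  thus "(\<lambda>n. indicator (cball 0 (real n)) x *\<^sub>R f x) \<longlonglongrightarrow> f x" by (rule tendsto_eventually)
qed

lemma locally_integrable_cong_AE:
  assumes "locally_integrable f" and [measurable]: "g \<in> borel_measurable borel" and ae: "AE x in lborel. f x = g x"
  shows "locally_integrable g"
  unfolding locally_integrable_lborel_iff[OF assms(2)]
proof (intro allI impI)
  fix C :: "(real ^ 'a) set" assume C: "compact C"
  hence [measurable]: "C \<in> sets borel" by (rule borel_compact)
  have "integrable lebesgue (\<lambda>x. indicator C x * f x)"
    using assms(1) C by (simp add: locally_integrable_def set_integrable_def)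
  moreover have "AE x in lebesgue. indicator C x * f x = indicator C x * g x"
    using ae by (intro AE_completion) auto
  ultimately have "integrable lebesgue (\<lambda>x. indicator C x * g x)"
    by (subst integrable_cong_AE[symmetric]) (auto dest: borel_measurable_integrable intro!: measurable_completion)
  thus "integrable lborel (\<lambda>x. indicator C x * g x)"
    by (subst (asm) integrable_completion) auto
qed

lemma lebesgue_integral_mult_cong_AE:
  fixes f g \<phi> :: "'a::euclidean_space \<Rightarrow> real"
  assumes [measurable]: "f \<in> borel_measurable lebesgue" "g \<in> borel_measurable borel" "\<phi> \<in> borel_measurable borel"
    and ae: "AE x in lborel. f x = g x"
  shows "(LINT x|lebesgue. f x * \<phi> x) = (\<integral>x. g x * \<phi> x \<partial>lborel)"
proof -
  have [measurable]: "g \<in> borel_measurable lebesgue" "\<phi> \<in> borel_measurable lebesgue"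
    by (auto intro!: measurable_completion)
  have "(LINT x|lebesgue. f x * \<phi> x) = (LINT x|lebesgue. g x * \<phi> x)"
    using AE_completion[OF ae] by (intro integral_cong_AE) auto
  also have "\<dots> = (\<integral>x. g x * \<phi> x \<partial>lborel)" by (rule integral_completion) measurable
  finally show ?thesis .
qed

lemma has_weak_deriv_borel_version:
  fixes f :: "real ^ ('n::finite) \<Rightarrow> real"
  assumes w: "has_weak_deriv f \<alpha> g" and \<phi>: "test_function \<phi>"
    and f': "f' \<in> borel_measurable borel" "AE x in lborel. f x = f' x"
    and g': "g' \<in> borel_measurable borel" "AE x in lborel. g x = g' x"
  shows "(\<integral>x. f' x * mi_deriv \<alpha> \<phi> x \<partial>lborel) = (-1) ^ mi_order \<alpha> * (\<integral>x. g' x * \<phi> x \<partial>lborel)"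
proof -
  have m: "\<phi> \<in> borel_measurable borel" "mi_deriv \<alpha> \<phi> \<in> borel_measurable borel"
    using \<phi> test_function_mi_deriv[OF \<phi>] by (auto intro!: borel_measurable_continuous_onI test_function_continuous)
  have l: "f \<in> borel_measurable lebesgue" "g \<in> borel_measurable lebesgue"
    using w by (auto simp: has_weak_deriv_def intro: locally_integrable_measurable)
  have "(LINT x|lebesgue. f x * mi_deriv \<alpha> \<phi> x) = (-1) ^ mi_order \<alpha> * (LINT x|lebesgue. g x * \<phi> x)"
    using w \<phi> by (auto simp: has_weak_deriv_def)
  thus ?thesis
    unfolding lebesgue_integral_mult_cong_AE[OF l(1) f'(1) m(2) f'(2)]
      lebesgue_integral_mult_cong_AE[OF l(2) g'(1) m(1) g'(2)] .
qed

lemma has_weak_deriv_unique: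
  fixes f :: "real ^ ('n::finite) \<Rightarrow> real"
  assumes w: "has_weak_deriv f \<alpha> g" "has_weak_deriv f \<alpha> h"
  shows "AE x in lborel. g x = h x"
proof -
  have loc: "locally_integrable f" "locally_integrable g" "locally_integrable h"
    using w by (auto simp: has_weak_deriv_def)
  obtain f' where f': "f' \<in> borel_measurable borel" "AE x in lborel. f x = f' x"
    using lebesgue_borel_version[OF locally_integrable_measurable[OF loc(1)]] .
  obtain g' where g': "g' \<in> borel_measurable borel" "AE x in lborel. g x = g' x"
    using lebesgue_borel_version[OF locally_integrable_measurable[OF loc(2)]] .
  obtain h' where h': "h' \<in> borel_measurable borel" "AE x in lborel. h x = h' x"
    using lebesgue_borel_version[OF locally_integrable_measurable[OF loc(3)]] .
  have lg: "locally_integrable g'" and lh: "locally_integrable h'"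
    using loc g' h' locally_integrable_cong_AE by blast+
  have "AE x in lborel. g' x - h' x = 0"
  proof (rule AE_eq_0_if_orthogonal_to_test_functions)
    show m: "(\<lambda>x. g' x - h' x) \<in> borel_measurable borel" using g'(1) h'(1) by measurable
    show "locally_integrable (\<lambda>x. g' x - h' x)"
      using lg lh unfolding locally_integrable_lborel_iff[OF m] locally_integrable_lborel_iff[OF g'(1)] locally_integrable_lborel_iff[OF h'(1)]
      by (auto simp: right_diff_distrib)
    fix \<phi> :: "real ^ 'n \<Rightarrow> real" assume \<phi>: "test_function \<phi>"
    have "(-1) ^ mi_order \<alpha> * (\<integral>x. g' x * \<phi> x \<partial>lborel) = (-1) ^ mi_order \<alpha> * (\<integral>x. h' x * \<phi> x \<partial>lborel)"
      using has_weak_deriv_borel_version[OF w(1) \<phi> f' g'] has_weak_deriv_borel_version[OF w(2) \<phi> f' h'] by simp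
    hence "(\<integral>x. g' x * \<phi> x \<partial>lborel) = (\<integral>x. h' x * \<phi> x \<partial>lborel)" by simp
    thus "(\<integral>x. (g' x - h' x) * \<phi> x \<partial>lborel) = 0"
      using integrable_test_function[OF g'(1) lg \<phi>] integrable_test_function[OF h'(1) lh \<phi>]
      by (simp add: left_diff_distrib)
  qed
  with g'(2) h'(2) show ?thesis by eventually_elim simp
qed

text \<open>
  The representative chosen by \<^const>\<open>weak_deriv\<close> agrees almost everywhere with the one that the definition
  of the Sobolev space provides, and thereby inherits its integrability.
\<close>
lemma sobolev_space_weak_deriv:
  fixes f :: "real ^ ('n::finite) \<Rightarrow> real"
  assumes f: "f \<in> sobolev_space m p" and \<alpha>: "mi_order \<alpha> \<le> m"
  obtains g where "g \<in> borel_measurable borel" "AE x in lborel. weak_deriv \<alpha> f x = g x"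
    "locally_integrable g" "integrable lborel (\<lambda>x. \<bar>g x\<bar> powr p)" "has_weak_deriv f \<alpha> (weak_deriv \<alpha> f)"
proof -
  obtain v where v: "v \<in> Lp_space p" "has_weak_deriv f \<alpha> v"
    using f \<alpha> by (auto simp: sobolev_space_def)
  have w: "has_weak_deriv f \<alpha> (weak_deriv \<alpha> f)" unfolding weak_deriv_def by (rule someI[of _ v]) (rule v)
  have vw: "AE x in lborel. weak_deriv \<alpha> f x = v x" by (rule has_weak_deriv_unique[OF w v(2)])
  have loc: "locally_integrable (weak_deriv \<alpha> f)" using w by (auto simp: has_weak_deriv_def)
  obtain g where g [measurable]: "g \<in> borel_measurable borel" and ae: "AE x in lborel. weak_deriv \<alpha> f x = g x"
    using lebesgue_borel_version[OF locally_integrable_measurable[OF loc]] .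
  have vi: "integrable lebesgue (\<lambda>x. \<bar>v x\<bar> powr p)" using v(1) by (auto simp: Lp_space_def)
  have "AE x in lborel. \<bar>v x\<bar> powr p = \<bar>g x\<bar> powr p" using vw ae by eventually_elim simp
  hence "AE x in lebesgue. \<bar>v x\<bar> powr p = \<bar>g x\<bar> powr p" by (rule AE_completion)
  hence "integrable lebesgue (\<lambda>x. \<bar>g x\<bar> powr p)"
    using vi by (subst integrable_cong_AE[symmetric]) (auto dest: borel_measurable_integrable intro!: measurable_completion)
  hence "integrable lborel (\<lambda>x. \<bar>g x\<bar> powr p)" by (subst (asm) integrable_completion) auto
  thus ?thesis using that[OF g ae locally_integrable_cong_AE[OF loc g ae]] w by blast
qed

section \<open>The rescaled double integral\<close>

lemma norm_of_ball_scale: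
  fixes K :: "(real ^ ('n::finite)) set"
  assumes K: "bounded K" "convex K" "0 \<in> interior K" and s: "s > 0"
  shows "norm_of_ball K (s *\<^sub>R x) = s * norm_of_ball K x"
proof -
  have iff: "norm_of_ball K (s *\<^sub>R x) < t \<longleftrightarrow> s * norm_of_ball K x < t" if "t > 0" for t
  proof -
    have "norm_of_ball K (s *\<^sub>R x) < t \<longleftrightarrow> x /\<^sub>R (t / s) \<in> interior K"
      using norm_of_ball_less_iff[OF K that, of "s *\<^sub>R x"] s by (simp add: divide_inverse mult.commute)
    also have "\<dots> \<longleftrightarrow> norm_of_ball K x < t / s"
      using norm_of_ball_less_iff[OF K, of "t / s" x] s that by simp
    also have "\<dots> \<longleftrightarrow> s * norm_of_ball K x < t" using s by (simp add: field_simps)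
    finally show ?thesis .
  qed
  have "norm_of_ball K (s *\<^sub>R x) \<ge> 0" "s * norm_of_ball K x \<ge> 0"
    using norm_of_ball_nonneg[OF K] s by auto
  with iff[of "norm_of_ball K (s *\<^sub>R x)"] iff[of "s * norm_of_ball K x"] show ?thesis by linarith
qed

text \<open>
  With \<open>\<epsilon>\<^sup>m = \<delta>\<close>, the Jacobian \<open>\<epsilon>\<^sup>N\<close>, the factor \<open>\<delta>\<^sup>p = \<epsilon>\<^sup>m\<^sup>p\<close> and the homogeneity of the kernel cancel.
\<close>
lemma nn_integral_ball_kernel_rescale:
  fixes K :: "(real ^ ('n::finite)) set" and R :: "real ^ 'n \<Rightarrow> real ^ 'n \<Rightarrow> real"
  assumes K: "bounded K" "convex K" "0 \<in> interior K" and m: "m \<ge> 1" and \<delta>: "\<delta> > 0"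
    and R: "(\<lambda>(x, y). R x y) \<in> borel_measurable (borel \<Otimes>\<^sub>M borel)"
  shows "(\<integral>\<^sup>+z. ennreal (\<delta> powr p / norm_of_ball K (fst z - snd z) powr (real CARD('n) + real m * p))
        * indicator {(x, y). \<bar>R x y\<bar> > \<delta>} z \<partial>lborel)
    = (\<integral>\<^sup>+h. ball_kernel K m p h * emeasure lborel {y. \<bar>R (y + (\<delta> powr (1 / m)) *\<^sub>R h) y\<bar> > \<delta>} \<partial>lborel)"
proof -
  let ?r = "real CARD('n) + real m * p" and ?N = "norm_of_ball K"
  define \<epsilon> where "\<epsilon> = \<delta> powr (1 / m)"
  have \<epsilon>: "\<epsilon> > 0" using \<delta> by (simp add: \<epsilon>_def)
  have scale: "\<epsilon> ^ CARD('n) * (\<delta> powr p / ?N (\<epsilon> *\<^sub>R h) powr ?r) = 1 / ?N h powr ?r" for h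
  proof -
    have "\<epsilon> powr (real m * p) = \<delta> powr p" using m by (simp add: \<epsilon>_def powr_powr)
    hence "\<epsilon> powr ?r = \<epsilon> ^ CARD('n) * \<delta> powr p" using \<epsilon> by (simp add: powr_add powr_realpow)
    thus ?thesis
      using \<epsilon> \<delta> norm_of_ball_nonneg[OF K, of h] by (simp add: norm_of_ball_scale[OF K] powr_mult)
  qed
  note [measurable] = borel_measurable_norm_of_ball[OF K]
  have Rm [measurable (raw)]: "(\<lambda>x. R (f x) (g x)) \<in> borel_measurable M"
    if "f \<in> M \<rightarrow>\<^sub>M borel" "g \<in> M \<rightarrow>\<^sub>M borel" for f g :: "'c \<Rightarrow> real ^ 'n" and M
    using measurable_compose[OF measurable_Pair[OF that] R] by simp
  let ?I = "\<lambda>x y. if \<bar>R x y\<bar> > \<delta> then 1 else 0 :: ennreal"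
  let ?c = "\<lambda>h. ennreal (\<delta> powr p / ?N h powr ?r)"
  have "(\<integral>\<^sup>+z. ?c (fst z - snd z) * indicator {(x, y). \<bar>R x y\<bar> > \<delta>} z \<partial>lborel)
    = (\<integral>\<^sup>+z. ?c (fst z - snd z) * ?I (fst z) (snd z) \<partial>(lborel \<Otimes>\<^sub>M lborel))"
    unfolding lborel_prod by (intro nn_integral_cong) (auto simp: indicator_def case_prod_beta)
  also have "\<dots> = (\<integral>\<^sup>+y. \<integral>\<^sup>+x. ?c (x - y) * ?I x y \<partial>lborel \<partial>lborel)"
    by (subst lborel_pair.nn_integral_snd[symmetric]) simp_all
  also have "\<dots> = (\<integral>\<^sup>+y. \<integral>\<^sup>+h. ?c h * ?I (h + y) y \<partial>lborel \<partial>lborel)"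
  proof (rule nn_integral_cong)
    fix y
    show "(\<integral>\<^sup>+x. ?c (x - y) * ?I x y \<partial>lborel) = (\<integral>\<^sup>+h. ?c h * ?I (h + y) y \<partial>lborel)"
      by (subst nn_integral_lborel_translate[of _ y, symmetric]) simp_all
  qed
  also have "\<dots> = (\<integral>\<^sup>+h. \<integral>\<^sup>+y. ?c h * ?I (h + y) y \<partial>lborel \<partial>lborel)"
    by (rule lborel_pair.Fubini'[symmetric]) measurable
  also have "\<dots> = ennreal (\<epsilon> ^ DIM(real ^ 'n)) * (\<integral>\<^sup>+h. \<integral>\<^sup>+y. ?c (\<epsilon> *\<^sub>R h) * ?I (\<epsilon> *\<^sub>R h + y) y \<partial>lborel \<partial>lborel)"
    using \<epsilon> by (intro nn_integral_lborel_scale) measurable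
  also have "\<dots> = (\<integral>\<^sup>+h. ennreal (\<epsilon> ^ DIM(real ^ 'n)) * (\<integral>\<^sup>+y. ?c (\<epsilon> *\<^sub>R h) * ?I (\<epsilon> *\<^sub>R h + y) y \<partial>lborel) \<partial>lborel)"
    by (rule nn_integral_cmult[symmetric]) measurable
  also have "\<dots> = (\<integral>\<^sup>+h. ball_kernel K m p h * emeasure lborel {y. \<bar>R (y + \<epsilon> *\<^sub>R h) y\<bar> > \<delta>} \<partial>lborel)"
  proof (rule nn_integral_cong)
    fix h
    have "(\<integral>\<^sup>+y. ?c (\<epsilon> *\<^sub>R h) * ?I (\<epsilon> *\<^sub>R h + y) y \<partial>lborel) = ?c (\<epsilon> *\<^sub>R h) * (\<integral>\<^sup>+y. ?I (\<epsilon> *\<^sub>R h + y) y \<partial>lborel)"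
      by (rule nn_integral_cmult) measurable
    also have "(\<integral>\<^sup>+y. ?I (\<epsilon> *\<^sub>R h + y) y \<partial>lborel) = (\<integral>\<^sup>+y. indicator {y. \<bar>R (y + \<epsilon> *\<^sub>R h) y\<bar> > \<delta>} y \<partial>lborel)"
      by (intro nn_integral_cong) (auto simp: indicator_def add.commute)
    also have "\<dots> = emeasure lborel {y. \<bar>R (y + \<epsilon> *\<^sub>R h) y\<bar> > \<delta>}"
      by (rule nn_integral_indicator) measurable
    finally have e: "(\<integral>\<^sup>+y. ?c (\<epsilon> *\<^sub>R h) * ?I (\<epsilon> *\<^sub>R h + y) y \<partial>lborel)
      = ?c (\<epsilon> *\<^sub>R h) * emeasure lborel {y. \<bar>R (y + \<epsilon> *\<^sub>R h) y\<bar> > \<delta>}" .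
    have "ennreal (\<epsilon> ^ DIM(real ^ 'n)) * ?c (\<epsilon> *\<^sub>R h) = ennreal (\<epsilon> ^ CARD('n) * (\<delta> powr p / ?N (\<epsilon> *\<^sub>R h) powr ?r))"
      using \<epsilon> by (subst ennreal_mult) auto
    also have "\<dots> = ball_kernel K m p h" unfolding ball_kernel_def scale ..
    finally show "ennreal (\<epsilon> ^ DIM(real ^ 'n)) * (\<integral>\<^sup>+y. ?c (\<epsilon> *\<^sub>R h) * ?I (\<epsilon> *\<^sub>R h + y) y \<partial>lborel)
      = ball_kernel K m p h * emeasure lborel {y. \<bar>R (y + \<epsilon> *\<^sub>R h) y\<bar> > \<delta>}"
      unfolding e mult.assoc[symmetric] by (rule arg_cong)
  qed
  finally show ?thesis unfolding \<epsilon>_def .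
qed

lemma AE_lborel_pair_fst:
  assumes "AE x in (lborel :: 'a::euclidean_space measure). P x"
  shows "AE z in (lborel :: ('a \<times> 'b::euclidean_space) measure). P (fst z)"
proof -
  obtain N where N: "{x. \<not> P x} \<subseteq> N" "N \<in> sets borel" "emeasure lborel N = 0"
    using AE_E[OF assms] by (auto simp: null_sets_def)
  have "N \<times> UNIV \<in> null_sets (lborel \<Otimes>\<^sub>M lborel :: ('a \<times> 'b) measure)"
    using N by (intro null_setsI) (auto simp: lborel.emeasure_pair_measure_Times)
  thus ?thesis unfolding lborel_prod by (rule AE_I') (use N in auto)
qed

lemma AE_lborel_pair_snd:
  assumes "AE y in (lborel :: 'b::euclidean_space measure). P y"
  shows "AE z in (lborel :: ('a::euclidean_space \<times> 'b) measure). P (snd z)"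
proof -
  obtain N where N: "{x. \<not> P x} \<subseteq> N" "N \<in> sets borel" "emeasure lborel N = 0"
    using AE_E[OF assms] by (auto simp: null_sets_def)
  have "UNIV \<times> N \<in> null_sets (lborel \<Otimes>\<^sub>M lborel :: ('a \<times> 'b) measure)"
    using N by (intro null_setsI) (auto simp: lborel.emeasure_pair_measure_Times)
  thus ?thesis unfolding lborel_prod by (rule AE_I') (use N in auto)
qed

lemma sum_powr_le:
  fixes a :: "'b \<Rightarrow> real"
  assumes "finite A" "\<And>i. i \<in> A \<Longrightarrow> 0 \<le> a i" "p > 0"
  shows "(\<Sum>i\<in>A. a i) powr p \<le> real (card A) powr p * (\<Sum>i\<in>A. a i powr p)"
proof (cases "A = {}")
  case False
  obtain j where j: "j \<in> A" "\<And>i. i \<in> A \<Longrightarrow> a i \<le> a j"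
    using finite_has_maximal2[of "a ` A"] Max_in[of "a ` A"] Max_ge[of "a ` A"] assms(1) False
    by (metis (no_types, lifting) finite_imageI image_iff image_is_empty)
  have "(\<Sum>i\<in>A. a i) \<le> real (card A) * a j" using j by (intro sum_bounded_above) auto
  hence "(\<Sum>i\<in>A. a i) powr p \<le> (real (card A) * a j) powr p"
    using assms by (intro powr_mono2) (auto intro!: sum_nonneg)
  also have "\<dots> = real (card A) powr p * a j powr p" using assms(2) j by (simp add: powr_mult)
  also have "\<dots> \<le> real (card A) powr p * (\<Sum>i\<in>A. a i powr p)"
    using j assms by (intro mult_left_mono member_le_sum) auto
  finally show ?thesis .
qed simp

text \<open>
  A crude bound whose only purpose is the finiteness of the energy: it separates the direction,
  which stays in a bounded set, from the derivatives, which are in \<open>L\<^sup>p\<close>.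
\<close>
lemma directional_form_powr_bound:
  assumes c: "\<And>i. \<bar>h $ i\<bar> \<le> B" and p: "p > 0"
  shows "\<bar>directional_form m g (h :: real ^ ('n::finite))\<bar> powr p
    \<le> (real (card {is :: 'n list. length is = m}) * B ^ m) powr p * (\<Sum>is | length is = m. \<bar>g (count_list is)\<bar> powr p)"
proof -
  have B: "B \<ge> 0" using c[of undefined] by linarith
  have pr: "\<bar>\<Prod>i\<leftarrow>is. h $ i\<bar> \<le> B ^ length is" for "is"
    using c B by (induction "is") (auto simp: abs_mult intro!: mult_mono)
  have "\<bar>directional_form m g h\<bar> \<le> (\<Sum>is | length is = m. \<bar>(\<Prod>i\<leftarrow>is. h $ i) * g (count_list is)\<bar>)"
    unfolding directional_form_def by (rule sum_abs)
  also have "\<dots> \<le> (\<Sum>is | length is = m. B ^ m * \<bar>g (count_list is)\<bar>)"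
    using pr by (intro sum_mono) (auto simp: abs_mult intro!: mult_right_mono)
  finally have "\<bar>directional_form m g h\<bar> powr p \<le> (\<Sum>is | length is = m. B ^ m * \<bar>g (count_list is)\<bar>) powr p"
    using p by (intro powr_mono2) auto
  also have "\<dots> \<le> real (card {is :: 'n list. length is = m}) powr p * (\<Sum>is | length is = m. (B ^ m * \<bar>g (count_list is)\<bar>) powr p)"
    using B p by (intro sum_powr_le finite_lists_length) auto
  also have "\<dots> = (real (card {is :: 'n list. length is = m}) * B ^ m) powr p * (\<Sum>is | length is = m. \<bar>g (count_list is)\<bar> powr p)"
    using B by (simp add: powr_mult sum_distrib_left[symmetric] mult.assoc)
  finally show ?thesis .
qed

lemma top_energy_finite:
  fixes K :: "(real ^ ('n::finite)) set" and g :: "'n multi_index \<Rightarrow> real ^ 'n \<Rightarrow> real"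
  assumes K: "bounded K" "convex K" "0 \<in> interior K" and p: "p > 1"
    and gm: "\<And>\<alpha>. mi_order \<alpha> = m \<Longrightarrow> g \<alpha> \<in> borel_measurable borel"
    and gi: "\<And>\<alpha>. mi_order \<alpha> = m \<Longrightarrow> integrable lborel (\<lambda>y. \<bar>g \<alpha> y\<bar> powr p)"
  shows "top_energy K p (\<lambda>h y. directional_form m (\<lambda>\<alpha>. g \<alpha> y) h) < \<infinity>"
proof -
  obtain B where B: "\<And>k. k \<in> K \<Longrightarrow> norm k \<le> B" using K(1) bounded_iff by blast
  define C where "C = (real (card {is :: 'n list. length is = m}) * B ^ m) powr p"
  define S where "S y = (\<Sum>is | length is = m. \<bar>g (count_list is) y\<bar> powr p)" for y
  have Si: "integrable lborel S"
    unfolding S_def by (intro Bochner_Integration.integrable_sum gi) (auto simp: mi_order_count_list)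
  have S0: "S y \<ge> 0" for y unfolding S_def by (intro sum_nonneg) auto
  have [measurable]: "S \<in> borel_measurable borel" using borel_measurable_integrable[OF Si] by simp
  have "top_energy K p (\<lambda>h y. directional_form m (\<lambda>\<alpha>. g \<alpha> y) h)
    \<le> (\<integral>\<^sup>+y. \<integral>\<^sup>+k. ennreal (C * S y) * indicator (interior K) k \<partial>lborel \<partial>lborel)"
    unfolding top_energy_def
  proof (intro nn_integral_mono)
    fix y k
    have "\<bar>directional_form m (\<lambda>\<alpha>. g \<alpha> y) k\<bar> powr p \<le> C * S y" if "k \<in> interior K"
    proof -
      have "\<bar>k $ i\<bar> \<le> B" for i
        using B[of k] that interior_subset component_le_norm_cart[of k i] by fastforce
      thus ?thesis unfolding C_def S_def using p by (intro directional_form_powr_bound) auto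
    qed
    thus "indicator (interior K) k * ennreal (\<bar>directional_form m (\<lambda>\<alpha>. g \<alpha> y) k\<bar> powr p) \<le> ennreal (C * S y) * indicator (interior K) k"
      by (auto simp: indicator_def intro: ennreal_leI)
  qed
  also have "\<dots> = (\<integral>\<^sup>+y. ennreal (C * S y) * emeasure lborel (interior K) \<partial>lborel)"
    by (intro nn_integral_cong nn_integral_cmult_indicator) auto
  also have "\<dots> = (\<integral>\<^sup>+y. ennreal (C * S y) \<partial>lborel) * emeasure lborel (interior K)"
    by (rule nn_integral_multc) measurable
  also have "\<dots> < \<infinity>"
  proof -
    have "integrable lborel (\<lambda>y. C * S y)" using Si by simp
    moreover have "norm (C * S y) = C * S y" for y using S0 by (simp add: abs_mult C_def)
    ultimately have "(\<integral>\<^sup>+y. ennreal (C * S y) \<partial>lborel) < \<infinity>"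
      unfolding integrable_iff_bounded by simp
    moreover have "emeasure lborel (interior K) < \<infinity>"
      using bounded_interior[OF K(1)] by (rule emeasure_bounded_finite)
    ultimately show ?thesis by (simp add: ennreal_mult_less_top)
  qed
  finally show ?thesis .
qed

lemma integral_taylor_weight:
  assumes "m \<ge> 1"
  shows "(\<integral>t. indicator {0..1} t * taylor_weight m t \<partial>lborel) = 1 / fact m"
proof -
  have d: "((\<lambda>t. - ((1 - t) ^ m / fact m)) has_vector_derivative taylor_weight m t) (at t within {0..1})" for t :: real
  proof -
    have "((\<lambda>t. - ((1 - t) ^ m / fact m)) has_real_derivative taylor_weight m t) (at t within {0..1})"
    proof (cases m)
      case (Suc k)
      have "((\<lambda>t. - ((1 - t) ^ m / fact m)) has_real_derivative real (Suc k) * (1 - t) ^ k / fact (Suc k)) (at t within {0..1})"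
        unfolding Suc
        by (auto intro!: derivative_eq_intros simp del: fact_Suc)
          (cases k; simp add: field_simps del: fact_Suc)
      thus ?thesis unfolding fact_Suc taylor_weight_def Suc by (simp del: of_nat_Suc)
    qed (use assms in simp)
    thus ?thesis by (simp add: has_real_derivative_iff_has_vector_derivative)
  qed
  have hi: "(taylor_weight m has_integral (- ((1 - 1) ^ m / fact m) - (- ((1 - 0) ^ m / fact m)))) {0..1}"
    by (rule fundamental_theorem_of_calculus) (use d in auto)
  have "continuous_on {0..1} (taylor_weight m)"
    unfolding taylor_weight_def by (intro continuous_intros) auto
  hence si: "set_integrable lborel {0..1} (taylor_weight m)" by (rule borel_integrable_atLeastAtMost')
  have "(LINT t:{0..1}|lborel. taylor_weight m t) = integral {0..1} (taylor_weight m)"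
    using set_borel_integral_eq_integral(2)[OF si] .
  also have "\<dots> = 1 / fact m" using integral_unique[OF hi] assms by simp
  finally show ?thesis by (simp add: set_lebesgue_integral_def)
qed

text \<open>
  The boundary of a convex set is negligible.
\<close>
lemma nn_integral_interior_convex:
  fixes K :: "(real ^ ('n::finite)) set"
  assumes "convex K"
  shows "(\<integral>\<^sup>+y\<in>K. F y \<partial>lebesgue) = (\<integral>\<^sup>+y. indicator (interior K) y * F y \<partial>lborel)"
proof -
  have "frontier K \<in> null_sets lebesgue"
    using negligible_convex_frontier[OF assms] by (simp add: negligible_iff_null_sets)
  hence "AE y in lebesgue. y \<notin> frontier K" by (rule AE_not_in)
  hence "AE y in lebesgue. F y * indicator K y = indicator (interior K) y * F y"
  proof eventually_elim
    case (elim y)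
    have "y \<in> K \<longleftrightarrow> y \<in> interior K"
      using elim interior_subset[of K] closure_subset[of K] by (auto simp: frontier_def)
    thus ?case by (simp add: indicator_def)
  qed
  hence "(\<integral>\<^sup>+y\<in>K. F y \<partial>lebesgue) = (\<integral>\<^sup>+y. indicator (interior K) y * F y \<partial>lebesgue)"
    by (rule nn_integral_cong_AE)
  thus ?thesis by (simp add: nn_integral_completion)
qed

section \<open>The theorem\<close>

theorem theorem1p3:
  fixes K :: "(real ^ ('n::finite)) set"
    and f :: "real ^ 'n \<Rightarrow> real"
    and m :: nat and p :: real
  assumes "m \<ge> 1" and "1 < p"
    and "bounded K" and "convex K" and "K = uminus ` K" and "0 \<in> K" and "interior K \<noteq> {}"
    and "f \<in> sobolev_space m p"
  shows "((\<lambda>\<delta>::real.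
            \<integral>\<^sup>+z\<in>{(x, y). \<bar>taylor_remainder (m - 1) f x y\<bar> > \<delta>}.
              ennreal (\<delta> powr p / norm_of_ball K (fst z - snd z) powr (real CARD('n) + real m * p))
            \<partial>(lebesgue :: ((real ^ 'n) \<times> (real ^ 'n)) measure))
          \<longlongrightarrow>
          ennreal ((real CARD('n) + real m * p) / (fact m powr p * (real m * p))) *
            (\<integral>\<^sup>+x. (\<integral>\<^sup>+y\<in>K. ennreal (\<bar>deriv_form m f x y\<bar> powr p) \<partial>lebesgue) \<partial>lebesgue))
         (at_right 0)"
proof -
  let ?c = "(real CARD('n) + real m * p) / (real m * p) * (1 / fact m) powr p"
  let ?M = "lborel :: ((real ^ 'n) \<times> (real ^ 'n)) measure"
  let ?J = "\<lambda>\<delta>. \<integral>\<^sup>+z\<in>{(x, y). \<bar>taylor_remainder (m - 1) f x y\<bar> > \<delta>}.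
              ennreal (\<delta> powr p / norm_of_ball K (fst z - snd z) powr (real CARD('n) + real m * p))
            \<partial>(lebesgue :: ((real ^ 'n) \<times> (real ^ 'n)) measure)"
  have K: "bounded K" "convex K" "0 \<in> interior K"
    using assms zero_in_interior_symmetric_convex by auto
  have m: "m \<ge> 1" and p: "p > 1" using assms by auto
  \<comment> \<open>Borel versions \<open>g \<alpha>\<close> of the weak derivatives and \<open>f'\<close> of \<open>f\<close> replace the Lebesgue measurable representatives.\<close>
  define good where "good \<alpha> g \<longleftrightarrow> g \<in> borel_measurable borel \<and> (AE x in lborel. weak_deriv \<alpha> f x = g x) \<and>
    locally_integrable g \<and> integrable lborel (\<lambda>x. \<bar>g x\<bar> powr p) \<and> has_weak_deriv f \<alpha> (weak_deriv \<alpha> f)" for \<alpha> g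
  define g where "g \<alpha> = (SOME g. good \<alpha> g)" for \<alpha>
  have g: "good \<alpha> (g \<alpha>)" if \<alpha>: "mi_order \<alpha> \<le> m" for \<alpha>
  proof -
    obtain u where "good \<alpha> u"
      using sobolev_space_weak_deriv[OF assms(8) \<alpha>] unfolding good_def by blast
    thus ?thesis unfolding g_def by (rule someI[of "good \<alpha>"])
  qed
  have gm: "g \<alpha> \<in> borel_measurable borel" and gae: "AE x in lborel. weak_deriv \<alpha> f x = g \<alpha> x"
    and gl: "locally_integrable (g \<alpha>)" and gi: "integrable lborel (\<lambda>x. \<bar>g \<alpha> x\<bar> powr p)"
    and gw: "has_weak_deriv f \<alpha> (weak_deriv \<alpha> f)" if "mi_order \<alpha> \<le> m" for \<alpha>
    using g[OF that] by (auto simp: good_def)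
  have floc: "locally_integrable f"
    using gw[of "\<lambda>_. 0"] by (simp add: mi_order_def has_weak_deriv_def)
  obtain f' where f' [measurable]: "f' \<in> borel_measurable borel" and fae: "AE x in lborel. f x = f' x"
    using lebesgue_borel_version[OF locally_integrable_measurable[OF floc]] .
  have fl: "locally_integrable f'" by (rule locally_integrable_cong_AE[OF floc f' fae])
  have weak: "(\<integral>y. f' y * mi_deriv \<alpha> \<phi> y \<partial>lborel) = (-1) ^ mi_order \<alpha> * (\<integral>y. g \<alpha> y * \<phi> y \<partial>lborel)"
    if "mi_order \<alpha> \<le> m" "test_function \<phi>" for \<alpha> \<phi>
    by (rule has_weak_deriv_borel_version[OF gw[OF that(1)] that(2) f' fae gm[OF that(1)] gae[OF that(1)]])
  define G where "G h y = directional_form m (\<lambda>\<alpha>. g \<alpha> y) h" for h y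
  define R where "R x y = f' x - (\<Sum>j<m. directional_form j (\<lambda>\<alpha>. g \<alpha> y) (x - y) / fact j)" for x y
  \<comment> \<open>By the rescaling and the weak Taylor formula, \<open>A \<epsilon>\<close> is the double integral at \<open>\<delta> = \<epsilon>\<^sup>m\<close>.\<close>
  define A where "A \<epsilon> = (\<integral>\<^sup>+h. ball_kernel K m p h * emeasure lborel {y. \<bar>segment_mean (taylor_weight m) (\<epsilon> *\<^sub>R h) (G h) y\<bar> > 1} \<partial>lborel)" for \<epsilon>
  have Gm: "(\<lambda>(h, y). G h y) \<in> borel_measurable (borel \<Otimes>\<^sub>M borel)"
    unfolding G_def case_prod_beta'
    by (intro borel_measurable_directional_form measurable_fst) (auto intro!: measurable_compose[OF measurable_snd] gm)
  have Rm: "(\<lambda>(x, y). R x y) \<in> borel_measurable (borel \<Otimes>\<^sub>M borel)"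
    unfolding R_def case_prod_beta'
    by (intro borel_measurable_diff borel_measurable_sum borel_measurable_divide borel_measurable_directional_form borel_measurable_const)
       (auto intro!: measurable_compose[OF measurable_snd] measurable_compose[OF measurable_fst] gm)
  have Ghom: "G (s *\<^sub>R h) y = s ^ m * G h y" for s h y by (simp add: G_def directional_form_scale)
  have fin: "top_energy K p G < \<infinity>"
    unfolding G_def[abs_def] using gm gi by (intro top_energy_finite K p) auto
  have energy: "(\<integral>\<^sup>+x. (\<integral>\<^sup>+y\<in>K. ennreal (\<bar>deriv_form m f x y\<bar> powr p) \<partial>lebesgue) \<partial>lebesgue) = top_energy K p G"
  proof -
    have "finite {\<alpha> :: 'n multi_index. mi_order \<alpha> \<le> m}" by (rule finite_mi_order_le)
    hence "AE x in lborel. \<forall>\<alpha>\<in>{\<alpha>. mi_order \<alpha> \<le> m}. weak_deriv \<alpha> f x = g \<alpha> x"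
      using gae by (intro AE_finite_allI) auto
    hence "AE x in lborel. \<forall>h. deriv_form m f x h = G h x"
      by eventually_elim (auto simp: deriv_form_eq_directional_form G_def intro!: directional_form_cong)
    thus ?thesis unfolding nn_integral_interior_convex[OF K(2)] unfolding nn_integral_completion top_energy_def
      by (intro nn_integral_cong_AE) (auto elim!: eventually_mono)
  qed
  have lhs: "?J \<delta> = A (\<delta> powr (1 / m))" if \<delta>: "\<delta> > 0" for \<delta>
  proof -
    let ?\<epsilon> = "\<delta> powr (1 / m)"
    let ?mean = "\<lambda>h. segment_mean (taylor_weight m) (?\<epsilon> *\<^sub>R h) (G h)"
    have \<epsilon>m: "?\<epsilon> ^ m = \<delta>" using \<delta> m by (simp add: powr_realpow[symmetric] powr_powr)
    have "AE y in lborel. \<forall>\<alpha>\<in>{\<alpha>. mi_order \<alpha> \<le> m}. weak_deriv \<alpha> f y = g \<alpha> y"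
      using gae by (intro AE_finite_allI finite_mi_order_le) auto
    hence "AE z in ?M. \<forall>\<alpha>\<in>{\<alpha>. mi_order \<alpha> \<le> m}. weak_deriv \<alpha> f (snd z) = g \<alpha> (snd z)"
      by (rule AE_lborel_pair_snd)
    moreover have "AE z in ?M. f (fst z) = f' (fst z)"
      using fae by (rule AE_lborel_pair_fst)
    ultimately have "AE z in ?M. taylor_remainder (m - 1) f (fst z) (snd z) = R (fst z) (snd z)"
    proof eventually_elim
      case (elim z)
      have "directional_form j (\<lambda>\<alpha>. weak_deriv \<alpha> f (snd z)) h = directional_form j (\<lambda>\<alpha>. g \<alpha> (snd z)) h" if "j < m" for j h
        using elim(1) that by (intro directional_form_cong) auto
      thus ?case unfolding taylor_remainder_eq_directional_forms[OF m] R_def using elim(2) by simp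
    qed
    hence "AE z in lebesgue. ennreal (\<delta> powr p / norm_of_ball K (fst z - snd z) powr (real CARD('n) + real m * p))
        * indicator {(x, y). \<bar>taylor_remainder (m - 1) f x y\<bar> > \<delta>} z
      = ennreal (\<delta> powr p / norm_of_ball K (fst z - snd z) powr (real CARD('n) + real m * p))
        * indicator {(x, y). \<bar>R x y\<bar> > \<delta>} (z :: (real ^ 'n) \<times> (real ^ 'n))"
      by (intro AE_completion) (auto elim!: eventually_mono simp: indicator_def case_prod_beta)
    from nn_integral_cong_AE[OF this]
    have "?J \<delta>
      = (\<integral>\<^sup>+h. ball_kernel K m p h * emeasure lborel {y. \<bar>R (y + ?\<epsilon> *\<^sub>R h) y\<bar> > \<delta>} \<partial>lborel)"
      unfolding nn_integral_completion nn_integral_ball_kernel_rescale[OF K m \<delta> Rm] .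
    also have "\<dots> = A ?\<epsilon>" unfolding A_def
    proof (intro nn_integral_cong arg_cong2[where f = "(*)"] refl)
      fix h
      have "AE y in lborel. R (y + ?\<epsilon> *\<^sub>R h) y = segment_mean (taylor_weight m) (?\<epsilon> *\<^sub>R h) (G (?\<epsilon> *\<^sub>R h)) y"
        using weak_taylor_formula[OF m f' fl gm gl weak, of "?\<epsilon> *\<^sub>R h"]
        unfolding R_def G_def[abs_def] by simp
      moreover have "segment_mean (taylor_weight m) (?\<epsilon> *\<^sub>R h) (G (?\<epsilon> *\<^sub>R h)) y = \<delta> * ?mean h y" for y
        unfolding segment_mean_def integral_mult_right_zero[symmetric] Ghom \<epsilon>m by (simp add: mult_ac)
      ultimately have ae: "AE y in lborel. (\<bar>R (y + ?\<epsilon> *\<^sub>R h) y\<bar> > \<delta>) = (\<bar>?mean h y\<bar> > 1)"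
        using \<delta> by (auto elim!: eventually_mono simp: abs_mult)
      have [measurable]: "G h \<in> borel_measurable borel"
        using measurable_compose[OF measurable_Pair1'[of h borel borel] Gm] by simp
      have "(\<lambda>y. (y + ?\<epsilon> *\<^sub>R h, y)) \<in> borel \<rightarrow>\<^sub>M borel \<Otimes>\<^sub>M borel"
        by (intro measurable_Pair borel_measurable_continuous_onI continuous_intros)
      from measurable_compose[OF this Rm]
      have [measurable]: "(\<lambda>y. R (y + ?\<epsilon> *\<^sub>R h) y) \<in> borel_measurable borel" by simp
      have [measurable]: "?mean h \<in> borel_measurable borel"
        by (rule borel_measurable_segment_mean[OF borel_measurable_taylor_weight taylor_weight_bound]) measurable
      have "{y \<in> space lborel. \<bar>R (y + ?\<epsilon> *\<^sub>R h) y\<bar> > \<delta>} \<in> sets lborel"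
        "{y \<in> space lborel. \<bar>?mean h y\<bar> > 1} \<in> sets lborel"
        by measurable
      with ae show "emeasure lborel {y. \<bar>R (y + ?\<epsilon> *\<^sub>R h) y\<bar> > \<delta>} = emeasure lborel {y. \<bar>?mean h y\<bar> > 1}"
        by (intro emeasure_eq_AE) simp_all
    qed
    finally show ?thesis .
  qed
  have "(A \<longlongrightarrow> ennreal (?c) * top_energy K p G) (at 0)"
    unfolding tendsto_at_iff_sequentially A_def o_def
  proof (intro allI impI)
    fix X :: "nat \<Rightarrow> real" assume "X \<longlonglongrightarrow> 0"
    moreover have "(1 / fact m :: real) > 0" by simp
    ultimately show "(\<lambda>n. \<integral>\<^sup>+h. ball_kernel K m p h * emeasure lborel {y. \<bar>segment_mean (taylor_weight m) (X n *\<^sub>R h) (G h) y\<bar> > 1} \<partial>lborel)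
      \<longlonglongrightarrow> ennreal (?c) * top_energy K p G"
      using kernel_segment_mean_level_tendsto[OF K m p Gm Ghom borel_measurable_taylor_weight taylor_weight_bound
        integral_taylor_weight[OF m] _ fin] by blast
  qed
  moreover have "filterlim (\<lambda>\<delta> :: real. \<delta> powr (1 / m)) (at 0) (at_right 0)"
    unfolding filterlim_at
  proof
    show "\<forall>\<^sub>F \<delta> :: real in at_right 0. \<delta> powr (1 / m) \<in> UNIV \<and> \<delta> powr (1 / m) \<noteq> 0"
      by (intro eventually_at_rightI[of 0 1]) auto
    have "((\<lambda>\<delta> :: real. \<delta> powr (1 / m)) \<longlongrightarrow> 0 powr (1 / m)) (at_right 0)"
    proof (rule tendsto_powr')
      have "\<forall>\<^sub>F \<delta> :: real in at_right 0. 0 \<le> \<delta>" by (intro eventually_at_rightI[of 0 1]) auto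
      thus "(0 :: real) \<noteq> 0 \<or> 0 < 1 / real m \<and> (\<forall>\<^sub>F \<delta> :: real in at_right 0. 0 \<le> \<delta>)" using m by simp
    qed (auto intro: tendsto_intros)
    thus "((\<lambda>\<delta> :: real. \<delta> powr (1 / m)) \<longlongrightarrow> 0) (at_right 0)" by simp
  qed
  ultimately have "((\<lambda>\<delta>. A (\<delta> powr (1 / m))) \<longlongrightarrow> ennreal (?c) * top_energy K p G) (at_right 0)"
    by (rule filterlim_compose)
  moreover have "?c = (real CARD('n) + real m * p) / (fact m powr p * (real m * p))"
    by (simp add: powr_divide)
  moreover have "\<forall>\<^sub>F \<delta> in at_right 0. A (\<delta> powr (1 / m)) =
      ?J \<delta>"
    using lhs by (intro eventually_at_rightI[of 0 1]) auto
  ultimately show ?thesis unfolding energy using Lim_transform_eventually by simp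
qed

end
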